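(* Let $0<\alpha<n$ and $1<p<n/\alpha$, and define $q$ by $\frac1p-\frac1q=\frac{\alpha}{n}$. Suppose $(u,\sigma)$ is a pair of weights with $[u,\sigma]_{A_{s(p)}}<\infty$. If $u\in A_\infty$, then $$\|I_\alpha(\,\cdot\,\sigma)\|_{L^p(\sigma)\to L^{q,\infty}(u)}\lesssim [u,\sigma]_{A_{s(p)}}^{\frac1q}\,[u]_{A_\infty'}^{\frac1{p'}}.$$ Moreover, if both $u$ and $\sigma$ belong to $A_\infty$, then $$\|I_\alpha(\,\cdot\,\sigma)\|_{L^p(\sigma)\to L^{q}(u)}\lesssim [u,\sigma]_{A_{s(p)}}^{\frac1q}\Big([u]_{A_\infty'}^{\frac1{p'}}+[\sigma]_{A_\infty'}^{\frac1q}\Big).$$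
   Context: All functions are on $\mathbb{R}^n$; suprema over $Q$ are over all cubes in $\mathbb{R}^n$ with sides parallel to the axes; $|Q|$ is Lebesgue measure, $\frac{1}{|Q|}\int_Q$ is the average over $Q$, and $w(Q)=\int_Q w\,dx$. A weight is a non-negative locally integrable function. For $1<r<\infty$, $r'=r/(r-1)$. Riesz potential: $I_\alpha f(x)=\int_{\mathbb{R}^n}\frac{f(y)}{|x-y|^{n-\alpha}}\,dy$. $s(p)=1+\frac{q}{p'}$. For $1<r<\infty$ and a pair of weights, $[u,\sigma]_{A_r}=\sup_Q\big(\frac1{|Q|}\int_Q u\,dx\big)\big(\frac1{|Q|}\int_Q\sigma\,dx\big)^{r-1}$. $w\in A_\infty$ means $[w]_{A_\infty}=\sup_Q\exp\big(\frac1{|Q|}\int_Q-\log w(x)\,dx\big)\big(\frac1{|Q|}\int_Q w\,dx\big)<\infty$. $[w]_{A_\infty'}=\sup_Q\frac{1}{w(Q)}\int_Q M(\chi_Q w)(x)\,dx$, where $M$ is the Hardy–Littlewood maximal operator, $Mf(x)=\sup_{Q\ni x}\frac{1}{|Q|}\int_Q|f|\,dy$. $\|f\|_{L^p(\sigma)}=(\int|f|^p\sigma\,dx)^{1/p}$ and $\|g\|_{L^{q,\infty}(u)}=\sup_{t>0}t\,u(\{x:|g(x)|>t\})^{1/q}$. The quantity $\|I_\alpha(\,\cdot\,\sigma)\|_{L^p(\sigma)\to X}$ is the smallest constant $C$ such that $\|I_\alpha(f\sigma)\|_X\le C\|f\|_{L^p(\sigma)}$ for all $f\in L^p(\sigma)$.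 $A\lesssim B$ means $A\le CB$ with $C$ depending only on $\alpha,p,n$ (not on the weights). *)

theory Defs
  imports "HOL-Analysis.Analysis"
begin

section \<open>Extended-valued auxiliaries\<close>

text \<open>Only used with exponent \<open>a > 0\<close>, where \<open>\<infinity>\<^sup>a = \<infinity>\<close>.\<close>
definition ennpowr :: "ennreal \<Rightarrow> real \<Rightarrow> ennreal" where
  "ennpowr x a = (if x = \<infinity> then \<infinity> else ennreal (enn2real x powr a))"

definition eexp :: "ereal \<Rightarrow> ennreal" where
  "eexp x = (case x of ereal r \<Rightarrow> ennreal (exp r) | PInfty \<Rightarrow> \<infinity> | MInfty \<Rightarrow> 0)"

text \<open>\<open>- log t\<close> for \<open>t \<ge> 0\<close>; the library has \<open>ln 0 = 0\<close>, whereas here \<open>- log 0 = \<infinity>\<close>.\<close>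
definition neg_log :: "real \<Rightarrow> ereal" where
  "neg_log t = (if t = 0 then \<infinity> else ereal (- ln t))"

text \<open>The Lebesgue integral as integral of the positive part minus integral of the negative
  part. When both are infinite, the value is \<open>\<infinity> - \<infinity> = \<infinity>\<close> (arithmetic of \<^typ>\<open>ereal\<close>), so the
  absolute value is finite exactly when the integral converges absolutely. (The Bochner
  integral would be 0 when it does not.)\<close>
definition eintegral :: "'a measure \<Rightarrow> ('a \<Rightarrow> ereal) \<Rightarrow> ereal" where
  "eintegral M f =
     enn2ereal (\<integral>\<^sup>+ x. e2ennreal (f x) \<partial>M) - enn2ereal (\<integral>\<^sup>+ x. e2ennreal (- f x) \<partial>M)"

section \<open>Cubes, averages, weights\<close>

definition cubes :: "(real ^ 'n) set set" where
  "cubes = {cbox a (\<chi> i. a $ i + l) | a l. l > 0}"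

definition avg :: "(real ^ 'n) set \<Rightarrow> (real ^ 'n \<Rightarrow> ennreal) \<Rightarrow> ennreal" where
  "avg Q f = (\<integral>\<^sup>+ x\<in>Q. f x \<partial>lebesgue) / emeasure lebesgue Q"

definition weight :: "(real ^ 'n \<Rightarrow> real) \<Rightarrow> bool" where
  "weight w \<longleftrightarrow> (\<forall>x. w x \<ge> 0) \<and> (\<forall>K. compact K \<longrightarrow> w absolutely_integrable_on K)"

definition wmass :: "(real ^ 'n \<Rightarrow> real) \<Rightarrow> (real ^ 'n) set \<Rightarrow> ennreal" where
  "wmass w S = (\<integral>\<^sup>+ x\<in>S. ennreal (w x) \<partial>lebesgue)"

definition maximal :: "(real ^ 'n \<Rightarrow> real) \<Rightarrow> real ^ 'n \<Rightarrow> ennreal" where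
  "maximal f x = (SUP Q\<in>{Q \<in> cubes. x \<in> Q}. avg Q (\<lambda>y. ennreal \<bar>f y\<bar>))"

section \<open>Weight characteristics\<close>

definition Ar_const :: "real \<Rightarrow> (real ^ 'n \<Rightarrow> real) \<Rightarrow> (real ^ 'n \<Rightarrow> real) \<Rightarrow> ennreal" where
  "Ar_const r u \<sigma> =
     (SUP Q\<in>cubes. avg Q (\<lambda>x. ennreal (u x)) * ennpowr (avg Q (\<lambda>x. ennreal (\<sigma> x))) (r - 1))"

text \<open>For a weight \<open>w\<close>, the positive part of \<open>log w\<close> is integrable over \<open>Q\<close>, so the average
  of \<open>- log w\<close> is well defined in \<open>(-\<infinity>, \<infinity>]\<close>. If \<open>w\<close> vanishes almost everywhere on \<open>Q\<close>,
  the product is read as \<open>\<infinity> * 0 = 0\<close>.\<close>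
definition Ainf_const :: "(real ^ 'n \<Rightarrow> real) \<Rightarrow> ennreal" where
  "Ainf_const w =
     (SUP Q\<in>cubes.
        eexp (eintegral lebesgue (\<lambda>x. indicator Q x * neg_log (w x)) / ereal (measure lebesgue Q))
        * avg Q (\<lambda>x. ennreal (w x)))"

definition Ainf :: "(real ^ 'n \<Rightarrow> real) set" where
  "Ainf = {w. weight w \<and> Ainf_const w < \<infinity>}"

text \<open>If \<open>w(Q) = 0\<close>, the quotient is \<open>0 / 0 = 0\<close>.\<close>
definition Ainf'_const :: "(real ^ 'n \<Rightarrow> real) \<Rightarrow> ennreal" where
  "Ainf'_const w =
     (SUP Q\<in>cubes. (\<integral>\<^sup>+ x\<in>Q. maximal (\<lambda>y. indicator Q y * w y) x \<partial>lebesgue) / wmass w Q)"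

section \<open>Norms and the Riesz potential\<close>

definition Lnorm :: "real \<Rightarrow> (real ^ 'n \<Rightarrow> real) \<Rightarrow> (real ^ 'n \<Rightarrow> ereal) \<Rightarrow> ennreal" where
  "Lnorm p w g =
     ennpowr (\<integral>\<^sup>+ x. ennpowr (e2ennreal \<bar>g x\<bar>) p * ennreal (w x) \<partial>lebesgue) (1 / p)"

definition weak_Lnorm :: "real \<Rightarrow> (real ^ 'n \<Rightarrow> real) \<Rightarrow> (real ^ 'n \<Rightarrow> ereal) \<Rightarrow> ennreal" where
  "weak_Lnorm q w g =
     (SUP t\<in>{0<..}. ennreal t * ennpowr (wmass w {x. \<bar>g x\<bar> > ereal t}) (1 / q))"

definition Lspace :: "real \<Rightarrow> (real ^ 'n \<Rightarrow> real) \<Rightarrow> (real ^ 'n \<Rightarrow> real) set" where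
  "Lspace p w = {f \<in> borel_measurable lebesgue. Lnorm p w (\<lambda>x. ereal (f x)) < \<infinity>}"

definition riesz :: "real \<Rightarrow> (real ^ 'n \<Rightarrow> real) \<Rightarrow> real ^ 'n \<Rightarrow> ereal" where
  "riesz \<alpha> f x =
     eintegral lebesgue (\<lambda>y. ereal (f y / norm (x - y) powr (real CARD('n) - \<alpha>)))"

text \<open>The smallest constant in the inequality, \<open>\<infinity>\<close> if there is none; \<open>X\<close> is the target norm.\<close>
definition riesz_opnorm ::
  "real \<Rightarrow> real \<Rightarrow> (real ^ 'n \<Rightarrow> real) \<Rightarrow> ((real ^ 'n \<Rightarrow> ereal) \<Rightarrow> ennreal) \<Rightarrow> ennreal" where
  "riesz_opnorm \<alpha> p \<sigma> X =
     Inf {C. \<forall>f\<in>Lspace p \<sigma>.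
            X (riesz \<alpha> (\<lambda>x. f x * \<sigma> x)) \<le> C * Lnorm p \<sigma> (\<lambda>x. ereal (f x))}"

definition conj_exp :: "real \<Rightarrow> real" where
  "conj_exp r = r / (r - 1)"

definition s_exp :: "real \<Rightarrow> real \<Rightarrow> real" where
  "s_exp p q = 1 + q / conj_exp p"

end

theory Submission
  imports Defs
begin

text \<open>By the one third trick, \<open>I\<^sub>\<alpha>\<close> is dominated by finitely many dyadic operators, so by duality it
  suffices to bound, with \<open>e = n - \<alpha>\<close> and for a finite family of dyadic cubes, the form
  \<open>\<Sum>\<^sub>Q |Q|\<^bsup>-e/n\<^esup> \<integral>\<^sub>Q f\<sigma> \<integral>\<^sub>Q gu\<close>; since \<open>\<alpha> > 0\<close>, the family may be taken sparse, so that both \<open>u\<close> and \<open>\<sigma>\<close>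
  satisfy a Carleson condition whose constant is the \<open>A\<^sub>\<infinity>'\<close> characteristic.
  Stop whenever the \<open>\<sigma>\<close>-average of \<open>f\<close> or the \<open>u\<close>-average of \<open>g\<close> over the ancestors doubles.
  Between stopping cubes the averages are frozen, and the two-weight condition alone gives
  \<open>\<Sum>\<^bsub>Q \<subseteq> H\<^esub> |Q|\<^bsup>-e/n\<^esup> \<sigma>(Q)u(Q) \<lesssim> [u,\<sigma>]\<^bsup>1/q\<^esup> \<sigma>(H)\<^bsup>1/p\<^esup> u(H)\<^bsup>1/q'\<^esup>\<close>. The sum over stopping cubes for \<open>g\<close> is treated by
  Hoelder's inequality with exponents \<open>q, q'\<close>: for \<open>g\<close> the stopping cubes are automatically
  Carleson, while for \<open>f\<close> one pays \<open>[\<sigma>]\<^bsup>1/q\<^esup>\<close> because \<open>q > p\<close>. The stopping cubes for \<open>f\<close> symmetrically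
  cost \<open>[u]\<^bsup>1/p'\<^esup>\<close>. For the weak type bound \<open>g\<close> is an indicator function, and the first sum can be
  organised by the levels of \<open>g\<close>, which decay geometrically, without any characteristic of \<open>\<sigma>\<close>.\<close>

section \<open>Sums of geometric type and Hoelder's inequality\<close>

text \<open>Cubes are stopped twice, for different averages. The first selection uses Lebesgue
  averages of \<open>F\<close>, the measure f\<sigma> dx, because a characteristic built from
  M(\<chi>_Q w) compares w with Lebesgue measure; the surviving cubes carry the Carleson conditions.
  The second uses averages of f against \<sigma> and of g against u, since these are controlled in
  L^p(\<sigma>) and L^r(u), r = q', with no property of the weights. The kernel sum decays at small
  scales because 1/p' + 1/q = 1 - \<alpha>/n < 1. All families are finite, so maxima over ancestors
  exist and a dyadic potential has a finite norm, by which duality may divide. The price is a limit: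
  the grids are translated by 2^N/3 with N the top scale, the potentials are not monotone in N, and
  Fatou's lemma takes the place of monotone convergence. If an A_\<infinity>' characteristic is
  infinite, the bound is trivial unless the two-weight constant is 0, where 0 * \<infinity> = 0. In
  that case no cube is charged by both f\<sigma> and gu. Hence the lemmas ask for finite
  characteristics only when that constant is positive.\<close>

lemma geometric_int_sum_le:
  fixes K :: "int set" and c r y :: real
  assumes "finite K" and r: "r > 0" and c: "c \<ge> 0" and y: "y \<ge> 0"
    and le: "\<And>k. k \<in> K \<Longrightarrow> c * 2 powr (r * k) \<le> y"
  shows "(\<Sum>k\<in>K. c * 2 powr (r * k)) \<le> y / (1 - 2 powr (- r))"
proof (cases "K = {}")
  case False
  define w :: real where "w = 2 powr (- r)"
  have w: "0 < w" "w < 1" using r by (auto simp: w_def powr_less_one)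
  \<comment> \<open>Only the top term is compared with y; the others lie at distinct integer
    distances below it and are dominated by a full geometric series.\<close>
  define m where "m = Max K"
  have m: "m \<in> K" "\<And>k. k \<in> K \<Longrightarrow> k \<le> m" using False assms(1) by (auto simp: m_def)
  have eq: "c * 2 powr (r * k) = c * 2 powr (r * m) * w ^ nat (m - k)" if "k \<in> K" for k
  proof -
    have "w ^ nat (m - k) = 2 powr (- r * (m - k))"
      using m(2)[OF that] by (simp add: w_def powr_powr flip: powr_realpow)
    then show ?thesis by (simp add: algebra_simps flip: powr_add)
  qed
  have "(\<Sum>k\<in>K. c * 2 powr (r * k)) = c * 2 powr (r * m) * (\<Sum>k\<in>K. w ^ nat (m - k))"
    unfolding sum_distrib_left by (intro sum.cong refl eq)
  also have "(\<Sum>k\<in>K. w ^ nat (m - k)) = (\<Sum>j\<in>(\<lambda>k. nat (m - k)) ` K. w ^ j)"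
    using m(2) by (subst sum.reindex) (auto simp: inj_on_def eq_nat_nat_iff)
  also have "\<dots> \<le> (\<Sum>j. w ^ j)"
    using w assms(1) by (intro sum_le_suminf) auto
  also have "\<dots> = 1 / (1 - w)" using w by (intro suminf_geometric) auto
  finally have "(\<Sum>k\<in>K. c * 2 powr (r * k)) \<le> c * 2 powr (r * m) * (1 / (1 - w))"
    using c by (simp add: mult_left_mono)
  also have "\<dots> \<le> y * (1 / (1 - w))"
    using le[OF m(1)] w by (intro mult_right_mono) auto
  finally show ?thesis by (simp add: w_def)
qed (use y r powr_mono[of "- r" 0 "2::real"] in \<open>auto intro!: divide_nonneg_nonneg\<close>)

lemma sum_powr_weighted_le_one:
  fixes x y :: "'a \<Rightarrow> real"
  assumes "\<And>i. i \<in> I \<Longrightarrow> x i > 0" "\<And>i. i \<in> I \<Longrightarrow> y i > 0"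
    and "sum x I \<le> 1" "sum y I \<le> 1" and "a \<ge> 0" "b \<ge> 0" "a + b = 1"
  shows "(\<Sum>i\<in>I. x i powr a * y i powr b) \<le> 1"
proof -
  have "(\<Sum>i\<in>I. x i powr a * y i powr b) \<le> (\<Sum>i\<in>I. a * x i + b * y i)"
    using assms by (intro sum_mono Youngs_inequality_0) auto
  also have "\<dots> = a * sum x I + b * sum y I" by (simp add: sum.distrib sum_distrib_left)
  also have "\<dots> \<le> a * 1 + b * 1" using assms by (intro add_mono mult_left_mono) auto
  finally show ?thesis using assms by simp
qed

text \<open>X and Y are upper bounds rather than the sums themselves, so that estimates can be
  inserted directly. Young's inequality is applied after normalising by them; a bound \<le> 0 is
  treated apart, as it makes the corresponding factors vanish.\<close>

lemma Holder_sum: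
  fixes x y :: "'a \<Rightarrow> real"
  assumes "p > 1" "r > 1" "1/p + 1/r = 1"
    and "\<And>i. i \<in> I \<Longrightarrow> x i \<ge> 0" "\<And>i. i \<in> I \<Longrightarrow> y i \<ge> 0"
    and X: "(\<Sum>i\<in>I. x i powr p) \<le> X" and Y: "(\<Sum>i\<in>I. y i powr r) \<le> Y"
  shows "(\<Sum>i\<in>I. x i * y i) \<le> X powr (1/p) * Y powr (1/r)"
proof (cases "finite I \<and> X > 0 \<and> Y > 0")
  case True
  define s t where "s = X powr (1/p)" and "t = Y powr (1/r)"
  have st: "s > 0" "t > 0" "s powr p = X" "t powr r = Y"
    using True assms by (auto simp: s_def t_def powr_powr)
  have "(\<Sum>i\<in>I. (x i / s) * (y i / t)) \<le> (\<Sum>i\<in>I. (x i / s) powr p / p + (y i / t) powr r / r)"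
    using assms st by (intro sum_mono Youngs_inequality) auto
  also have "\<dots> = (\<Sum>i\<in>I. x i powr p) / X / p + (\<Sum>i\<in>I. y i powr r) / Y / r"
    using assms st by (simp add: powr_divide sum.distrib sum_divide_distrib)
  also have "\<dots> \<le> 1 / p + 1 / r"
    using assms True by (intro add_mono divide_right_mono) (auto simp: field_simps)
  finally have "(\<Sum>i\<in>I. (x i / s) * (y i / t)) \<le> 1" using assms by simp
  then have "(\<Sum>i\<in>I. x i * y i) / (s * t) \<le> 1" by (simp add: sum_divide_distrib)
  then show ?thesis using st by (simp add: s_def[symmetric] t_def[symmetric] field_simps)
next
  case False
  consider "infinite I" | "finite I" "X \<le> 0" | "finite I" "Y \<le> 0" using False by force
  then have "(\<Sum>i\<in>I. x i * y i) = 0"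
  proof cases
    case 2
    then have "(\<Sum>i\<in>I. x i powr p) = 0" using X by (intro antisym sum_nonneg) auto
    then have "\<And>i. i \<in> I \<Longrightarrow> x i = 0" using 2 by (subst (asm) sum_nonneg_eq_0_iff) auto
    then show ?thesis by simp
  next
    case 3
    then have "(\<Sum>i\<in>I. y i powr r) = 0" using Y by (intro antisym sum_nonneg) auto
    then have "\<And>i. i \<in> I \<Longrightarrow> y i = 0" using 3 by (subst (asm) sum_nonneg_eq_0_iff) auto
    then show ?thesis by simp
  qed simp
  then show ?thesis by simp
qed

text \<open>Here p' and r are conjugate to p and q. The inequality 1/p' + 1/q < 1 is p < q in
  disguise and gives the kernel sum its decay; r < p' is the same gap seen from the dual side, for
  arguments with f and g exchanged.\<close>

lemma off_diagonal_exponents: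
  fixes p p' q r :: real
  assumes pq: "1 < p" "p < q" "1/p + 1/p' = 1" "1/q + 1/r = 1"
  shows "q > 1" "p' > 1" "r > 1" "r < p'" "1/p' + 1/q < 1" "0 < 1/p' + 1/q" "1 - 1/p' = 1/p" "1 - 1/q = 1/r"
proof -
  show q: "q > 1" using pq by linarith
  have "1/q < 1/p" using pq by (intro divide_strict_left_mono) auto
  moreover have "1/p < 1" using pq by simp
  moreover have "1/p > 0" "1/q > 0" using pq q by auto
  ultimately have *: "0 < 1/p'" "1/p' < 1" "0 < 1/r" "1/r < 1" "1/p' < 1/r" "1/p' + 1/q < 1" using pq by linarith+
  show "p' > 1" "r > 1" using * by (auto simp: divide_less_eq_1 zero_less_divide_iff)
  then show "r < p'" using * by (simp add: field_simps)
  show "1/p' + 1/q < 1" "0 < 1/p' + 1/q" using * \<open>1/q > 0\<close> by linarith+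
  show "1 - 1/p' = 1/p" "1 - 1/q = 1/r" using pq by linarith+
qed

section \<open>Laminar families and stopping sets\<close>

definition laminar :: "'a set set \<Rightarrow> bool" where
  "laminar D \<longleftrightarrow> finite D \<and> {} \<notin> D \<and> (\<forall>Q\<in>D. \<forall>R\<in>D. Q \<subseteq> R \<or> R \<subseteq> Q \<or> disjnt Q R)"

text \<open>A dyadic maximal function, evaluated on sets instead of points. Unlike \<phi> it is
  monotone along chains, so its levels can serve as stopping labels.\<close>

definition anc_max :: "'a set set \<Rightarrow> ('a set \<Rightarrow> real) \<Rightarrow> 'a set \<Rightarrow> real" where
  "anc_max D \<phi> Q = Max (\<phi> ` {R \<in> D. Q \<subseteq> R})"

definition level :: "'a set set \<Rightarrow> ('a set \<Rightarrow> real) \<Rightarrow> 'a set \<Rightarrow> int" where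
  "level D \<phi> Q = \<lfloor>log 2 (anc_max D \<phi> Q)\<rfloor>"

text \<open>The label type is left free: a level marks the sets where the running maximum enters a
  new dyadic range, a pair of levels gives joint stopping, and a constant label yields the maximal
  members.\<close>

definition stops :: "'a set set \<Rightarrow> ('a set \<Rightarrow> 'b) \<Rightarrow> 'a set set" where
  "stops D l = {H \<in> D. \<forall>R\<in>D. H \<subset> R \<longrightarrow> l R \<noteq> l H}"

lemma laminar_finite: "laminar D \<Longrightarrow> finite D"
  by (simp add: laminar_def)

lemma laminar_subset: "laminar D \<Longrightarrow> E \<subseteq> D \<Longrightarrow> laminar E"
  unfolding laminar_def by (auto dest: finite_subset)

lemma stops_subset: "stops D l \<subseteq> D"
  by (auto simp: stops_def)

lemma laminar_chain:
  "laminar D \<Longrightarrow> Q \<in> D \<Longrightarrow> R \<in> D \<Longrightarrow> x \<in> Q \<Longrightarrow> x \<in> R \<Longrightarrow> Q \<subseteq> R \<or> R \<subseteq> Q"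
  unfolding laminar_def disjnt_def by blast

lemma stops_same_level_disjnt:
  assumes "laminar D" "H \<in> stops D l" "H' \<in> stops D l" "l H = l H'" "H \<noteq> H'"
  shows "disjnt H H'"
proof -
  have "H \<in> D" "H' \<in> D" "\<not> H \<subset> H'" "\<not> H' \<subset> H" using assms(2-4) by (auto simp: stops_def)
  then show ?thesis using assms(1,5) unfolding laminar_def by blast
qed

text \<open>Stopping sets through a common point are nested, hence cannot share a label; a sum over
  them becomes a sum over distinct integers, ready for a geometric series.\<close>

lemma inj_on_level_stops:
  assumes "laminar D" "\<And>H. H \<in> T \<Longrightarrow> H \<in> stops D l \<and> x \<in> H"
  shows "inj_on l T"
proof (rule inj_onI, rule ccontr)
  fix H H' assume "H \<in> T" "H' \<in> T" "l H = l H'" "H \<noteq> H'"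
  then show False
    using stops_same_level_disjnt[OF assms(1), of H l H'] assms(2)[of H] assms(2)[of H'] by (auto simp: disjnt_def)
qed

lemma ex_stop:
  assumes "laminar D" "Q \<in> D"
  shows "\<exists>H\<in>stops D l. Q \<subseteq> H \<and> l H = l Q"
proof -
  have fin: "finite {R \<in> D. Q \<subseteq> R \<and> l R = l Q}" using assms by (auto simp: laminar_def)
  have "Q \<in> {R \<in> D. Q \<subseteq> R \<and> l R = l Q}" using assms by auto
  from finite_has_maximal2[OF fin this] obtain H where H: "H \<in> D" "Q \<subseteq> H" "l H = l Q" and
    max: "\<forall>R\<in>{R \<in> D. Q \<subseteq> R \<and> l R = l Q}. H \<subseteq> R \<longrightarrow> H = R" by auto
  have "H \<in> stops D l" using H max by (auto simp: stops_def)
  with H show ?thesis by blast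
qed

text \<open>Every Q is assigned one stopping set by choice. As w \<ge> 0, each class may be enlarged
  to all Q below H with the label of H, so uniqueness of the assignment is never at issue.\<close>

lemma sum_by_stops_le:
  fixes w :: "'a set \<Rightarrow> real"
  assumes "laminar D" "C \<subseteq> D" and "\<And>Q. Q \<in> C \<Longrightarrow> w Q \<ge> 0"
  shows "(\<Sum>Q\<in>C. w Q) \<le> (\<Sum>H\<in>stops D l. \<Sum>Q\<in>{Q \<in> C. Q \<subseteq> H \<and> l Q = l H}. w Q)"
proof -
  have fin: "finite D" using assms by (auto simp: laminar_def)
  have finC: "finite C" using fin assms(2) finite_subset by blast
  have "\<exists>h. \<forall>Q\<in>C. h Q \<in> stops D l \<and> Q \<subseteq> h Q \<and> l (h Q) = l Q"
    using ex_stop[OF assms(1), of _ l] assms(2) by (intro bchoice) blast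
  then obtain h where h: "\<And>Q. Q \<in> C \<Longrightarrow> h Q \<in> stops D l \<and> Q \<subseteq> h Q \<and> l (h Q) = l Q" by blast
  have "(\<Sum>Q\<in>C. w Q) = (\<Sum>H\<in>stops D l. \<Sum>Q\<in>{Q \<in> C. h Q = H}. w Q)"
    using h finC finite_subset[OF stops_subset fin, of l]
    by (intro sum.group[symmetric]) auto
  also have "\<dots> \<le> (\<Sum>H\<in>stops D l. \<Sum>Q\<in>{Q \<in> C. Q \<subseteq> H \<and> l Q = l H}. w Q)"
    using h assms finC by (intro sum_mono sum_mono2) auto
  finally show ?thesis .
qed

section \<open>Running maxima over ancestors and their dyadic levels\<close>

context
  fixes D :: "'a set set" and \<phi> :: "'a set \<Rightarrow> real"
  assumes lam: "laminar D" and pos: "\<And>Q. Q \<in> D \<Longrightarrow> \<phi> Q > 0"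
begin

lemma anc_max_ge: "R \<in> D \<Longrightarrow> Q \<subseteq> R \<Longrightarrow> \<phi> R \<le> anc_max D \<phi> Q"
  unfolding anc_max_def using lam by (intro Max_ge) (auto simp: laminar_def)

lemma anc_max_attained: "Q \<in> D \<Longrightarrow> \<exists>R\<in>D. Q \<subseteq> R \<and> anc_max D \<phi> Q = \<phi> R"
proof -
  assume "Q \<in> D"
  then have "anc_max D \<phi> Q \<in> \<phi> ` {R \<in> D. Q \<subseteq> R}"
    unfolding anc_max_def using lam by (intro Max_in) (auto simp: laminar_def)
  then show ?thesis by auto
qed

lemma anc_max_pos: "Q \<in> D \<Longrightarrow> anc_max D \<phi> Q > 0"
  using anc_max_ge[of Q Q] pos[of Q] by auto

lemma anc_max_antimono: "Q \<subseteq> R \<Longrightarrow> R \<in> D \<Longrightarrow> anc_max D \<phi> R \<le> anc_max D \<phi> Q"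
  by (metis anc_max_attained anc_max_ge dual_order.trans)

lemma level_bounds:
  assumes "Q \<in> D"
  shows "2 powr level D \<phi> Q \<le> anc_max D \<phi> Q" "anc_max D \<phi> Q < 2 * 2 powr level D \<phi> Q"
proof -
  have "level D \<phi> Q \<le> log 2 (anc_max D \<phi> Q)" by (simp add: level_def)
  then show "2 powr level D \<phi> Q \<le> anc_max D \<phi> Q"
    using anc_max_pos[OF assms] by (simp add: le_log_iff)
  have "log 2 (anc_max D \<phi> Q) < 1 + level D \<phi> Q" by (simp add: level_def) linarith
  then show "anc_max D \<phi> Q < 2 * 2 powr level D \<phi> Q"
    using anc_max_pos[OF assms] by (simp add: log_less_iff powr_add)
qed

lemma level_antimono: "Q \<in> D \<Longrightarrow> Q \<subseteq> R \<Longrightarrow> R \<in> D \<Longrightarrow> level D \<phi> R \<le> level D \<phi> Q"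
  unfolding level_def using anc_max_antimono anc_max_pos by (intro floor_mono) auto

text \<open>Were the maximum attained at a strict ancestor, that ancestor would have the same
  running maximum, hence the same level, and H would not stop.\<close>

lemma anc_max_stop:
  assumes "H \<in> stops D (level D \<phi>)"
  shows "anc_max D \<phi> H = \<phi> H"
proof -
  have HD: "H \<in> D" using assms by (auto simp: stops_def)
  obtain R where R: "R \<in> D" "H \<subseteq> R" "anc_max D \<phi> H = \<phi> R" using anc_max_attained[OF HD] by blast
  have "anc_max D \<phi> R = anc_max D \<phi> H"
    using anc_max_antimono[OF R(2,1)] anc_max_ge[OF R(1), of R] R(3) by simp
  then have "level D \<phi> R = level D \<phi> H" by (simp add: level_def)
  then show ?thesis using assms R by (auto simp: stops_def)
qed

end

text \<open>Suppose both levels of H had already occurred above it, at R1 and at R2. These are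
  nested, and monotonicity forces both levels on the smaller one to agree with those of H. Joint
  stopping thus creates no new sets, and a joint sum splits into one sum per function.\<close>

lemma stops_pair_subset:
  fixes \<phi> \<gamma> :: "'a set \<Rightarrow> real"
  assumes lam: "laminar D" and pos: "\<And>Q. Q \<in> D \<Longrightarrow> \<phi> Q > 0" "\<And>Q. Q \<in> D \<Longrightarrow> \<gamma> Q > 0"
  shows "stops D (\<lambda>Q. (level D \<phi> Q, level D \<gamma> Q)) \<subseteq> stops D (level D \<phi>) \<union> stops D (level D \<gamma>)"
proof (rule subsetI, rule ccontr)
  fix H assume H: "H \<in> stops D (\<lambda>Q. (level D \<phi> Q, level D \<gamma> Q))"
    and "H \<notin> stops D (level D \<phi>) \<union> stops D (level D \<gamma>)"
  then obtain R1 R2 where R: "R1 \<in> D" "H \<subset> R1" "level D \<phi> R1 = level D \<phi> H"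
    "R2 \<in> D" "H \<subset> R2" "level D \<gamma> R2 = level D \<gamma> H" by (auto simp: stops_def)
  have HD: "H \<in> D" "H \<noteq> {}" using H lam by (auto simp: stops_def laminar_def)
  then obtain x where "x \<in> H" by auto
  then have "R1 \<subseteq> R2 \<or> R2 \<subseteq> R1" using laminar_chain[OF lam R(1,4), of x] R by auto
  then show False
  proof
    assume "R1 \<subseteq> R2"
    then have "level D \<gamma> R1 = level D \<gamma> H"
      using level_antimono[where \<phi>=\<gamma>, OF lam pos(2), of H R1] level_antimono[where \<phi>=\<gamma>, OF lam pos(2), of R1 R2] R HD by auto
    then show False using H R by (auto simp: stops_def)
  next
    assume "R2 \<subseteq> R1"
    then have "level D \<phi> R2 = level D \<phi> H"
      using level_antimono[where \<phi>=\<phi>, OF lam pos(1), of H R2] level_antimono[where \<phi>=\<phi>, OF lam pos(1), of R2 R1] R HD by auto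
    then show False using H R by (auto simp: stops_def)
  qed
qed

section \<open>Sums over stopping sets: L^p bound, Carleson embedding, kernel sum\<close>

lemma sum_measure_disjnt_le:
  assumes "finite C" "C \<subseteq> fmeasurable M" "pairwise disjnt C" "\<And>Q. Q \<in> C \<Longrightarrow> Q \<subseteq> H" "H \<in> fmeasurable M"
  shows "(\<Sum>Q\<in>C. measure M Q) \<le> measure M H"
proof -
  have "(\<Sum>Q\<in>C. measure M Q) = measure M (\<Union>C)"
    using assms by (intro measure_Union'[symmetric]) auto
  also have "\<dots> \<le> measure M H"
    using assms by (intro measure_mono_fmeasurable) (auto intro!: sets.finite_Union)
  finally show ?thesis .
qed

text \<open>Truncating \<open>f\<close> at half the level of a stopping set still leaves half of its average.\<close>
lemma stop_sum_Lp_le: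
  fixes f :: "'a \<Rightarrow> real" and M :: "'a measure" and D :: "'a set set" and p X :: real
  defines "F \<equiv> density M (\<lambda>x. ennreal (f x))"
  defines "\<phi> \<equiv> \<lambda>Q. measure F Q / measure M Q"
  assumes lam: "laminar D" and DM: "D \<subseteq> fmeasurable M" and DF: "D \<subseteq> fmeasurable F"
    and f: "f \<in> borel_measurable M" "\<And>x. f x \<ge> 0"
    and Mpos: "\<And>Q. Q \<in> D \<Longrightarrow> measure M Q > 0" and Fpos: "\<And>Q. Q \<in> D \<Longrightarrow> measure F Q > 0"
    and p: "p > 1" and X: "(\<integral>\<^sup>+x. ennreal (f x powr p) \<partial>M) \<le> ennreal X" "X \<ge> 0"
  shows "(\<Sum>H\<in>stops D (level D \<phi>). 2 powr (p * level D \<phi> H) * measure M H)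
           \<le> 2 powr p / (1 - 2 powr (1 - p)) * X"
proof -
  define S where "S = stops D (level D \<phi>)"
  define k where "k = level D \<phi>"
  define w where "w = (\<lambda>H x. if x \<in> H \<and> 2 powr (k H - 1) < f x then f x else 0)"
  define C where "C = 2 powr p / (1 - 2 powr (1 - p))"
  have C: "C \<ge> 0" using p powr_mono[of "1 - p" 0 "2::real"] by (auto simp: C_def intro!: divide_nonneg_nonneg)
  have \<phi>pos: "\<phi> Q > 0" if "Q \<in> D" for Q using that Mpos Fpos by (simp add: \<phi>_def)
  have SD: "S \<subseteq> D" "finite S" using stops_subset laminar_finite[OF lam] by (auto simp: S_def intro: finite_subset)
  have meas: "H \<in> sets M" if "H \<in> D" for H using DM that by auto
  have wmeas: "w H \<in> borel_measurable M" if "H \<in> S" for H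
  proof -
    have [measurable]: "f \<in> borel_measurable M" "H \<in> sets M" using f(1) meas that SD by auto
    show ?thesis unfolding w_def by measurable
  qed
  have trunc: "ennreal (2 powr (k H - 1) * measure M H) \<le> (\<integral>\<^sup>+x. ennreal (w H x) \<partial>M)" if H: "H \<in> S" for H
  proof -
    define a :: real where "a = 2 powr (k H - 1)"
    have HD: "H \<in> D" using H SD by auto
    have a: "a > 0" "2 powr k H = 2 * a" by (auto simp: a_def powr_diff)
    have "2 * a \<le> \<phi> H"
      using level_bounds(1)[where \<phi>=\<phi>, OF lam \<phi>pos HD] anc_max_stop[where \<phi>=\<phi>, OF lam \<phi>pos, of H] H unfolding S_def k_def a(2)[symmetric] by simp
    then have "2 * a * measure M H \<le> measure F H"
      using Mpos[OF HD] by (simp add: \<phi>_def field_simps)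
    then have "ennreal (2 * a * measure M H) \<le> emeasure F H"
      using DF HD by (auto simp: emeasure_eq_measure2 intro!: ennreal_leI)
    also have "\<dots> = (\<integral>\<^sup>+x. ennreal (f x) * indicator H x \<partial>M)"
      unfolding F_def using f meas[OF HD] by (subst emeasure_density) auto
    also have "\<dots> \<le> (\<integral>\<^sup>+x. ennreal (w H x) + ennreal a * indicator H x \<partial>M)"
      using a f(2) by (intro nn_integral_mono) (auto simp: w_def a_def indicator_def intro!: ennreal_leI)
    also have "\<dots> = (\<integral>\<^sup>+x. ennreal (w H x) \<partial>M) + ennreal a * emeasure M H"
      using wmeas[OF H] meas[OF HD] by (subst nn_integral_add) (auto simp: nn_integral_cmult_indicator)
    also have "\<dots> = (\<integral>\<^sup>+x. ennreal (w H x) \<partial>M) + ennreal (a * measure M H)"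
      using DM HD a by (auto simp: emeasure_eq_measure2 ennreal_mult)
    finally have *: "ennreal (2 * a * measure M H) \<le> (\<integral>\<^sup>+x. ennreal (w H x) \<partial>M) + ennreal (a * measure M H)" .
    show ?thesis
    proof (cases "(\<integral>\<^sup>+x. ennreal (w H x) \<partial>M)")
      case (real r)
      then show ?thesis using * a unfolding a_def[symmetric] by (simp flip: ennreal_plus)
    qed simp
  qed
  \<comment> \<open>The stopping sets through x have distinct levels, and a contributing one
    satisfies 2^k < 2 f(x). The top term is at most (2 f(x))^p and the ratio is 2^(1-p), which
    explains both parts of \<open>C\<close>; p > 1 makes the series converge.\<close>
  have pw: "(\<Sum>H\<in>S. 2 * 2 powr ((p - 1) * k H) * w H x) \<le> C * f x powr p" for x
  proof (cases "f x = 0")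
    case False
    then have fx: "f x > 0" using f(2)[of x] by linarith
    define T where "T = {H \<in> S. x \<in> H \<and> 2 powr (k H - 1) < f x}"
    have inj: "inj_on k T"
      by (rule inj_on_level_stops[OF lam, of T k x]) (auto simp: T_def S_def k_def)
    have "(\<Sum>H\<in>S. 2 * 2 powr ((p - 1) * k H) * w H x) = (\<Sum>H\<in>T. (2 * f x) * 2 powr ((p - 1) * k H))"
      using SD(2) by (intro sum.mono_neutral_cong_right) (auto simp: T_def w_def)
    also have "\<dots> = (\<Sum>j\<in>k ` T. (2 * f x) * 2 powr ((p - 1) * j))"
      by (simp add: sum.reindex[OF inj] o_def)
    also have "\<dots> \<le> (2 * f x) * (2 * f x) powr (p - 1) / (1 - 2 powr (- (p - 1)))"
    proof (intro geometric_int_sum_le)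
      fix j assume "j \<in> k ` T"
      then have "2 powr (j - 1) \<le> f x" by (auto simp: T_def)
      then have "2 powr j \<le> 2 * f x" by (simp add: powr_diff)
      then have "(2 powr j) powr (p - 1) \<le> (2 * f x) powr (p - 1)"
        using p by (intro powr_mono2) auto
      then show "(2 * f x) * 2 powr ((p - 1) * j) \<le> (2 * f x) * (2 * f x) powr (p - 1)"
        using fx by (simp add: powr_powr mult.commute)
    qed (use fx p SD in \<open>auto simp: T_def\<close>)
    also have "(2 * f x) * (2 * f x) powr (p - 1) = (2 * f x) powr p"
      using fx powr_add[of "2 * f x" 1 "p - 1"] by simp
    also have "\<dots> / (1 - 2 powr (- (p - 1))) = C * f x powr p"
      using fx by (simp add: C_def powr_mult)
    finally show ?thesis .
  qed (simp add: w_def)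
  \<comment> \<open>The power 2^(pk) splits as 2 * 2^((p-1)k) * 2^(k-1), and the last factor times
    the measure of H is what \<open>trunc\<close> bounds.\<close>
  have "ennreal (\<Sum>H\<in>S. 2 powr (p * k H) * measure M H)
      = (\<Sum>H\<in>S. ennreal (2 * 2 powr ((p - 1) * k H)) * ennreal (2 powr (k H - 1) * measure M H))"
  proof -
    have "2 powr (p * k H) * measure M H = (2 * 2 powr ((p - 1) * k H)) * (2 powr (k H - 1) * measure M H)" for H
    proof -
      have "(2 * 2 powr ((p - 1) * k H)) * 2 powr (k H - 1) = (2::real) powr (1 + (p - 1) * k H + (k H - 1))"
        unfolding powr_add by simp
      also have "1 + (p - 1) * k H + (k H - 1) = p * k H" by (simp add: algebra_simps)
      finally show ?thesis by simp
    qed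
    then have eq: "ennreal (2 powr (p * k H) * measure M H)
        = ennreal (2 * 2 powr ((p - 1) * k H)) * ennreal (2 powr (k H - 1) * measure M H)" for H
      by (subst ennreal_mult[symmetric]) auto
    have "ennreal (\<Sum>H\<in>S. 2 powr (p * k H) * measure M H) = (\<Sum>H\<in>S. ennreal (2 powr (p * k H) * measure M H))"
      by simp
    also have "\<dots> = (\<Sum>H\<in>S. ennreal (2 * 2 powr ((p - 1) * k H)) * ennreal (2 powr (k H - 1) * measure M H))"
      by (intro sum.cong refl eq)
    finally show ?thesis .
  qed
  also have "\<dots> \<le> (\<Sum>H\<in>S. ennreal (2 * 2 powr ((p - 1) * k H)) * (\<integral>\<^sup>+x. ennreal (w H x) \<partial>M))"
    by (intro sum_mono mult_left_mono trunc) auto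
  also have "\<dots> = (\<Sum>H\<in>S. \<integral>\<^sup>+x. ennreal (2 * 2 powr ((p - 1) * k H)) * ennreal (w H x) \<partial>M)"
    using wmeas by (intro sum.cong refl nn_integral_cmult[symmetric]) auto
  also have "\<dots> = (\<integral>\<^sup>+x. (\<Sum>H\<in>S. ennreal (2 * 2 powr ((p - 1) * k H)) * ennreal (w H x)) \<partial>M)"
    using wmeas by (intro nn_integral_sum[symmetric]) auto
  also have "\<dots> = (\<integral>\<^sup>+x. ennreal (\<Sum>H\<in>S. 2 * 2 powr ((p - 1) * k H) * w H x) \<partial>M)"
    using f(2) by (intro nn_integral_cong, subst sum_ennreal[symmetric]) (auto simp: w_def ennreal_mult)
  also have "\<dots> \<le> (\<integral>\<^sup>+x. ennreal C * ennreal (f x powr p) \<partial>M)"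
    using C by (intro nn_integral_mono) (auto simp: ennreal_mult[symmetric] intro!: ennreal_leI pw)
  also have "\<dots> = ennreal C * (\<integral>\<^sup>+x. ennreal (f x powr p) \<partial>M)"
    using f by (intro nn_integral_cmult) auto
  also have "\<dots> \<le> ennreal C * ennreal X" using X by (intro mult_left_mono) auto
  also have "\<dots> = ennreal (C * X)" using C X by (simp add: ennreal_mult)
  finally have "(\<Sum>H\<in>S. 2 powr (p * k H) * measure M H) \<le> C * X"
    using mult_nonneg_nonneg[OF C X(2)] by (subst (asm) ennreal_le_iff) auto
  then show ?thesis unfolding S_def k_def C_def .
qed

text \<open>For \<theta> = 1, group C by the stopping sets of \<phi>: on each group the running
  maximum is constant up to a factor 2, and the Carleson condition pays K once. For \<theta> > 1 the
  surplus power \<theta> - 1 is taken out as a supremum of single terms, which costs no K because s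
  is monotone. So K enters to the first power whatever \<theta> is; this is the source of the
  exponents 1/q and 1/p' on the characteristics.\<close>

lemma carleson_embedding:
  fixes D C :: "'a set set" and \<phi> s :: "'a set \<Rightarrow> real" and p \<theta> K X :: real
  assumes lam: "laminar D" and pos: "\<And>Q. Q \<in> D \<Longrightarrow> \<phi> Q > 0" and s: "\<And>Q. Q \<in> D \<Longrightarrow> s Q \<ge> 0"
    and mono: "\<And>Q R. Q \<in> D \<Longrightarrow> R \<in> D \<Longrightarrow> Q \<subseteq> R \<Longrightarrow> s Q \<le> s R"
    and p: "p > 0" and \<theta>: "\<theta> \<ge> 1" and C: "C \<subseteq> D"
    and carl: "\<And>P. P \<in> D \<Longrightarrow> (\<Sum>H\<in>{H \<in> C. H \<subseteq> P}. s H) \<le> K * s P" and K: "K \<ge> 0"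
    and X: "(\<Sum>H\<in>stops D (level D \<phi>). 2 powr (p * level D \<phi> H) * s H) \<le> X"
  shows "(\<Sum>H\<in>C. (anc_max D \<phi> H powr p * s H) powr \<theta>) \<le> K * (2 powr p * X) powr \<theta>"
proof -
  define S where "S = stops D (level D \<phi>)"
  have SD: "S \<subseteq> D" "finite S" using stops_subset laminar_finite[OF lam] by (auto simp: S_def intro: finite_subset)
  define Y where "Y = (\<Sum>H\<in>S. 2 powr (p * level D \<phi> H) * s H)"
  have Y: "0 \<le> Y" "Y \<le> X" using X s SD by (auto simp: Y_def S_def intro!: sum_nonneg)
  have m: "anc_max D \<phi> Q powr p \<le> 2 powr p * 2 powr (p * level D \<phi> Q)" if "Q \<in> D" for Q
  proof -
    have "anc_max D \<phi> Q powr p \<le> (2 * 2 powr level D \<phi> Q) powr p"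
      using level_bounds(2)[where \<phi>=\<phi>, OF lam pos that] anc_max_pos[where \<phi>=\<phi>, OF lam pos that] p by (intro powr_mono2) auto
    also have "\<dots> = 2 powr p * 2 powr (p * level D \<phi> Q)" by (simp add: powr_mult powr_powr mult.commute)
    finally show ?thesis .
  qed
  have sup: "anc_max D \<phi> Q powr p * s Q \<le> 2 powr p * Y" if Q: "Q \<in> D" for Q
  proof -
    obtain H where H: "H \<in> S" "Q \<subseteq> H" "level D \<phi> H = level D \<phi> Q"
      using ex_stop[OF lam Q, of "level D \<phi>"] unfolding S_def by blast
    have "anc_max D \<phi> Q powr p * s Q \<le> 2 powr p * 2 powr (p * level D \<phi> H) * s H"
      using m[OF Q] H SD mono[OF Q, of H] s[OF Q] by (intro mult_mono) auto
    also have "\<dots> = 2 powr p * (2 powr (p * level D \<phi> H) * s H)" by simp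
    also have "2 powr (p * level D \<phi> H) * s H \<le> Y"
      unfolding Y_def using H SD s by (intro member_le_sum) auto
    finally show ?thesis by simp
  qed
  have one: "(\<Sum>H\<in>C. anc_max D \<phi> H powr p * s H) \<le> K * (2 powr p * Y)"
  proof -
    have "(\<Sum>H\<in>C. anc_max D \<phi> H powr p * s H)
        \<le> (\<Sum>H\<in>S. \<Sum>Q\<in>{Q \<in> C. Q \<subseteq> H \<and> level D \<phi> Q = level D \<phi> H}. anc_max D \<phi> Q powr p * s Q)"
      unfolding S_def using C s by (intro sum_by_stops_le[OF lam]) (auto intro!: mult_nonneg_nonneg)
    also have "\<dots> \<le> (\<Sum>H\<in>S. 2 powr p * 2 powr (p * level D \<phi> H) * (K * s H))"
    proof (rule sum_mono)
      fix H assume H: "H \<in> S"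
      have fin: "finite C" using laminar_finite[OF lam] C finite_subset by blast
      have "(\<Sum>Q\<in>{Q \<in> C. Q \<subseteq> H \<and> level D \<phi> Q = level D \<phi> H}. anc_max D \<phi> Q powr p * s Q)
          \<le> (\<Sum>Q\<in>{Q \<in> C. Q \<subseteq> H \<and> level D \<phi> Q = level D \<phi> H}. 2 powr p * 2 powr (p * level D \<phi> H) * s Q)"
        using m s C by (intro sum_mono mult_right_mono) (force+)
      also have "\<dots> \<le> (\<Sum>Q\<in>{Q \<in> C. Q \<subseteq> H}. 2 powr p * 2 powr (p * level D \<phi> H) * s Q)"
        using s C fin by (intro sum_mono2) auto
      also have "\<dots> \<le> 2 powr p * 2 powr (p * level D \<phi> H) * (K * s H)"
        unfolding sum_distrib_left[symmetric] using H SD by (intro mult_left_mono carl) auto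
      finally show "(\<Sum>Q\<in>{Q \<in> C. Q \<subseteq> H \<and> level D \<phi> Q = level D \<phi> H}. anc_max D \<phi> Q powr p * s Q)
          \<le> 2 powr p * 2 powr (p * level D \<phi> H) * (K * s H)" .
    qed
    also have "\<dots> = K * (2 powr p * Y)" by (simp add: Y_def sum_distrib_left algebra_simps)
    finally show ?thesis .
  qed
  have "(\<Sum>H\<in>C. (anc_max D \<phi> H powr p * s H) powr \<theta>)
      \<le> (\<Sum>H\<in>C. (2 powr p * Y) powr (\<theta> - 1) * (anc_max D \<phi> H powr p * s H))"
  proof (rule sum_mono)
    fix H assume "H \<in> C"
    then have HD: "H \<in> D" using C by auto
    define z where "z = anc_max D \<phi> H powr p * s H"
    have z: "0 \<le> z" "z \<le> 2 powr p * Y" using sup[OF HD] s[OF HD] by (auto simp: z_def)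
    have "z powr \<theta> = z powr (\<theta> - 1) * z"
      using z(1) powr_add[of z "\<theta> - 1" 1] by (cases "z = 0") auto
    also have "\<dots> \<le> (2 powr p * Y) powr (\<theta> - 1) * z"
      using z \<theta> by (intro mult_right_mono powr_mono2) auto
    finally show "(anc_max D \<phi> H powr p * s H) powr \<theta> \<le> (2 powr p * Y) powr (\<theta> - 1) * (anc_max D \<phi> H powr p * s H)"
      by (simp add: z_def)
  qed
  also have "\<dots> \<le> (2 powr p * Y) powr (\<theta> - 1) * (K * (2 powr p * Y))"
    unfolding sum_distrib_left[symmetric] by (intro mult_left_mono one) auto
  also have "\<dots> = K * (2 powr p * Y) powr \<theta>"
    using Y(1) powr_add[of "2 powr p * Y" "\<theta> - 1" 1] by (cases "Y = 0") auto
  also have "\<dots> \<le> K * (2 powr p * X) powr \<theta>"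
    using Y K \<theta> by (intro mult_left_mono powr_mono2) auto
  finally show ?thesis .
qed

text \<open>The reference scale is the one at which the two-weight condition would be an equality for
  \<open>H\<close>. Above it one uses \<open>\<Sum>\<mu>(Q)\<nu>(Q) \<le> \<mu>(H)\<nu>(H)\<close>, below it the two-weight condition raised to
  a power greater than one; both give geometric decay away from the reference scale.\<close>
lemma laminar_kernel_sum_le:
  fixes lev :: "'a set \<Rightarrow> int" and M N :: "'a measure" and D :: "'a set set" and a b e B :: real
  defines "\<eta> \<equiv> 1 / (a + b) - 1"
  assumes lam: "laminar D" and DM: "D \<subseteq> fmeasurable M" and DN: "D \<subseteq> fmeasurable N"
    and Mpos: "\<And>Q. Q \<in> D \<Longrightarrow> measure M Q > 0" and Npos: "\<And>Q. Q \<in> D \<Longrightarrow> measure N Q > 0"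
    and disj: "\<And>Q R. Q \<in> D \<Longrightarrow> R \<in> D \<Longrightarrow> lev Q = lev R \<Longrightarrow> Q \<noteq> R \<Longrightarrow> disjnt Q R"
    and e: "e > 0" and ab: "a > 0" "b > 0" "a + b < 1" and B: "B > 0"
    and A: "\<And>Q. Q \<in> D \<Longrightarrow> measure M Q powr a * measure N Q powr b \<le> B * 2 powr (e * lev Q)"
    and H: "H \<in> D"
  shows "(\<Sum>Q\<in>{Q \<in> D. Q \<subseteq> H}. 2 powr (- (e * lev Q)) * (measure M Q * measure N Q))
     \<le> (1 / (1 - 2 powr (- e)) + 1 / (1 - 2 powr (- (e * \<eta>))))
         * (B * (measure M H powr (1 - a) * measure N H powr (1 - b)))"
proof -
  define DH where "DH = {Q \<in> D. Q \<subseteq> H}"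
  \<comment> \<open>The reference scale is where \<open>z j\<close> = 1. After normalising by the
    masses of H, a summand at scale j is V / z j times x y, so it remains to bound the sum of x y
    over one scale.\<close>
  define \<rho> where "\<rho> = measure M H powr a * measure N H powr b / B"
  define V where "V = B * (measure M H powr (1 - a) * measure N H powr (1 - b))"
  define z where "z = (\<lambda>j::int. 2 powr (e * j) / \<rho>)"
  define x where "x = (\<lambda>Q. measure M Q / measure M H)"
  define y where "y = (\<lambda>Q. measure N Q / measure N H)"
  have \<eta>: "\<eta> > 0" using ab by (simp add: \<eta>_def field_simps)
  have HM: "measure M H > 0" and HN: "measure N H > 0" using Mpos Npos H by auto
  have \<rho>: "\<rho> > 0" and V: "V > 0" using HM HN B by (auto simp: \<rho>_def V_def)
  have z: "z j > 0" for j using \<rho> by (simp add: z_def)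
  have finH: "finite DH" using laminar_finite[OF lam] by (auto simp: DH_def)
  have xy: "0 < x Q" "0 < y Q" "x Q \<le> 1" "y Q \<le> 1" if "Q \<in> DH" for Q
    using that Mpos Npos HM HN DM DN H
    by (auto simp: x_def y_def DH_def intro!: measure_mono_fmeasurable)
  have V\<rho>: "V * \<rho> = measure M H * measure N H"
  proof -
    have "V * \<rho> = (measure M H powr (1 - a) * measure M H powr a) * (measure N H powr (1 - b) * measure N H powr b)"
      using B by (simp add: V_def \<rho>_def)
    also have "\<dots> = measure M H * measure N H" using HM HN by (simp flip: powr_add)
    finally show ?thesis .
  qed
  have sums: "(\<Sum>Q\<in>{Q \<in> DH. lev Q = j}. x Q) \<le> 1" "(\<Sum>Q\<in>{Q \<in> DH. lev Q = j}. y Q) \<le> 1" for j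
  proof -
    have *: "finite {Q \<in> DH. lev Q = j}" "pairwise disjnt {Q \<in> DH. lev Q = j}"
      "\<And>Q. Q \<in> {Q \<in> DH. lev Q = j} \<Longrightarrow> Q \<subseteq> H"
      using laminar_finite[OF lam] disj by (auto simp: DH_def pairwise_def)
    have "(\<Sum>Q\<in>{Q \<in> DH. lev Q = j}. measure M Q) \<le> measure M H"
      by (rule sum_measure_disjnt_le[OF *(1) _ *(2,3)]) (use DM H in \<open>auto simp: DH_def\<close>)
    then show "(\<Sum>Q\<in>{Q \<in> DH. lev Q = j}. x Q) \<le> 1"
      using HM by (simp add: x_def flip: sum_divide_distrib)
    have "(\<Sum>Q\<in>{Q \<in> DH. lev Q = j}. measure N Q) \<le> measure N H"
      by (rule sum_measure_disjnt_le[OF *(1) _ *(2,3)]) (use DN H in \<open>auto simp: DH_def\<close>)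
    then show "(\<Sum>Q\<in>{Q \<in> DH. lev Q = j}. y Q) \<le> 1"
      using HN by (simp add: y_def flip: sum_divide_distrib)
  qed
  have prod1: "(\<Sum>Q\<in>{Q \<in> DH. lev Q = j}. x Q * y Q) \<le> 1" for j
  proof -
    have "(\<Sum>Q\<in>{Q \<in> DH. lev Q = j}. x Q * y Q) \<le> (\<Sum>Q\<in>{Q \<in> DH. lev Q = j}. x Q)"
      using xy by (intro sum_mono) (auto simp: mult_left_le less_imp_le)
    then show ?thesis using sums(1)[of j] by linarith
  qed
  have prod2: "(\<Sum>Q\<in>{Q \<in> DH. lev Q = j}. x Q * y Q) \<le> z j powr (1 + \<eta>)" for j
  proof -
    \<comment> \<open>The two-weight condition is raised to the power d for which the exponents 1 -
      a d and 1 - b d left over for x and y add up to 2 - 1 = 1. The weighted mean inequality and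
      disjointness within one scale then bound the remaining sum by 1.\<close>
    define d where "d = 1 / (a + b)"
    have d: "d > 0" "d = 1 + \<eta>" "a * d + b * d = 1"
      using ab by (auto simp: d_def \<eta>_def simp flip: add_divide_distrib)
    have ad: "0 \<le> 1 - a * d" "0 \<le> 1 - b * d" "1 - a * d + (1 - b * d) = 1"
      using d(3) mult_pos_pos[OF ab(1) d(1)] mult_pos_pos[OF ab(2) d(1)] by linarith+
    have "x Q * y Q \<le> z j powr d * (x Q powr (1 - a * d) * y Q powr (1 - b * d))"
      if Q: "Q \<in> DH" "lev Q = j" for Q
    proof -
      have "x Q powr a * y Q powr b = measure M Q powr a * measure N Q powr b / (B * \<rho>)"
        using B HM HN by (simp add: x_def y_def powr_divide \<rho>_def)
      also have "\<dots> \<le> B * 2 powr (e * j) / (B * \<rho>)"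
        using A[of Q] Q B \<rho> by (intro divide_right_mono) (auto simp: DH_def)
      also have "\<dots> = z j" using B by (simp add: z_def)
      finally have le: "(x Q powr a * y Q powr b) powr d \<le> z j powr d"
        using d by (intro powr_mono2) auto
      have "x Q * y Q = x Q powr (a * d + (1 - a * d)) * y Q powr (b * d + (1 - b * d))"
        using xy[OF Q(1)] by simp
      also have "\<dots> = (x Q powr a * y Q powr b) powr d * (x Q powr (1 - a * d) * y Q powr (1 - b * d))"
        using xy[OF Q(1)] unfolding powr_add by (simp add: powr_mult powr_powr algebra_simps)
      also have "\<dots> \<le> z j powr d * (x Q powr (1 - a * d) * y Q powr (1 - b * d))"
        by (intro mult_right_mono le) auto
      finally show ?thesis .
    qed
    then have "(\<Sum>Q\<in>{Q \<in> DH. lev Q = j}. x Q * y Q)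
        \<le> (\<Sum>Q\<in>{Q \<in> DH. lev Q = j}. z j powr d * (x Q powr (1 - a * d) * y Q powr (1 - b * d)))"
      by (intro sum_mono) auto
    also have "\<dots> \<le> z j powr d * 1"
      unfolding sum_distrib_left[symmetric] using xy sums ad
      by (intro mult_left_mono sum_powr_weighted_le_one) auto
    finally show ?thesis by (simp add: d)
  qed
  have T: "(\<Sum>Q\<in>{Q \<in> DH. lev Q = j}. 2 powr (- (e * lev Q)) * (measure M Q * measure N Q))
      \<le> V * (if z j \<ge> 1 then 1 / z j else z j powr \<eta>)" for j
  proof -
    have "(\<Sum>Q\<in>{Q \<in> DH. lev Q = j}. 2 powr (- (e * lev Q)) * (measure M Q * measure N Q))
        = (\<Sum>Q\<in>{Q \<in> DH. lev Q = j}. V / z j * (x Q * y Q))"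
      using V\<rho> HM HN \<rho> by (intro sum.cong refl) (simp add: z_def x_def y_def powr_minus_divide)
    also have "\<dots> = V / z j * (\<Sum>Q\<in>{Q \<in> DH. lev Q = j}. x Q * y Q)" by (simp add: sum_distrib_left)
    also have "\<dots> \<le> V / z j * (if z j \<ge> 1 then 1 else z j powr (1 + \<eta>))"
      using prod1 prod2 V z[of j] by (intro mult_left_mono) auto
    also have "\<dots> = V * (if z j \<ge> 1 then 1 / z j else z j powr \<eta>)"
      using z[of j] by (simp add: powr_add)
    finally show ?thesis .
  qed
  define J where "J = lev ` DH"
  have finJ: "finite J" using finH by (simp add: J_def)
  have "(\<Sum>Q\<in>DH. 2 powr (- (e * lev Q)) * (measure M Q * measure N Q))
      = (\<Sum>j\<in>J. \<Sum>Q\<in>{Q \<in> DH. lev Q = j}. 2 powr (- (e * lev Q)) * (measure M Q * measure N Q))"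
    unfolding J_def by (rule sum.image_gen[OF finH])
  also have "\<dots> \<le> (\<Sum>j\<in>J. V * (if z j \<ge> 1 then 1 / z j else z j powr \<eta>))"
    by (intro sum_mono T)
  also have "\<dots> = V * ((\<Sum>j\<in>{j \<in> J. z j \<ge> 1}. 1 / z j) + (\<Sum>j\<in>{j \<in> J. \<not> z j \<ge> 1}. z j powr \<eta>))"
    using finJ by (simp add: sum_distrib_left[symmetric] sum.If_cases Int_def Collect_neg_eq[symmetric] Diff_eq)
  \<comment> \<open>Above the reference scale the terms decrease in j, so the index is negated
    before the geometric bound applies.\<close>
  also have "(\<Sum>j\<in>{j \<in> J. z j \<ge> 1}. 1 / z j) = (\<Sum>i\<in>(uminus :: int \<Rightarrow> int) ` {j \<in> J. z j \<ge> 1}. \<rho> * 2 powr (e * i))"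
    by (subst sum.reindex) (auto simp: z_def powr_minus_divide intro!: sum.cong)
  also have "\<dots> \<le> 1 / (1 - 2 powr (- e))"
    using finJ e \<rho> by (intro geometric_int_sum_le) (auto simp: z_def powr_minus_divide field_simps)
  also have "(\<Sum>j\<in>{j \<in> J. \<not> z j \<ge> 1}. z j powr \<eta>)
      = (\<Sum>j\<in>{j \<in> J. \<not> z j \<ge> 1}. (1 / \<rho> powr \<eta>) * 2 powr ((e * \<eta>) * j))"
    using \<rho> by (intro sum.cong refl) (simp add: z_def powr_divide powr_powr algebra_simps)
  also have "\<dots> \<le> 1 / (1 - 2 powr (- (e * \<eta>)))"
  proof (intro geometric_int_sum_le)
    fix j assume j: "j \<in> {j \<in> J. \<not> z j \<ge> 1}"
    have "(1 / \<rho> powr \<eta>) * 2 powr ((e * \<eta>) * j) = z j powr \<eta>"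
      using \<rho> by (simp add: z_def powr_divide powr_powr algebra_simps)
    also have "\<dots> \<le> 1 powr \<eta>" using j \<eta> z[of j] by (intro powr_mono2) auto
    finally show "(1 / \<rho> powr \<eta>) * 2 powr ((e * \<eta>) * j) \<le> 1" by simp
  qed (use finJ e \<eta> \<rho> in auto)
  finally show ?thesis
    using V unfolding DH_def[symmetric] V_def[symmetric] by (simp add: algebra_simps)
qed

section \<open>Freezing averages between stopping sets\<close>

text \<open>Below a stopping set, as long as the level is unchanged, \<phi> stays under twice its
  value there. It factors out, and what remains is a sum of w alone.\<close>

lemma level_stop_sum_le:
  fixes D :: "'a set set" and \<phi> w :: "'a set \<Rightarrow> real"
  assumes lam: "laminar D" and pos: "\<And>Q. Q \<in> D \<Longrightarrow> \<phi> Q > 0" and w: "\<And>Q. Q \<in> D \<Longrightarrow> w Q \<ge> 0"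
    and c: "\<And>H. H \<in> D \<Longrightarrow> (\<Sum>Q\<in>{Q \<in> D. Q \<subseteq> H}. w Q) \<le> c H"
  shows "(\<Sum>Q\<in>D. \<phi> Q * w Q) \<le> 2 * (\<Sum>H\<in>stops D (level D \<phi>). \<phi> H * c H)"
proof -
  have fin: "finite D" using laminar_finite[OF lam] .
  have "(\<Sum>Q\<in>D. \<phi> Q * w Q)
      \<le> (\<Sum>H\<in>stops D (level D \<phi>). \<Sum>Q\<in>{Q \<in> D. Q \<subseteq> H \<and> level D \<phi> Q = level D \<phi> H}. \<phi> Q * w Q)"
    using w pos by (intro sum_by_stops_le[OF lam]) (auto simp: less_imp_le)
  also have "\<dots> \<le> (\<Sum>H\<in>stops D (level D \<phi>). 2 * \<phi> H * c H)"
  proof (rule sum_mono)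
    fix H assume H: "H \<in> stops D (level D \<phi>)"
    then have HD: "H \<in> D" using stops_subset by auto
    have "(\<Sum>Q\<in>{Q \<in> D. Q \<subseteq> H \<and> level D \<phi> Q = level D \<phi> H}. \<phi> Q * w Q)
        \<le> (\<Sum>Q\<in>{Q \<in> D. Q \<subseteq> H \<and> level D \<phi> Q = level D \<phi> H}. 2 * \<phi> H * w Q)"
    proof (intro sum_mono mult_right_mono)
      fix Q assume Q: "Q \<in> {Q \<in> D. Q \<subseteq> H \<and> level D \<phi> Q = level D \<phi> H}"
      have "\<phi> Q \<le> anc_max D \<phi> Q" using anc_max_ge[where \<phi>=\<phi>, OF lam pos] Q by auto
      also have "\<dots> \<le> 2 * 2 powr level D \<phi> H"
        using level_bounds(2)[where \<phi>=\<phi>, OF lam pos, of Q] Q by auto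
      also have "2 powr level D \<phi> H \<le> \<phi> H"
        using level_bounds(1)[where \<phi>=\<phi>, OF lam pos, of H] HD anc_max_stop[where \<phi>=\<phi>, OF lam pos H] by simp
      finally show "\<phi> Q \<le> 2 * \<phi> H" by simp
    qed (use w in auto)
    also have "\<dots> \<le> (\<Sum>Q\<in>{Q \<in> D. Q \<subseteq> H}. 2 * \<phi> H * w Q)"
      using w pos[OF HD] fin by (intro sum_mono2) auto
    also have "\<dots> \<le> 2 * \<phi> H * c H"
      unfolding sum_distrib_left[symmetric] using pos[OF HD] c[OF HD] by (intro mult_left_mono) auto
    finally show "(\<Sum>Q\<in>{Q \<in> D. Q \<subseteq> H \<and> level D \<phi> Q = level D \<phi> H}. \<phi> Q * w Q) \<le> 2 * \<phi> H * c H" .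
  qed
  finally show ?thesis by (simp add: sum_distrib_left mult.assoc)
qed

text \<open>A joint stopping set need not stop for both functions, so the values of \<phi> and
  \<gamma> at H may be too small; the running maxima replace them. Each is constant up to a factor 2
  on a group, whence the 4.\<close>

lemma level_pair_stop_sum_le:
  fixes D :: "'a set set" and \<phi> \<gamma> w :: "'a set \<Rightarrow> real"
  assumes lam: "laminar D" and pos: "\<And>Q. Q \<in> D \<Longrightarrow> \<phi> Q > 0" "\<And>Q. Q \<in> D \<Longrightarrow> \<gamma> Q > 0"
    and w: "\<And>Q. Q \<in> D \<Longrightarrow> w Q \<ge> 0"
    and c: "\<And>H. H \<in> D \<Longrightarrow> (\<Sum>Q\<in>{Q \<in> D. Q \<subseteq> H}. w Q) \<le> c H"
  shows "(\<Sum>Q\<in>D. \<phi> Q * \<gamma> Q * w Q)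
    \<le> 4 * ((\<Sum>H\<in>stops D (level D \<phi>). anc_max D \<phi> H * anc_max D \<gamma> H * c H)
         + (\<Sum>H\<in>stops D (level D \<gamma>). anc_max D \<phi> H * anc_max D \<gamma> H * c H))"
proof -
  define l where "l = (\<lambda>Q. (level D \<phi> Q, level D \<gamma> Q))"
  have fin: "finite D" using laminar_finite[OF lam] .
  have mpos: "anc_max D \<phi> Q > 0" "anc_max D \<gamma> Q > 0" if "Q \<in> D" for Q
    using anc_max_pos[where \<phi>=\<phi>, OF lam pos(1)] anc_max_pos[where \<phi>=\<gamma>, OF lam pos(2)] that by auto
  have cpos: "c H \<ge> 0" if "H \<in> D" for H
    using c[OF that] sum_nonneg[of "{Q \<in> D. Q \<subseteq> H}" w] w by force
  define g where "g = (\<lambda>H. anc_max D \<phi> H * anc_max D \<gamma> H * c H)"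
  have gpos: "g H \<ge> 0" if "H \<in> D" for H using mpos[OF that] cpos[OF that] by (simp add: g_def)
  have "(\<Sum>Q\<in>D. \<phi> Q * \<gamma> Q * w Q)
      \<le> (\<Sum>H\<in>stops D l. \<Sum>Q\<in>{Q \<in> D. Q \<subseteq> H \<and> l Q = l H}. \<phi> Q * \<gamma> Q * w Q)"
    using w pos by (intro sum_by_stops_le[OF lam]) (auto simp: less_imp_le)
  also have "\<dots> \<le> (\<Sum>H\<in>stops D l. 4 * g H)"
  proof (rule sum_mono)
    fix H assume H: "H \<in> stops D l"
    then have HD: "H \<in> D" using stops_subset by auto
    have "(\<Sum>Q\<in>{Q \<in> D. Q \<subseteq> H \<and> l Q = l H}. \<phi> Q * \<gamma> Q * w Q)
        \<le> (\<Sum>Q\<in>{Q \<in> D. Q \<subseteq> H \<and> l Q = l H}. (2 * anc_max D \<phi> H) * (2 * anc_max D \<gamma> H) * w Q)"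
    proof (intro sum_mono mult_right_mono mult_mono)
      fix Q assume Q: "Q \<in> {Q \<in> D. Q \<subseteq> H \<and> l Q = l H}"
      have "\<phi> Q \<le> anc_max D \<phi> Q" using anc_max_ge[where \<phi>=\<phi>, OF lam pos(1)] Q by auto
      also have "\<dots> \<le> 2 * 2 powr level D \<phi> H"
        using level_bounds(2)[where \<phi>=\<phi>, OF lam pos(1), of Q] Q by (auto simp: l_def)
      also have "2 powr level D \<phi> H \<le> anc_max D \<phi> H"
        using level_bounds(1)[where \<phi>=\<phi>, OF lam pos(1), of H] HD by simp
      finally show "\<phi> Q \<le> 2 * anc_max D \<phi> H" by simp
      have "\<gamma> Q \<le> anc_max D \<gamma> Q" using anc_max_ge[where \<phi>=\<gamma>, OF lam pos(2)] Q by auto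
      also have "\<dots> \<le> 2 * 2 powr level D \<gamma> H"
        using level_bounds(2)[where \<phi>=\<gamma>, OF lam pos(2), of Q] Q by (auto simp: l_def)
      also have "2 powr level D \<gamma> H \<le> anc_max D \<gamma> H"
        using level_bounds(1)[where \<phi>=\<gamma>, OF lam pos(2), of H] HD by simp
      finally show "\<gamma> Q \<le> 2 * anc_max D \<gamma> H" by simp
    qed (use w pos mpos[OF HD] in \<open>auto simp: less_imp_le\<close>)
    also have "\<dots> \<le> (\<Sum>Q\<in>{Q \<in> D. Q \<subseteq> H}. (2 * anc_max D \<phi> H) * (2 * anc_max D \<gamma> H) * w Q)"
      using w mpos[OF HD] fin by (intro sum_mono2) auto
    also have "\<dots> \<le> (2 * anc_max D \<phi> H) * (2 * anc_max D \<gamma> H) * c H"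
      unfolding sum_distrib_left[symmetric] using mpos[OF HD] c[OF HD] by (intro mult_left_mono) auto
    finally show "(\<Sum>Q\<in>{Q \<in> D. Q \<subseteq> H \<and> l Q = l H}. \<phi> Q * \<gamma> Q * w Q) \<le> 4 * g H" by (simp add: g_def)
  qed
  also have "\<dots> = 4 * (\<Sum>H\<in>stops D l. g H)" by (simp add: sum_distrib_left)
  also have "(\<Sum>H\<in>stops D l. g H) \<le> (\<Sum>H\<in>stops D (level D \<phi>) \<union> stops D (level D \<gamma>). g H)"
    using stops_pair_subset[where \<phi>=\<phi> and \<gamma>=\<gamma>, OF lam pos] stops_subset[of D] fin gpos
    unfolding l_def by (intro sum_mono2) (auto intro: finite_subset simp: subset_iff)
  also have "\<dots> \<le> (\<Sum>H\<in>stops D (level D \<phi>). g H) + (\<Sum>H\<in>stops D (level D \<gamma>). g H)"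
    using finite_subset[OF stops_subset fin] gpos stops_subset[of D]
    by (subst sum_Un) (auto intro!: sum_nonneg simp: subset_iff)
  finally show ?thesis by (simp add: g_def)
qed

section \<open>Summation over scales and sparseness of stopping sets\<close>

text \<open>At one scale the sets below H are disjoint and together weigh at most N(H); the factor
  2^(\<alpha> j) turns the scales into a geometric series headed by H. This is where \<alpha> > 0
  permits the reduction to sparse families.\<close>

lemma scale_sum_le:
  fixes lev :: "'a set \<Rightarrow> int" and \<alpha> :: real
  assumes lam: "laminar D" and DN: "D \<subseteq> fmeasurable N"
    and disj: "\<And>Q R. Q \<in> D \<Longrightarrow> R \<in> D \<Longrightarrow> lev Q = lev R \<Longrightarrow> Q \<noteq> R \<Longrightarrow> disjnt Q R"
    and lev: "\<And>Q R. Q \<in> D \<Longrightarrow> R \<in> D \<Longrightarrow> Q \<subseteq> R \<Longrightarrow> lev Q \<le> lev R"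
    and \<alpha>: "\<alpha> > 0" and H: "H \<in> D"
  shows "(\<Sum>Q\<in>{Q \<in> D. Q \<subseteq> H}. 2 powr (\<alpha> * lev Q) * measure N Q)
           \<le> 1 / (1 - 2 powr (- \<alpha>)) * (2 powr (\<alpha> * lev H) * measure N H)"
proof -
  define DH where "DH = {Q \<in> D. Q \<subseteq> H}"
  have fin: "finite DH" using laminar_finite[OF lam] by (simp add: DH_def)
  have "(\<Sum>Q\<in>DH. 2 powr (\<alpha> * lev Q) * measure N Q)
      = (\<Sum>j\<in>lev ` DH. \<Sum>Q\<in>{Q \<in> DH. lev Q = j}. 2 powr (\<alpha> * lev Q) * measure N Q)"
    by (rule sum.image_gen[OF fin])
  also have "\<dots> \<le> (\<Sum>j\<in>lev ` DH. measure N H * 2 powr (\<alpha> * j))"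
  proof (rule sum_mono)
    fix j
    have "(\<Sum>Q\<in>{Q \<in> DH. lev Q = j}. measure N Q) \<le> measure N H"
    proof (rule sum_measure_disjnt_le)
      show "pairwise disjnt {Q \<in> DH. lev Q = j}" using disj by (auto simp: DH_def pairwise_def)
    qed (use laminar_finite[OF lam] DN H in \<open>auto simp: DH_def\<close>)
    then have "2 powr (\<alpha> * j) * (\<Sum>Q\<in>{Q \<in> DH. lev Q = j}. measure N Q) \<le> 2 powr (\<alpha> * j) * measure N H"
      by (intro mult_left_mono) auto
    then show "(\<Sum>Q\<in>{Q \<in> DH. lev Q = j}. 2 powr (\<alpha> * lev Q) * measure N Q) \<le> measure N H * 2 powr (\<alpha> * j)"
      by (simp add: sum_distrib_left mult.commute)
  qed
  also have "\<dots> \<le> measure N H * 2 powr (\<alpha> * lev H) / (1 - 2 powr (- \<alpha>))"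
    using fin \<alpha> lev H by (intro geometric_int_sum_le mult_left_mono) (auto simp: DH_def)
  finally show ?thesis by (simp add: DH_def mult.commute)
qed

text \<open>Removing from a stopping set all members at least two levels higher leaves at least half of it,
  and the remainders overlap at most twice.\<close>
lemma stops_carleson:
  fixes L F N :: "'a measure" and D :: "'a set set" and g :: "'a \<Rightarrow> ennreal"
  defines "\<phi> \<equiv> \<lambda>Q. measure F Q / measure L Q"
  assumes lam: "laminar D" and DL: "D \<subseteq> fmeasurable L" and DF: "D \<subseteq> fmeasurable F"
    and Lpos: "\<And>Q. Q \<in> D \<Longrightarrow> measure L Q > 0" and Fpos: "\<And>Q. Q \<in> D \<Longrightarrow> measure F Q > 0"
    and P: "P \<in> D"
    and g: "\<And>H x. H \<in> D \<Longrightarrow> H \<subseteq> P \<Longrightarrow> x \<in> H \<Longrightarrow> ennreal (measure N H / measure L H) \<le> g x"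
  shows "ennreal (\<Sum>H\<in>{H \<in> stops D (level D \<phi>). H \<subseteq> P}. measure N H / 4) \<le> (\<integral>\<^sup>+x. g x * indicator P x \<partial>L)"
proof -
  define k where "k = level D \<phi>"
  define S where "S = {H \<in> stops D k. H \<subseteq> P}"
  \<comment> \<open>The gap of two levels matters: the maximal removed sets have averages at least
    2^(k H + 2), while that of H is below 2^(k H + 1), so they fill at most half of H. A gap of one
    would guarantee nothing.\<close>
  define E where "E = (\<lambda>H. H - \<Union>{R \<in> D. R \<subset> H \<and> k H + 2 \<le> k R})"
  have \<phi>pos: "\<phi> Q > 0" if "Q \<in> D" for Q using that Lpos Fpos by (simp add: \<phi>_def)
  have finD: "finite D" using laminar_finite[OF lam] .
  have SD: "S \<subseteq> D" using stops_subset by (auto simp: S_def)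
  then have finS: "finite S" using finD finite_subset by blast
  have meas: "H \<in> sets L" if "H \<in> D" for H using DL that by auto
  have Emeas: "E H \<in> sets L" if "H \<in> D" for H
    unfolding E_def using meas that finD by (intro sets.Diff sets.finite_Union) auto
  have half: "measure L H \<le> 2 * measure L (E H)" if H: "H \<in> D" for H
  proof -
    define C where "C = {R \<in> D. R \<subset> H \<and> k H + 2 \<le> k R}"
    define C' where "C' = stops C (\<lambda>_. ())"
    have lamC: "laminar C" using laminar_subset[OF lam] by (auto simp: C_def)
    have C'C: "C' \<subseteq> C" "C \<subseteq> D" using stops_subset by (auto simp: C'_def C_def)
    have finC': "finite C'" by (rule finite_subset[OF subset_trans[OF C'C] finD])
    have UC: "\<Union>C = \<Union>C'"
    proof (intro equalityI subsetI)
      fix x assume "x \<in> \<Union>C"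
      then obtain R where R: "R \<in> C" "x \<in> R" by blast
      obtain H' where "H' \<in> C'" "R \<subseteq> H'" using ex_stop[OF lamC R(1), of "\<lambda>_. ()"] unfolding C'_def by blast
      then show "x \<in> \<Union>C'" using R by blast
    qed (use C'C(1) in blast)
    have disC': "pairwise disjnt C'"
    proof (rule pairwiseI)
      fix R R' assume "R \<in> C'" "R' \<in> C'" "R \<noteq> R'"
      then show "disjnt R R'" unfolding C'_def by (intro stops_same_level_disjnt[OF lamC, of R "\<lambda>_. ()"] refl)
    qed
    \<comment> \<open>The running maximum of R may come from an ancestor R'. That ancestor has the
      level of R, hence does not contain H and belongs to \<open>C\<close>; maximality of R in
      \<open>C\<close> gives R' = R, and the average of R itself is large.\<close>
    have small: "2 powr (k H + 2) * measure L R \<le> measure F R" if R: "R \<in> C'" for R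
    proof -
      have RD: "R \<in> D" by (rule subsetD[OF C'C(2) subsetD[OF C'C(1) R]])
      obtain R' where R': "R' \<in> D" "R \<subseteq> R'" "anc_max D \<phi> R = \<phi> R'"
        using anc_max_attained[where \<phi>=\<phi>, OF lam \<phi>pos RD] by auto
      have kR: "k H + 2 \<le> k R" "R \<subset> H" using R C'C by (auto simp: C_def)
      have "anc_max D \<phi> R' = anc_max D \<phi> R"
        using anc_max_antimono[where \<phi>=\<phi>, OF lam \<phi>pos R'(2,1)] anc_max_ge[where \<phi>=\<phi>, OF lam \<phi>pos R'(1), of R'] R'(3) by simp
      then have kR': "k R' = k R" by (simp add: k_def level_def)
      have "R \<noteq> {}" using RD lam by (auto simp: laminar_def)
      then have "R' \<subseteq> H \<or> H \<subseteq> R'" using R' kR(2) laminar_chain[OF lam R'(1) H] by blast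
      moreover have "\<not> H \<subseteq> R'"
      proof
        assume "H \<subseteq> R'"
        then have "k R' \<le> k H" unfolding k_def by (intro level_antimono[where \<phi>=\<phi>, OF lam \<phi>pos H _ R'(1)])
        then show False using kR kR' by simp
      qed
      ultimately have "R' \<in> C" using R'(1) kR kR' by (auto simp: C_def)
      then have "R' = R" using R R'(2) by (auto simp: C'_def stops_def)
      then have "2 powr (k R) \<le> \<phi> R"
        using level_bounds(1)[where \<phi>=\<phi>, OF lam \<phi>pos RD] R' by (simp add: k_def)
      moreover have "(2::real) powr (k H + 2) \<le> 2 powr (k R)" using kR by simp
      ultimately have "2 powr (k H + 2) \<le> \<phi> R" by linarith
      then show ?thesis using Lpos[OF RD] by (simp add: \<phi>_def field_simps)
    qed
    have "2 powr (k H + 2) * (\<Sum>R\<in>C'. measure L R) \<le> (\<Sum>R\<in>C'. measure F R)"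
      unfolding sum_distrib_left by (intro sum_mono small)
    also have "\<dots> \<le> measure F H"
      using C'C DF H finC' disC' by (intro sum_measure_disjnt_le) (auto simp: C_def)
    also have "\<dots> \<le> 2 * 2 powr k H * measure L H"
    proof -
      have "\<phi> H \<le> 2 * 2 powr k H"
        using level_bounds(2)[where \<phi>=\<phi>, OF lam \<phi>pos H] anc_max_ge[where \<phi>=\<phi>, OF lam \<phi>pos H, of H] by (simp add: k_def)
      then show ?thesis using Lpos[OF H] by (simp add: \<phi>_def field_simps)
    qed
    finally have "4 * 2 powr k H * (\<Sum>R\<in>C'. measure L R) \<le> 2 * 2 powr k H * measure L H"
      by (simp add: powr_add)
    then have "2 * 2 powr k H * (2 * (\<Sum>R\<in>C'. measure L R)) \<le> 2 * 2 powr k H * measure L H" by simp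
    then have *: "2 * (\<Sum>R\<in>C'. measure L R) \<le> measure L H"
      by (subst (asm) mult_le_cancel_left_pos) auto
    have "measure L (\<Union>C') \<le> (\<Sum>R\<in>C'. measure L R)"
      using C'C finC' meas by (intro measure_Union_le) auto
    moreover have "measure L (E H) = measure L H - measure L (\<Union>C')"
    proof -
      have "E H = H - \<Union>C'" using UC by (simp add: E_def C_def)
      moreover have "\<Union>C' \<subseteq> H" using C'C by (auto simp: C_def)
      moreover have "\<Union>C' \<in> sets L" using C'C finC' meas by (intro sets.finite_Union) auto
      moreover have "H \<in> fmeasurable L" using DL H by auto
      ultimately show ?thesis by (simp add: measure_Diff fmeasurableD fmeasurableD2)
    qed
    ultimately show ?thesis using * by linarith
  qed
  have overlap: "(\<Sum>H\<in>S. ennreal (measure N H / (2 * measure L H)) * indicator (E H) x) \<le> g x * indicator P x" for x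
  proof -
    define T where "T = {H \<in> S. x \<in> E H}"
    have finT: "finite T" using finS by (simp add: T_def)
    have eq: "(\<Sum>H\<in>S. ennreal (measure N H / (2 * measure L H)) * indicator (E H) x)
        = (\<Sum>H\<in>T. ennreal (measure N H / (2 * measure L H)))"
      using finS by (intro sum.mono_neutral_cong_right) (auto simp: T_def indicator_def)
    show ?thesis
    proof (cases "T = {}")
      case False
      have TP: "H \<in> D" "H \<subseteq> P" "x \<in> H" if "H \<in> T" for H
        using that SD by (auto simp: T_def S_def E_def)
      have inj: "inj_on k T"
        by (rule inj_on_level_stops[OF lam, of T k x]) (auto simp: T_def S_def E_def)
      define a where "a = Min (k ` T)"
      have a: "a \<in> k ` T" "\<And>H. H \<in> T \<Longrightarrow> a \<le> k H" using finT False by (auto simp: a_def)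
      \<comment> \<open>Let H0 have the least level a. A set containing H0 has no higher level, and
        one strictly inside H0 of level at least a + 2 has been removed from \<open>E H0\<close>. As
        levels are distinct, at most two sets remain.\<close>
      have "k H \<le> a + 1" if H: "H \<in> T" for H
      proof -
        obtain H0 where H0: "H0 \<in> T" "k H0 = a" using a(1) by auto
        show ?thesis
        proof (cases "H \<subset> H0")
          case True
          have "\<not> k H0 + 2 \<le> k H" using True H0 TP[OF H] by (auto simp: T_def E_def)
          then show ?thesis using H0 by simp
        next
          case False
          then have "H0 \<subseteq> H" using laminar_chain[OF lam TP(1)[OF H] TP(1)[OF H0(1)] TP(3)[OF H] TP(3)[OF H0(1)]] by auto
          then have "k H \<le> k H0" unfolding k_def
            by (intro level_antimono[where \<phi>=\<phi>, OF lam \<phi>pos TP(1)[OF H0(1)] _ TP(1)[OF H]])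
          then show ?thesis using H0 by simp
        qed
      qed
      then have "k ` T \<subseteq> {a, a + 1}" using a(2) by force
      then have "card (k ` T) \<le> card {a, a + 1}" by (intro card_mono) auto
      then have card: "card T \<le> 2" by (simp add: card_image[OF inj])
      have "(\<Sum>H\<in>T. ennreal (measure N H / (2 * measure L H))) \<le> (\<Sum>H\<in>T. g x / 2)"
      proof (rule sum_mono)
        fix H assume "H \<in> T"
        then have "ennreal (measure N H / measure L H) / 2 \<le> g x / 2"
          using g TP by (intro divide_right_mono_ennreal) auto
        also have "ennreal (measure N H / measure L H) / 2 = ennreal (measure N H / (2 * measure L H))"
          using divide_ennreal[of "measure N H / measure L H" 2] by (simp add: mult.commute)
        finally show "ennreal (measure N H / (2 * measure L H)) \<le> g x / 2" .
      qed
      also have "\<dots> = of_nat (card T) * (g x / 2)" by simp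
      also have "\<dots> \<le> of_nat 2 * (g x / 2)"
        using card by (intro mult_right_mono) (auto simp del: of_nat_numeral)
      also have "\<dots> = g x"
        by (simp add: ennreal_times_divide mult.commute mult_divide_eq_ennreal)
      also have "\<dots> = g x * indicator P x" using False TP by (auto simp: indicator_def)
      finally show ?thesis using eq by simp
    qed (simp add: eq)
  qed
  have "ennreal (\<Sum>H\<in>S. measure N H / 4) \<le> ennreal (\<Sum>H\<in>S. measure N H / (2 * measure L H) * measure L (E H))"
  proof (intro ennreal_leI sum_mono)
    fix H assume "H \<in> S"
    then have HD: "H \<in> D" using SD by auto
    have "measure N H * measure L H \<le> measure N H * (2 * measure L (E H))"
      by (intro mult_left_mono half HD) auto
    then show "measure N H / 4 \<le> measure N H / (2 * measure L H) * measure L (E H)"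
      using Lpos[OF HD] by (simp add: field_simps)
  qed
  also have "\<dots> = (\<Sum>H\<in>S. ennreal (measure N H / (2 * measure L H) * measure L (E H)))"
    by simp
  also have "\<dots> = (\<Sum>H\<in>S. ennreal (measure N H / (2 * measure L H)) * emeasure L (E H))"
  proof (intro sum.cong refl)
    fix H assume "H \<in> S"
    then have HD: "H \<in> D" using SD by auto
    have "E H \<subseteq> H" by (auto simp: E_def)
    then have "E H \<in> fmeasurable L" by (rule fmeasurableI2[OF subsetD[OF DL HD] _ Emeas[OF HD]])
    then show "ennreal (measure N H / (2 * measure L H) * measure L (E H)) = ennreal (measure N H / (2 * measure L H)) * emeasure L (E H)"
      by (simp add: emeasure_eq_measure2 flip: ennreal_mult)
  qed
  also have "\<dots> = (\<Sum>H\<in>S. \<integral>\<^sup>+x. ennreal (measure N H / (2 * measure L H)) * indicator (E H) x \<partial>L)"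
    using Emeas SD finS by (intro sum.cong refl nn_integral_cmult_indicator[symmetric]) auto
  also have "\<dots> = (\<integral>\<^sup>+x. (\<Sum>H\<in>S. ennreal (measure N H / (2 * measure L H)) * indicator (E H) x) \<partial>L)"
    using Emeas SD finS by (intro nn_integral_sum[symmetric]) auto
  also have "\<dots> \<le> (\<integral>\<^sup>+x. g x * indicator P x \<partial>L)"
    by (intro nn_integral_mono overlap)
  finally show ?thesis unfolding S_def k_def .
qed

section \<open>Hoelder estimates over stopping sets, strong and weak\<close>

text \<open>Hoelder with exponents q and r. The \<gamma>-factor runs over its own stopping sets and
  is controlled by Y without loss. The \<phi>-factor runs over foreign stopping sets and passes
  through \<open>carleson_embedding\<close> with \<theta> = q/p, at the cost K^(1/q).\<close>

lemma stop_pair_sum_strong: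
  fixes D :: "'a set set" and \<phi> \<gamma> s t :: "'a set \<Rightarrow> real" and p q r K X Y :: real
  assumes lam: "laminar D" and pos: "\<And>Q. Q \<in> D \<Longrightarrow> \<phi> Q > 0" "\<And>Q. Q \<in> D \<Longrightarrow> \<gamma> Q > 0"
    and s: "\<And>Q. Q \<in> D \<Longrightarrow> s Q \<ge> 0" and t: "\<And>Q. Q \<in> D \<Longrightarrow> t Q \<ge> 0"
    and mono: "\<And>Q R. Q \<in> D \<Longrightarrow> R \<in> D \<Longrightarrow> Q \<subseteq> R \<Longrightarrow> s Q \<le> s R"
    and pqr: "p > 1" "p \<le> q" "r > 1" "1 / q + 1 / r = 1"
    and carl: "\<And>P. P \<in> D \<Longrightarrow> (\<Sum>H\<in>{H \<in> D. H \<subseteq> P}. s H) \<le> K * s P" and K: "K \<ge> 0"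
    and X: "(\<Sum>H\<in>stops D (level D \<phi>). 2 powr (p * level D \<phi> H) * s H) \<le> X"
    and Y: "(\<Sum>H\<in>stops D (level D \<gamma>). 2 powr (r * level D \<gamma> H) * t H) \<le> Y"
  shows "(\<Sum>H\<in>stops D (level D \<gamma>). anc_max D \<phi> H * anc_max D \<gamma> H * (s H powr (1/p) * t H powr (1/r)))
          \<le> 4 * K powr (1/q) * X powr (1/p) * Y powr (1/r)"
proof -
  define C where "C = stops D (level D \<gamma>)"
  have fin: "finite D" using laminar_finite[OF lam] .
  have CD: "C \<subseteq> D" using stops_subset by (auto simp: C_def)
  have m\<phi>: "anc_max D \<phi> Q > 0" and m\<gamma>: "anc_max D \<gamma> Q > 0" if "Q \<in> D" for Q
    using anc_max_pos[where \<phi>=\<phi>, OF lam pos(1) that] anc_max_pos[where \<phi>=\<gamma>, OF lam pos(2) that] by auto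
  have XY: "X \<ge> 0" "Y \<ge> 0"
    by (rule order_trans[OF sum_nonneg X] order_trans[OF sum_nonneg Y]; use s t stops_subset in force)+
  have q: "q > 1" using pqr by linarith
  have "(\<Sum>H\<in>C. (anc_max D \<phi> H powr p * s H) powr (q / p)) \<le> K * (2 powr p * X) powr (q / p)"
  proof (rule carleson_embedding[OF lam pos(1) s mono _ _ CD _ K X])
    fix P assume P: "P \<in> D"
    have "(\<Sum>H\<in>{H \<in> C. H \<subseteq> P}. s H) \<le> (\<Sum>H\<in>{H \<in> D. H \<subseteq> P}. s H)"
      using CD fin s by (intro sum_mono2) auto
    also have "\<dots> \<le> K * s P" by (rule carl[OF P])
    finally show "(\<Sum>H\<in>{H \<in> C. H \<subseteq> P}. s H) \<le> K * s P" .
  qed (use pqr in auto)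
  also have "(\<Sum>H\<in>C. (anc_max D \<phi> H powr p * s H) powr (q / p)) = (\<Sum>H\<in>C. (anc_max D \<phi> H * s H powr (1/p)) powr q)"
    using m\<phi> CD s pqr by (intro sum.cong refl) (auto simp: powr_mult powr_powr less_imp_le subset_iff)
  finally have A: "(\<Sum>H\<in>C. (anc_max D \<phi> H * s H powr (1/p)) powr q) \<le> K * (2 powr p * X) powr (q / p)" .
  have B: "(\<Sum>H\<in>C. (anc_max D \<gamma> H * t H powr (1/r)) powr r) \<le> 2 powr r * Y"
  proof -
    have "(\<Sum>H\<in>C. (anc_max D \<gamma> H * t H powr (1/r)) powr r) \<le> (\<Sum>H\<in>C. 2 powr r * (2 powr (r * level D \<gamma> H) * t H))"
    proof (rule sum_mono)
      fix H assume "H \<in> C"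
      then have H: "H \<in> D" using CD by auto
      have "anc_max D \<gamma> H powr r \<le> (2 * 2 powr level D \<gamma> H) powr r"
        using level_bounds(2)[where \<phi>=\<gamma>, OF lam pos(2) H] m\<gamma>[OF H] pqr by (intro powr_mono2) auto
      also have "\<dots> = 2 powr r * 2 powr (r * level D \<gamma> H)" by (simp add: powr_mult powr_powr mult.commute)
      finally have "anc_max D \<gamma> H powr r * t H \<le> 2 powr r * 2 powr (r * level D \<gamma> H) * t H"
        using t[OF H] by (intro mult_right_mono)
      then show "(anc_max D \<gamma> H * t H powr (1/r)) powr r \<le> 2 powr r * (2 powr (r * level D \<gamma> H) * t H)"
        using m\<gamma>[OF H] t[OF H] pqr by (simp add: powr_mult powr_powr less_imp_le mult.assoc)
    qed
    also have "\<dots> \<le> 2 powr r * Y"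
      unfolding sum_distrib_left[symmetric] using Y by (simp add: C_def)
    finally show ?thesis .
  qed
  have "(\<Sum>H\<in>C. anc_max D \<phi> H * anc_max D \<gamma> H * (s H powr (1/p) * t H powr (1/r)))
      = (\<Sum>H\<in>C. (anc_max D \<phi> H * s H powr (1/p)) * (anc_max D \<gamma> H * t H powr (1/r)))"
    by (intro sum.cong) auto
  also have "\<dots> \<le> (K * (2 powr p * X) powr (q / p)) powr (1/q) * (2 powr r * Y) powr (1/r)"
    using A B pqr q m\<phi> m\<gamma> CD by (intro Holder_sum) (auto simp: less_imp_le subset_iff)
  also have "(K * (2 powr p * X) powr (q / p)) powr (1/q) = 2 * K powr (1/q) * X powr (1/p)"
    using XY K pqr q by (simp add: powr_mult powr_powr)
  also have "(2 powr r * Y) powr (1/r) = 2 * Y powr (1/r)"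
    using XY pqr by (simp add: powr_mult powr_powr)
  finally show ?thesis by (simp add: C_def)
qed

lemma sum_powr_le_powr_sum:
  fixes t :: "'a \<Rightarrow> real"
  assumes "finite I" "\<And>i. i \<in> I \<Longrightarrow> t i \<ge> 0" "\<theta> \<ge> 1"
  shows "(\<Sum>i\<in>I. t i powr \<theta>) \<le> (\<Sum>i\<in>I. t i) powr \<theta>"
proof -
  define Z where "Z = (\<Sum>i\<in>I. t i)"
  have Z: "Z \<ge> 0" "\<And>i. i \<in> I \<Longrightarrow> t i \<le> Z"
    using assms by (auto simp: Z_def intro!: sum_nonneg member_le_sum)
  have "(\<Sum>i\<in>I. t i powr \<theta>) \<le> (\<Sum>i\<in>I. Z powr (\<theta> - 1) * t i)"
  proof (rule sum_mono)
    fix i assume i: "i \<in> I"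
    have "t i powr \<theta> = t i powr (\<theta> - 1) * t i"
      using assms(2)[OF i] powr_add[of "t i" "\<theta> - 1" 1] by (cases "t i = 0") auto
    also have "\<dots> \<le> Z powr (\<theta> - 1) * t i"
      using Z i assms by (intro mult_right_mono powr_mono2) auto
    finally show "t i powr \<theta> \<le> Z powr (\<theta> - 1) * t i" .
  qed
  also have "\<dots> = Z powr (\<theta> - 1) * Z" by (simp add: Z_def sum_distrib_left)
  also have "\<dots> = Z powr \<theta>" using Z(1) powr_add[of Z "\<theta> - 1" 1] by (cases "Z = 0") auto
  finally show ?thesis by (simp add: Z_def)
qed

text \<open>Stopping sets of one \<gamma>-level j are disjoint, so s is Carleson on them with
  constant 1. There \<gamma> is about 2^j and the values of t sum to at most 2^(-j) Z; Hoelder with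
  p and p' yields the factor 2^j * 2^(-j/r). Since \<gamma> \<le> 1 forces j \<le> 0, and 1 - 1/r >
  0, the levels add up geometrically.\<close>

lemma stop_pair_sum_weak:
  fixes D :: "'a set set" and \<phi> \<gamma> s t :: "'a set \<Rightarrow> real" and p p' r X Z :: real
  assumes lam: "laminar D" and pos: "\<And>Q. Q \<in> D \<Longrightarrow> \<phi> Q > 0" "\<And>Q. Q \<in> D \<Longrightarrow> \<gamma> Q > 0"
    and s: "\<And>Q. Q \<in> D \<Longrightarrow> s Q \<ge> 0" and t: "\<And>Q. Q \<in> D \<Longrightarrow> t Q \<ge> 0"
    and sub: "\<And>C P. C \<subseteq> D \<Longrightarrow> P \<in> D \<Longrightarrow> pairwise disjnt C \<Longrightarrow> (\<And>Q. Q \<in> C \<Longrightarrow> Q \<subseteq> P) \<Longrightarrow> sum s C \<le> s P"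
    and p: "p > 1" "p' > 1" "1 / p + 1 / p' = 1" and r: "1 < r" "r \<le> p'"
    and \<gamma>1: "\<And>Q. Q \<in> D \<Longrightarrow> \<gamma> Q \<le> 1"
    and X: "(\<Sum>H\<in>stops D (level D \<phi>). 2 powr (p * level D \<phi> H) * s H) \<le> X"
    and Z: "\<And>C. C \<subseteq> D \<Longrightarrow> pairwise disjnt C \<Longrightarrow> (\<Sum>H\<in>C. \<gamma> H * t H) \<le> Z" "Z \<ge> 0"
  shows "(\<Sum>H\<in>stops D (level D \<gamma>). anc_max D \<phi> H * anc_max D \<gamma> H * (s H powr (1/p) * t H powr (1/r)))
          \<le> 4 / (1 - 2 powr (- (1 - 1/r))) * X powr (1/p) * Z powr (1/r)"
proof -
  define k where "k = level D \<gamma>"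
  define C where "C = stops D k"
  define G where "G = (\<lambda>j. {H \<in> C. k H = j})"
  have fin: "finite D" using laminar_finite[OF lam] .
  have CD: "C \<subseteq> D" using stops_subset by (auto simp: C_def)
  have finC: "finite C" using CD fin finite_subset by blast
  have m\<phi>: "anc_max D \<phi> Q > 0" and m\<gamma>: "anc_max D \<gamma> Q > 0" if "Q \<in> D" for Q
    using anc_max_pos[where \<phi>=\<phi>, OF lam pos(1) that] anc_max_pos[where \<phi>=\<gamma>, OF lam pos(2) that] by auto
  have X0: "X \<ge> 0"
    by (rule order_trans[OF sum_nonneg X]; use s stops_subset in force)
  have mono: "s Q \<le> s R" if "Q \<in> D" "R \<in> D" "Q \<subseteq> R" for Q R
    using sub[of "{Q}" R] that by (auto simp: pairwise_def)
  have Gdis: "pairwise disjnt (G j)" for j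
    using stops_same_level_disjnt[OF lam, of _ k] unfolding G_def C_def pairwise_def by auto
  have GD: "G j \<subseteq> D" "finite (G j)" for j using CD finC by (auto simp: G_def)
  have term_j: "(\<Sum>H\<in>G j. anc_max D \<phi> H * anc_max D \<gamma> H * (s H powr (1/p) * t H powr (1/r)))
      \<le> (4 * X powr (1/p) * Z powr (1/r)) * 2 powr ((1 - 1/r) * j)" for j
  proof -
    have A: "(\<Sum>H\<in>G j. (anc_max D \<phi> H * s H powr (1/p)) powr p) \<le> 2 powr p * X"
    proof -
      have "(\<Sum>H\<in>G j. (anc_max D \<phi> H powr p * s H) powr 1) \<le> 1 * (2 powr p * X) powr 1"
      proof (rule carleson_embedding[OF lam pos(1) s mono _ _ GD(1) _ _ X])
        fix P assume P: "P \<in> D"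
        have "pairwise disjnt {H \<in> G j. H \<subseteq> P}" using Gdis[of j] by (auto simp: pairwise_def)
        then have "sum s {H \<in> G j. H \<subseteq> P} \<le> s P"
          by (intro sub P) (use GD(1)[of j] in blast)+
        then show "(\<Sum>H\<in>{H \<in> G j. H \<subseteq> P}. s H) \<le> 1 * s P" by simp
      qed (use p in auto)
      also have "(\<Sum>H\<in>G j. (anc_max D \<phi> H powr p * s H) powr 1) = (\<Sum>H\<in>G j. (anc_max D \<phi> H * s H powr (1/p)) powr p)"
        using m\<phi> GD(1)[of j] s p by (intro sum.cong refl) (auto simp: powr_mult powr_powr less_imp_le subset_iff)
      finally show ?thesis using X0 by simp
    qed
    have tj: "(\<Sum>H\<in>G j. t H) \<le> 2 powr (- j) * Z"
    proof -
      have "2 powr j * (\<Sum>H\<in>G j. t H) \<le> (\<Sum>H\<in>G j. \<gamma> H * t H)"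
        unfolding sum_distrib_left
      proof (intro sum_mono mult_right_mono)
        fix H assume H: "H \<in> G j"
        show "2 powr j \<le> \<gamma> H"
          using level_bounds(1)[where \<phi>=\<gamma>, OF lam pos(2), of H] anc_max_stop[where \<phi>=\<gamma>, OF lam pos(2), of H] H GD(1)[of j]
          by (auto simp: G_def C_def k_def)
      qed (use t GD in auto)
      also have "\<dots> \<le> Z" by (intro Z GD Gdis)
      finally show ?thesis by (simp add: powr_minus field_simps)
    qed
    have B: "(\<Sum>H\<in>G j. (t H powr (1/r)) powr p') \<le> (2 powr (- j) * Z) powr (p' / r)"
    proof -
      have "(\<Sum>H\<in>G j. (t H powr (1/r)) powr p') = (\<Sum>H\<in>G j. t H powr (p' / r))"
        by (simp add: powr_powr)
      \<comment> \<open>The gap between the exponents is used here: p'/r \<ge> 1, so the l^1 bound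
        on t suffices.\<close>
      also have "\<dots> \<le> (\<Sum>H\<in>G j. t H) powr (p' / r)"
        using GD t r by (intro sum_powr_le_powr_sum) auto
      also have "\<dots> \<le> (2 powr (- j) * Z) powr (p' / r)"
        using tj GD t r by (intro powr_mono2 sum_nonneg) auto
      finally show ?thesis .
    qed
    have "(\<Sum>H\<in>G j. anc_max D \<phi> H * anc_max D \<gamma> H * (s H powr (1/p) * t H powr (1/r)))
        \<le> (\<Sum>H\<in>G j. 2 * 2 powr j * ((anc_max D \<phi> H * s H powr (1/p)) * t H powr (1/r)))"
    proof (rule sum_mono)
      fix H assume H: "H \<in> G j"
      then have HD: "H \<in> D" using GD(1)[of j] by auto
      have "anc_max D \<gamma> H \<le> 2 * 2 powr j"
        using level_bounds(2)[where \<phi>=\<gamma>, OF lam pos(2) HD] H by (simp add: G_def k_def)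
      then have "anc_max D \<gamma> H * ((anc_max D \<phi> H * s H powr (1/p)) * t H powr (1/r))
          \<le> 2 * 2 powr j * ((anc_max D \<phi> H * s H powr (1/p)) * t H powr (1/r))"
        using m\<phi>[OF HD] by (intro mult_right_mono) (auto simp: less_imp_le subset_iff)
      then show "anc_max D \<phi> H * anc_max D \<gamma> H * (s H powr (1/p) * t H powr (1/r))
          \<le> 2 * 2 powr j * ((anc_max D \<phi> H * s H powr (1/p)) * t H powr (1/r))"
        by (simp add: mult_ac)
    qed
    also have "\<dots> \<le> 2 * 2 powr j * ((2 powr p * X) powr (1/p) * ((2 powr (- j) * Z) powr (p' / r)) powr (1/p'))"
      unfolding sum_distrib_left[symmetric] using A B p m\<phi> GD
      by (intro mult_left_mono Holder_sum) (auto simp: less_imp_le subset_iff)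
    also have "\<dots> = (4 * X powr (1/p) * Z powr (1/r)) * (2 powr j * (2 powr (- j)) powr (1/r))"
      using p r X0 Z(2) by (simp add: powr_mult powr_powr)
    also have "2 powr j * (2 powr (- j)) powr (1/r) = (2::real) powr ((1 - 1/r) * j)"
      by (simp add: powr_powr algebra_simps flip: powr_add)
    finally show ?thesis .
  qed
  have "(\<Sum>H\<in>C. anc_max D \<phi> H * anc_max D \<gamma> H * (s H powr (1/p) * t H powr (1/r)))
      = (\<Sum>j\<in>k ` C. \<Sum>H\<in>G j. anc_max D \<phi> H * anc_max D \<gamma> H * (s H powr (1/p) * t H powr (1/r)))"
    unfolding G_def by (rule sum.image_gen[OF finC])
  also have "\<dots> \<le> (\<Sum>j\<in>k ` C. (4 * X powr (1/p) * Z powr (1/r)) * 2 powr ((1 - 1/r) * j))"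
    by (intro sum_mono term_j)
  also have "\<dots> \<le> (4 * X powr (1/p) * Z powr (1/r)) / (1 - 2 powr (- (1 - 1/r)))"
  proof (intro geometric_int_sum_le)
    fix j assume "j \<in> k ` C"
    then obtain H where H: "H \<in> C" "j = k H" by auto
    have "2 powr k H \<le> \<gamma> H"
      using level_bounds(1)[where \<phi>=\<gamma>, OF lam pos(2), of H] anc_max_stop[where \<phi>=\<gamma>, OF lam pos(2), of H] H CD
      by (auto simp: C_def k_def)
    also have "\<dots> \<le> 2 powr 0" using \<gamma>1 H CD by auto
    finally have "k H \<le> 0" by (subst (asm) powr_le_cancel_iff) auto
    then have "(1 - 1/r) * j \<le> 0" using H r by (intro mult_nonneg_nonpos) auto
    then have "(2::real) powr ((1 - 1/r) * j) \<le> 1" using powr_mono[of "(1 - 1/r) * j" 0 "2::real"] by simp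
    then show "(4 * X powr (1/p) * Z powr (1/r)) * 2 powr ((1 - 1/r) * j) \<le> 4 * X powr (1/p) * Z powr (1/r)"
      using mult_left_mono[of "2 powr ((1 - 1/r) * j)" 1 "4 * X powr (1/p) * Z powr (1/r)"] by simp
  qed (use finC r in auto)
  finally show ?thesis by (simp add: C_def k_def)
qed

section \<open>The bilinear form of the dyadic fractional integral\<close>

text \<open>The kernel at Q times F(Q) is the Lebesgue average of F times 2^(\<alpha> lev Q).
  Freezing that average between its stopping cubes leaves exactly the sum of
  \<open>scale_sum_le\<close>. The point is that the remaining cubes fall under
  \<open>stops_carleson\<close>, which a full dyadic family does not.\<close>

lemma sparse_reduction:
  fixes lev :: "'a set \<Rightarrow> int" and n \<alpha> :: real and L F G :: "'a measure" and D :: "'a set set"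
  assumes lam: "laminar D" and DG: "D \<subseteq> fmeasurable G"
    and disj: "\<And>Q R. Q \<in> D \<Longrightarrow> R \<in> D \<Longrightarrow> lev Q = lev R \<Longrightarrow> Q \<noteq> R \<Longrightarrow> disjnt Q R"
    and lev: "\<And>Q R. Q \<in> D \<Longrightarrow> R \<in> D \<Longrightarrow> Q \<subseteq> R \<Longrightarrow> lev Q \<le> lev R"
    and L: "\<And>Q. Q \<in> D \<Longrightarrow> measure L Q = 2 powr (n * lev Q)"
    and Fpos: "\<And>Q. Q \<in> D \<Longrightarrow> measure F Q > 0" and \<alpha>: "\<alpha> > 0"
  shows "(\<Sum>Q\<in>D. 2 powr (- ((n - \<alpha>) * lev Q)) * (measure F Q * measure G Q))
    \<le> 2 / (1 - 2 powr (- \<alpha>))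
        * (\<Sum>Q\<in>stops D (level D (\<lambda>Q. measure F Q / measure L Q)).
             2 powr (- ((n - \<alpha>) * lev Q)) * (measure F Q * measure G Q))"
proof -
  define \<phi> where "\<phi> = (\<lambda>Q. measure F Q / measure L Q)"
  have eq: "\<phi> Q * (2 powr (\<alpha> * lev Q) * measure G Q) = 2 powr (- ((n - \<alpha>) * lev Q)) * (measure F Q * measure G Q)"
    if "Q \<in> D" for Q
  proof -
    have "\<phi> Q = measure F Q * 2 powr (- (n * lev Q))" using L[OF that] by (simp add: \<phi>_def powr_minus_divide)
    then have "\<phi> Q * (2 powr (\<alpha> * lev Q) * measure G Q)
        = (2 powr (- (n * lev Q)) * 2 powr (\<alpha> * lev Q)) * (measure F Q * measure G Q)" by simp
    also have "2 powr (- (n * lev Q)) * 2 powr (\<alpha> * lev Q) = (2::real) powr (- ((n - \<alpha>) * lev Q))"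
      by (simp add: algebra_simps flip: powr_add)
    finally show ?thesis .
  qed
  have "(\<Sum>Q\<in>D. 2 powr (- ((n - \<alpha>) * lev Q)) * (measure F Q * measure G Q))
      = (\<Sum>Q\<in>D. \<phi> Q * (2 powr (\<alpha> * lev Q) * measure G Q))"
    by (intro sum.cong refl) (simp add: eq)
  also have "\<dots> \<le> 2 * (\<Sum>H\<in>stops D (level D \<phi>). \<phi> H * (1 / (1 - 2 powr (- \<alpha>)) * (2 powr (\<alpha> * lev H) * measure G H)))"
  proof (rule level_stop_sum_le[OF lam])
    fix Q assume "Q \<in> D"
    then show "\<phi> Q > 0" using Fpos L by (simp add: \<phi>_def)
  next
    fix H assume "H \<in> D"
    then show "(\<Sum>Q\<in>{Q \<in> D. Q \<subseteq> H}. 2 powr (\<alpha> * lev Q) * measure G Q)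
        \<le> 1 / (1 - 2 powr (- \<alpha>)) * (2 powr (\<alpha> * lev H) * measure G H)"
      by (intro scale_sum_le[OF lam DG disj lev \<alpha>])
  qed auto
  also have "\<dots> = 2 / (1 - 2 powr (- \<alpha>)) * (\<Sum>H\<in>stops D (level D \<phi>). \<phi> H * (2 powr (\<alpha> * lev H) * measure G H))"
    by (simp add: sum_distrib_left)
  also have "(\<Sum>H\<in>stops D (level D \<phi>). \<phi> H * (2 powr (\<alpha> * lev H) * measure G H))
      = (\<Sum>H\<in>stops D (level D \<phi>). 2 powr (- ((n - \<alpha>) * lev H)) * (measure F H * measure G H))"
    using stops_subset by (intro sum.cong refl eq) auto
  finally show ?thesis by (simp add: \<phi>_def)
qed

text \<open>The constant of \<open>laminar_kernel_sum_le\<close> with d = a + b; its terms come from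
  the scales above and below the reference scale.\<close>

definition kernel_const :: "real \<Rightarrow> real \<Rightarrow> real" where
  "kernel_const e d = 1 / (1 - 2 powr (- e)) + 1 / (1 - 2 powr (- (e * (1 / d - 1))))"

definition stop_const :: "real \<Rightarrow> real" where
  "stop_const p = 2 powr p / (1 - 2 powr (1 - p))"

lemma kernel_const_pos: "0 < e \<Longrightarrow> 0 < d \<Longrightarrow> d < 1 \<Longrightarrow> kernel_const e d > 0"
  unfolding kernel_const_def by (intro add_pos_pos divide_pos_pos) (auto simp: powr_less_one field_simps)

lemma stop_const_pos: "1 < p \<Longrightarrow> stop_const p > 0"
  unfolding stop_const_def by (intro divide_pos_pos) (auto simp: powr_less_one)

context
  fixes lev :: "'a set \<Rightarrow> int" and D :: "'a set set" and M N :: "'a measure" and f g :: "'a \<Rightarrow> real"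
    and e B p p' q r X Y Kg :: real
  fixes F G :: "'a measure"
  assumes F_def: "F = density M (\<lambda>x. ennreal (f x))" and G_def: "G = density N (\<lambda>x. ennreal (g x))"
  assumes lam: "laminar D"
    and D: "D \<subseteq> fmeasurable M" "D \<subseteq> fmeasurable N" "D \<subseteq> fmeasurable F" "D \<subseteq> fmeasurable G"
    and pos: "\<And>Q. Q \<in> D \<Longrightarrow> measure M Q > 0" "\<And>Q. Q \<in> D \<Longrightarrow> measure N Q > 0"
      "\<And>Q. Q \<in> D \<Longrightarrow> measure F Q > 0" "\<And>Q. Q \<in> D \<Longrightarrow> measure G Q > 0"
    and f: "f \<in> borel_measurable M" "\<And>x. f x \<ge> 0" and g: "g \<in> borel_measurable N" "\<And>x. g x \<ge> 0"
    and disj: "\<And>Q R. Q \<in> D \<Longrightarrow> R \<in> D \<Longrightarrow> lev Q = lev R \<Longrightarrow> Q \<noteq> R \<Longrightarrow> disjnt Q R"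
    and e: "e > 0" and B: "B > 0"
    and A: "\<And>Q. Q \<in> D \<Longrightarrow> measure M Q powr (1/p') * measure N Q powr (1/q) \<le> B * 2 powr (e * lev Q)"
    and pq: "1 < p" "p < q" "1/p + 1/p' = 1" "1/q + 1/r = 1"
    and X: "(\<integral>\<^sup>+x. ennreal (f x powr p) \<partial>M) \<le> ennreal X" "X \<ge> 0"
    and Y: "(\<integral>\<^sup>+x. ennreal (g x powr r) \<partial>N) \<le> ennreal Y" "Y \<ge> 0"
    and Kg: "\<And>P. P \<in> D \<Longrightarrow> (\<Sum>H\<in>{H \<in> D. H \<subseteq> P}. measure N H) \<le> Kg * measure N P" "Kg \<ge> 0"
begin

text \<open>These averages are against the weights, in contrast to the Lebesgue averages that select
  the sparse family. With them F(Q) G(Q) is av1 av2 M(Q) N(Q), so the sum left after freezing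
  involves the weights alone.\<close>

private definition "av1 Q = measure F Q / measure M Q"
private definition "av2 Q = measure G Q / measure N Q"
private definition "KC = kernel_const e (1/p' + 1/q)"
private definition "S1 = (\<Sum>H\<in>stops D (level D av1). anc_max D av1 H * anc_max D av2 H * (measure M H powr (1/p) * measure N H powr (1/r)))"
private definition "S2 = (\<Sum>H\<in>stops D (level D av2). anc_max D av1 H * anc_max D av2 H * (measure M H powr (1/p) * measure N H powr (1/r)))"

private lemmas exps = off_diagonal_exponents[OF pq]

private lemma av_pos: "Q \<in> D \<Longrightarrow> av1 Q > 0" "Q \<in> D \<Longrightarrow> av2 Q > 0"
  using pos by (auto simp: av1_def av2_def)

private lemma mono: "Q \<in> D \<Longrightarrow> R \<in> D \<Longrightarrow> Q \<subseteq> R \<Longrightarrow> measure M Q \<le> measure M R"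
    "Q \<in> D \<Longrightarrow> R \<in> D \<Longrightarrow> Q \<subseteq> R \<Longrightarrow> measure N Q \<le> measure N R"
  using D by (auto intro!: measure_mono_fmeasurable)

private lemma stopF: "(\<Sum>H\<in>stops D (level D av1). 2 powr (p * level D av1 H) * measure M H) \<le> stop_const p * X"
  using stop_sum_Lp_le[OF lam D(1) D(3)[unfolded F_def] f pos(1) pos(3)[unfolded F_def] pq(1) X]
  by (simp add: stop_const_def av1_def[abs_def] flip: F_def)

private lemma stopG: "(\<Sum>H\<in>stops D (level D av2). 2 powr (r * level D av2 H) * measure N H) \<le> stop_const r * Y"
  using stop_sum_Lp_le[OF lam D(2) D(4)[unfolded G_def] g pos(2) pos(4)[unfolded G_def] exps(3) Y]
  by (simp add: stop_const_def av2_def[abs_def] flip: G_def)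

private lemma kernel_form_le:
  "(\<Sum>Q\<in>D. 2 powr (- (e * lev Q)) * (measure F Q * measure G Q)) \<le> 4 * KC * B * (S1 + S2)"
proof -
  define c where "c = (\<lambda>H. KC * (B * (measure M H powr (1/p) * measure N H powr (1/r))))"
  have "(\<Sum>Q\<in>D. 2 powr (- (e * lev Q)) * (measure F Q * measure G Q))
      = (\<Sum>Q\<in>D. av1 Q * av2 Q * (2 powr (- (e * lev Q)) * (measure M Q * measure N Q)))"
    using pos(1,2) by (intro sum.cong refl) (force simp: av1_def av2_def)
  also have "\<dots> \<le> 4 * ((\<Sum>H\<in>stops D (level D av1). anc_max D av1 H * anc_max D av2 H * c H)
         + (\<Sum>H\<in>stops D (level D av2). anc_max D av1 H * anc_max D av2 H * c H))"
  proof (rule level_pair_stop_sum_le[OF lam av_pos])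
    fix H assume H: "H \<in> D"
    show "(\<Sum>Q\<in>{Q \<in> D. Q \<subseteq> H}. 2 powr (- (e * lev Q)) * (measure M Q * measure N Q)) \<le> c H"
      unfolding c_def KC_def kernel_const_def exps(7,8)[symmetric]
      by (rule laminar_kernel_sum_le[OF lam D(1,2) pos(1,2) disj e _ _ exps(5) B A H]) (use exps in auto)
  qed auto
  also have "\<dots> = 4 * KC * B * (S1 + S2)"
    by (simp add: c_def S1_def S2_def sum_distrib_left algebra_simps)
  finally show ?thesis .
qed

text \<open>\<open>stop_pair_sum_strong\<close> with f and g exchanged: (p, q, r) becomes (r, p',
  p), which is admissible because r \<le> p'. Over the stopping cubes of f it is the average of g
  that pays, with the Carleson constant of N, hence the exponent 1/p'.\<close>

private lemma S1_le: "S1 \<le> 4 * Kg powr (1/p') * (stop_const p * X) powr (1/p) * (stop_const r * Y) powr (1/r)"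
proof -
  have "(\<Sum>H\<in>stops D (level D av1). anc_max D av2 H * anc_max D av1 H * (measure N H powr (1/r) * measure M H powr (1/p)))
      \<le> 4 * Kg powr (1/p') * (stop_const r * Y) powr (1/r) * (stop_const p * X) powr (1/p)"
    using exps pq
    by (intro stop_pair_sum_strong[OF lam av_pos(2,1) _ _ mono(2) _ _ _ _ Kg stopG stopF]) auto
  then show ?thesis by (simp add: S1_def mult_ac)
qed

lemma kernel_form_strong:
  assumes Kf: "\<And>P. P \<in> D \<Longrightarrow> (\<Sum>H\<in>{H \<in> D. H \<subseteq> P}. measure M H) \<le> Kf * measure M P" "Kf \<ge> 0"
  shows "(\<Sum>Q\<in>D. 2 powr (- (e * lev Q)) * (measure F Q * measure G Q))
    \<le> 16 * kernel_const e (1/p' + 1/q) * stop_const p powr (1/p) * stop_const r powr (1/r)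
        * B * (Kg powr (1/p') + Kf powr (1/q)) * (X powr (1/p) * Y powr (1/r))"
proof -
  have "S2 \<le> 4 * Kf powr (1/q) * (stop_const p * X) powr (1/p) * (stop_const r * Y) powr (1/r)"
    unfolding S2_def using exps pq
    by (intro stop_pair_sum_strong[OF lam av_pos _ _ mono(1) _ _ _ _ Kf stopF stopG]) auto
  with S1_le have "S1 + S2 \<le> 4 * (Kg powr (1/p') + Kf powr (1/q)) * ((stop_const p * X) powr (1/p) * (stop_const r * Y) powr (1/r))"
    by (simp add: algebra_simps)
  also have "(stop_const p * X) powr (1/p) * (stop_const r * Y) powr (1/r)
      = stop_const p powr (1/p) * stop_const r powr (1/r) * (X powr (1/p) * Y powr (1/r))"
    using X Y stop_const_pos[OF pq(1)] stop_const_pos[OF exps(3)] by (simp add: powr_mult)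
  finally have *: "S1 + S2 \<le> 4 * (Kg powr (1/p') + Kf powr (1/q)) * (stop_const p powr (1/p) * stop_const r powr (1/r) * (X powr (1/p) * Y powr (1/r)))" .
  have "KC > 0" unfolding KC_def using e exps by (intro kernel_const_pos)
  then have "4 * KC * B * (S1 + S2) \<le> 4 * KC * B * (4 * (Kg powr (1/p') + Kf powr (1/q)) * (stop_const p powr (1/p) * stop_const r powr (1/r) * (X powr (1/p) * Y powr (1/r))))"
    using B by (intro mult_left_mono *) auto
  from order_trans[OF kernel_form_le this] show ?thesis unfolding KC_def by (simp add: mult_ac del: distrib_left_numeral)
qed

text \<open>Only the sum over the stopping cubes of g changes: averages of g are at most 1, and the
  bound Y for the G-mass of disjoint families replaces the Carleson condition for M. This sum
  carries no characteristic, so Kg \<ge> 1 serves to put it under the common factor.\<close>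

lemma kernel_form_weak:
  assumes g1: "\<And>x. g x \<le> 1" and GY: "\<And>C. C \<subseteq> D \<Longrightarrow> pairwise disjnt C \<Longrightarrow> (\<Sum>H\<in>C. measure G H) \<le> Y"
    and Kg1: "Kg \<ge> 1"
  shows "(\<Sum>Q\<in>D. 2 powr (- (e * lev Q)) * (measure F Q * measure G Q))
    \<le> 16 * kernel_const e (1/p' + 1/q) * stop_const p powr (1/p) * (1 / (1 - 2 powr (- (1 - 1/r))) + stop_const r powr (1/r))
        * B * Kg powr (1/p') * (X powr (1/p) * Y powr (1/r))"
proof -
  have av2_1: "av2 Q \<le> 1" if Q: "Q \<in> D" for Q
  proof -
    have "emeasure G Q = (\<integral>\<^sup>+x. ennreal (g x) * indicator Q x \<partial>N)"
      using g D Q unfolding G_def by (subst emeasure_density) auto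
    also have "\<dots> \<le> (\<integral>\<^sup>+x. indicator Q x \<partial>N)"
      using g1 by (intro nn_integral_mono) (auto simp: indicator_def)
    also have "\<dots> = emeasure N Q" using D Q by (intro nn_integral_indicator) auto
    finally have "measure G Q \<le> measure N Q"
      using D Q by (auto simp: emeasure_eq_measure2 subset_iff)
    then show ?thesis using pos(2)[OF Q] by (simp add: av2_def)
  qed
  define W where "W = 1 / (1 - 2 powr (- (1 - 1/r)))"
  have W: "W \<ge> 0" using exps powr_mono[of "- (1 - 1/r)" 0 "2::real"] by (simp add: W_def)
  have fin: "finite D" using laminar_finite[OF lam] .
  have "S2 \<le> 4 / (1 - 2 powr (- (1 - 1/r))) * (stop_const p * X) powr (1/p) * Y powr (1/r)"
    unfolding S2_def
  proof (rule stop_pair_sum_weak[OF lam av_pos _ _ _ pq(1) exps(2) pq(3) exps(3) less_imp_le[OF exps(4)] av2_1 stopF])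
    fix C P assume C: "C \<subseteq> D" "P \<in> D" "pairwise disjnt C" "\<And>Q. Q \<in> C \<Longrightarrow> Q \<subseteq> P"
    show "sum (measure M) C \<le> measure M P"
      by (rule sum_measure_disjnt_le[OF finite_subset[OF C(1) fin] subset_trans[OF C(1) D(1)] C(3,4) subsetD[OF D(1) C(2)]])
  next
    fix C assume C: "C \<subseteq> D" "pairwise disjnt C"
    have "(\<Sum>H\<in>C. av2 H * measure N H) = (\<Sum>H\<in>C. measure G H)"
      using pos(2) C by (intro sum.cong refl) (force simp: av2_def)
    then show "(\<Sum>H\<in>C. av2 H * measure N H) \<le> Y" using GY[OF C] by simp
  qed (use Y in auto)
  also have "\<dots> = 4 * W * 1 * ((stop_const p * X) powr (1/p) * Y powr (1/r))" by (simp add: W_def)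
  also have "\<dots> \<le> 4 * W * Kg powr (1/p') * ((stop_const p * X) powr (1/p) * Y powr (1/r))"
    using W Kg1 exps by (intro mult_right_mono mult_left_mono ge_one_powr_ge_zero) auto
  finally have 2: "S2 \<le> 4 * W * Kg powr (1/p') * ((stop_const p * X) powr (1/p) * Y powr (1/r))" .
  have "S1 + S2 \<le> 4 * (W + stop_const r powr (1/r)) * Kg powr (1/p') * (stop_const p powr (1/p) * (X powr (1/p) * Y powr (1/r)))"
    using add_mono[OF S1_le 2] X Y stop_const_pos[OF pq(1)] stop_const_pos[OF exps(3)]
    by (simp add: powr_mult algebra_simps)
  moreover have "KC > 0" unfolding KC_def using e exps by (intro kernel_const_pos)
  ultimately have "4 * KC * B * (S1 + S2) \<le> 4 * KC * B * (4 * (W + stop_const r powr (1/r)) * Kg powr (1/p') * (stop_const p powr (1/p) * (X powr (1/p) * Y powr (1/r))))"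
    using B by (intro mult_left_mono) auto
  from order_trans[OF kernel_form_le this] show ?thesis unfolding KC_def W_def by (simp add: mult_ac del: distrib_left_numeral)
qed

end

section \<open>Dyadic grids\<close>

text \<open>Floors encode half-open cubes, so those of one level partition the space exactly and
  passing to a coarser level is an integer division of the index.\<close>

definition gcube :: "real ^ 'n \<Rightarrow> int \<Rightarrow> ('n \<Rightarrow> int) \<Rightarrow> (real ^ 'n) set" where
  "gcube t k z = {x. \<forall>i. \<lfloor>(x $ i - t $ i) / 2 powr k\<rfloor> = z i}"

text \<open>The scale is recovered from the set, so families of cubes can be plain sets without
  indices.\<close>

definition cube_level :: "(real ^ 'n) set \<Rightarrow> int" where
  "cube_level Q = \<lfloor>log 2 (measure lebesgue Q) / real CARD('n)\<rfloor>"

lemma gcube_iff: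
  "x \<in> gcube t k z \<longleftrightarrow> (\<forall>i. t $ i + z i * 2 powr k \<le> x $ i \<and> x $ i < t $ i + z i * 2 powr k + 2 powr k)"
  unfolding gcube_def mem_Collect_eq floor_eq_iff by (auto simp: field_simps)

lemma gcube_closure:
  fixes t :: "real ^ 'n"
  obtains Q where "Q \<in> cubes" "gcube t k z \<subseteq> Q" "Q - gcube t k z \<in> null_sets lebesgue" "gcube t k z \<in> sets lebesgue"
    "emeasure lebesgue (gcube t k z) = ennreal (2 powr (real CARD('n) * k))"
    "emeasure lebesgue Q = ennreal (2 powr (real CARD('n) * k))"
proof -
  define a :: "real ^ 'n" where "a = (\<chi> i. t $ i + z i * 2 powr k)"
  define b :: "real ^ 'n" where "b = (\<chi> i. a $ i + 2 powr k)"
  have box: "box a b \<subseteq> gcube t k z" "gcube t k z \<subseteq> cbox a b"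
    by (auto simp: gcube_iff mem_box_cart a_def b_def less_imp_le)
  have null: "cbox a b - box a b \<in> null_sets lebesgue"
    using negligible_frontier_interval[of a b] by (simp add: negligible_iff_null_sets)
  have gm: "gcube t k z \<in> sets lebesgue"
  proof -
    have "gcube t k z - box a b \<in> null_sets lebesgue"
      using null_sets_completion_subset[of "gcube t k z - box a b" "cbox a b - box a b" lborel] null box by auto
    then have "box a b \<union> (gcube t k z - box a b) \<in> sets lebesgue" by (intro sets.Un) (auto dest: null_setsD2)
    then show ?thesis using box by (simp add: Un_absorb1)
  qed
  have n2: "cbox a b - gcube t k z \<in> null_sets lebesgue"
    using null_sets_completion_subset[of "cbox a b - gcube t k z" "cbox a b - box a b" lborel] null box by auto
  have "a \<le> b" by (auto simp: less_eq_vec_def b_def)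
  have cb: "emeasure lebesgue (cbox a b) = ennreal (2 powr (real CARD('n) * k))"
  proof -
    have ab: "a \<bullet> j \<le> b \<bullet> j" if "j \<in> Basis" for j
      using that by (auto simp: Basis_vec_def b_def inner_axis)
    have "emeasure lebesgue (cbox a b) = ennreal (\<Prod>j\<in>Basis. (b - a) \<bullet> j)"
      using emeasure_lborel_cbox[OF ab] by simp
    also have "(\<Prod>j\<in>Basis. (b - a) \<bullet> j) = (\<Prod>j\<in>(Basis :: (real ^ 'n) set). 2 powr k)"
      by (intro prod.cong refl) (auto simp: Basis_vec_def b_def inner_axis)
    also have "\<dots> = 2 powr (real CARD('n) * k)"
      by (simp add: powr_powr mult.commute flip: powr_realpow)
    finally show ?thesis .
  qed
  have "emeasure lebesgue (gcube t k z) = emeasure lebesgue (cbox a b)"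
    using emeasure_Diff_null_set[OF n2, of "cbox a b"] box(2) by (simp add: double_diff)
  moreover have "cbox a b \<in> cubes"
    unfolding cubes_def b_def by (intro CollectI exI[of _ a] exI[of _ "2 powr k"]) auto
  ultimately show ?thesis using that[of "cbox a b"] box n2 gm cb by simp
qed

lemma measure_gcube:
  fixes t :: "real ^ 'n"
  shows "measure lebesgue (gcube t k z) = 2 powr (real CARD('n) * k)"
  using gcube_closure[of t k z] by (metis enn2real_ennreal measure_def powr_ge_zero)

lemma cube_level_gcube [simp]: "cube_level (gcube t k z) = k"
  by (simp add: cube_level_def measure_gcube)

lemma gcube_fmeasurable: "gcube t k z \<in> fmeasurable lebesgue"
  using gcube_closure[of t k z] by (metis ennreal_less_top fmeasurableI infinity_ennreal_def)

lemma gcube_nonempty: "gcube t k z \<noteq> {}"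
proof -
  have "(\<chi> i. t $ i + z i * 2 powr k) \<in> gcube t k z" by (simp add: gcube_iff)
  then show ?thesis by blast
qed

lemma gcube_nested:
  assumes "k \<le> l"
  shows "gcube t k z \<subseteq> gcube t l w \<or> disjnt (gcube t k z) (gcube t l w)"
proof (rule ccontr)
  assume "\<not> ?thesis"
  then obtain x y where x: "x \<in> gcube t k z" "x \<in> gcube t l w" and y: "y \<in> gcube t k z" "y \<notin> gcube t l w"
    by (auto simp: disjnt_def)
  have coarse: "\<lfloor>v / 2 powr l\<rfloor> = \<lfloor>v / 2 powr k\<rfloor> div 2 ^ nat (l - k)" for v :: real
  proof -
    have "(2::real) powr l = 2 powr k * 2 powr (l - k)" by (simp flip: powr_add)
    also have "(2::real) powr (l - k) = real_of_int (2 ^ nat (l - k))"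
      using assms powr_realpow[of "2::real" "nat (l - k)"] by simp
    finally have "v / 2 powr l = (v / 2 powr k) / real_of_int (2 ^ nat (l - k))" by simp
    then show ?thesis by (simp only:) (rule floor_divide_real_eq_div, simp)
  qed
  have "y \<in> gcube t l w"
    using x y(1) unfolding gcube_def mem_Collect_eq coarse by simp
  with y(2) show False by simp
qed

lemma gcube_same_level: "z \<noteq> w \<Longrightarrow> disjnt (gcube t k z) (gcube t k w)"
  by (auto simp: gcube_def disjnt_def)

lemma laminar_gcubes:
  assumes "finite D" "\<And>Q. Q \<in> D \<Longrightarrow> \<exists>k z. Q = gcube t k z"
  shows "laminar D"
    and "Q \<in> D \<Longrightarrow> R \<in> D \<Longrightarrow> cube_level Q = cube_level R \<Longrightarrow> Q \<noteq> R \<Longrightarrow> disjnt Q R"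
    and "Q \<in> D \<Longrightarrow> R \<in> D \<Longrightarrow> Q \<subseteq> R \<Longrightarrow> cube_level Q \<le> cube_level R"
proof -
  show "laminar D" unfolding laminar_def
  proof (intro conjI ballI)
    show "{} \<notin> D" using assms(2) gcube_nonempty by (metis)
    fix Q R assume "Q \<in> D" "R \<in> D"
    then obtain k z l w where *: "Q = gcube t k z" "R = gcube t l w" using assms(2) by metis
    show "Q \<subseteq> R \<or> R \<subseteq> Q \<or> disjnt Q R"
      using gcube_nested[of k l t z w] gcube_nested[of l k t w z] unfolding * by (metis disjnt_sym linear)
  qed (rule assms(1))
next
  assume "Q \<in> D" "R \<in> D" "cube_level Q = cube_level R" "Q \<noteq> R"
  moreover from this obtain k z l w where "Q = gcube t k z" "R = gcube t l w" using assms(2) by metis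
  ultimately show "disjnt Q R" using gcube_same_level[of z w t k] by auto
next
  assume *: "Q \<in> D" "R \<in> D" "Q \<subseteq> R"
  then obtain k z l w where QR: "Q = gcube t k z" "R = gcube t l w" using assms(2) by metis
  have "measure lebesgue Q \<le> measure lebesgue R"
    using * gcube_fmeasurable unfolding QR by (intro measure_mono_fmeasurable) auto
  then show "cube_level Q \<le> cube_level R" unfolding QR by (simp add: measure_gcube)
qed

section \<open>The one third trick and the finite shifted grids\<close>

text \<open>If both grids separated the points, each would have a grid point between them, and these
  two would be less than 1/3 apart in units of 2^k. In these units the shift is m/3 with m =
  2^(N-k), so the two points differ by a multiple of 1/3; hence they coincide, and 3 divides a power
  of 2. A single shift thus serves every scale up to N.\<close>

lemma one_third_trick:
  fixes x y :: real and k N :: int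
  assumes "k \<le> N" "\<bar>x - y\<bar> < 2 powr k / 3"
  shows "\<lfloor>x / 2 powr k\<rfloor> = \<lfloor>y / 2 powr k\<rfloor> \<or> \<lfloor>(x - 2 powr N / 3) / 2 powr k\<rfloor> = \<lfloor>(y - 2 powr N / 3) / 2 powr k\<rfloor>"
  using assms(2)
proof (induction x y rule: linorder_wlog)
  case (le x y)
  define X Y where "X = x / 2 powr k" and "Y = y / 2 powr k"
  define m :: int where "m = 2 ^ nat (N - k)"
  have XY: "X \<le> Y" "Y - X < 1 / 3"
    using le by (auto simp: X_def Y_def field_simps abs_less_iff)
  have m: "\<not> 3 dvd m"
  proof
    assume "3 dvd m"
    then have "3 dvd (2::int)" unfolding m_def
      by (rule prime_dvd_power[rotated]) simp
    then show False by simp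
  qed
  have "2 powr N / 3 / 2 powr k = (2::real) powr (N - k) / 3" by (simp add: powr_diff)
  also have "(2::real) powr (N - k) = m"
    using assms(1) powr_realpow[of "2::real" "nat (N - k)"] by (simp add: m_def)
  finally have shift: "(v - 2 powr N / 3) / 2 powr k = v / 2 powr k - m / 3" for v
    by (simp add: diff_divide_distrib)
  have "\<lfloor>X\<rfloor> = \<lfloor>Y\<rfloor> \<or> \<lfloor>X - m / 3\<rfloor> = \<lfloor>Y - m / 3\<rfloor>"
  proof (rule ccontr)
    assume *: "\<not> ?thesis"
    define a w where "a = \<lfloor>Y\<rfloor>" and "w = \<lfloor>Y - m / 3\<rfloor>"
    have "\<lfloor>X\<rfloor> < a" "\<lfloor>X - m / 3\<rfloor> < w"
      using * XY floor_mono[of X Y] floor_mono[of "X - m / 3" "Y - m / 3"] by (auto simp: a_def w_def)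
    then have "X < a" "X - m / 3 < w" "a \<le> Y" "w \<le> Y - m / 3" by (auto simp: a_def w_def floor_less_iff)
    then have "\<bar>real_of_int (3 * a - m - 3 * w)\<bar> < 1" using XY by simp
    then have "3 * a - m - 3 * w = 0" by linarith
    then have "m = 3 * (a - w)" by simp
    then show False using m by (metis dvd_triv_left)
  qed
  then show ?case unfolding shift by (simp add: X_def Y_def)
next
  case (sym x y)
  then show ?case by (simp add: abs_minus_commute eq_commute)
qed

definition grid_shift :: "nat \<Rightarrow> ('n \<Rightarrow> bool) \<Rightarrow> real ^ 'n" where
  "grid_shift N \<tau> = (\<chi> i. if \<tau> i then 2 powr N / 3 else 0)"

text \<open>Levels and indices are cut off in terms of N to keep the family finite. Each coordinate
  is shifted or not independently, giving 2^n grids for every N.\<close>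

definition grid :: "nat \<Rightarrow> ('n \<Rightarrow> bool) \<Rightarrow> (real ^ 'n) set set" where
  "grid N \<tau> = (\<lambda>(k, z). gcube (grid_shift N \<tau>) k z) `
     ({- int N..int N} \<times> {z. \<forall>i. z i \<in> {- (4 ^ (N + 1))..4 ^ (N + 1)}})"

lemma finite_grid: "finite (grid N \<tau> :: (real ^ 'n) set set)"
proof -
  have "finite (PiE (UNIV :: 'n set) (\<lambda>_. {- (4 ^ (N + 1))..4 ^ (N + 1) :: int}))"
    by (intro finite_PiE) auto
  then have "finite {z :: 'n \<Rightarrow> int. \<forall>i. z i \<in> {- (4 ^ (N + 1))..4 ^ (N + 1)}}"
    by (simp add: PiE_UNIV_domain Pi_def)
  then show ?thesis unfolding grid_def by (intro finite_imageI finite_cartesian_product) auto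
qed

lemma grid_gcube: "Q \<in> grid N \<tau> \<Longrightarrow> \<exists>k z. Q = gcube (grid_shift N \<tau>) k z"
  by (auto simp: grid_def)

lemma kernel_le_grid_sum:
  fixes x y :: "real ^ 'n" and e :: real
  assumes N: "1 \<le> N" and x: "\<And>i. \<bar>x $ i\<bar> \<le> 2 powr N" and e: "e > 0"
    and xy: "2 powr (- real N - 1) / 3 \<le> norm (x - y)" "norm (x - y) < 2 powr N / 3"
  shows "1 / norm (x - y) powr e \<le> 6 powr e * (\<Sum>\<tau>\<in>UNIV. \<Sum>Q\<in>grid N \<tau>. 2 powr (- (e * cube_level Q)) * (indicator Q x * indicator Q y))"
proof -
  define s where "s = norm (x - y)"
  have "(0::real) < 2 powr (- real N - 1) / 3" by simp
  then have s: "s > 0" using xy(1) unfolding s_def by linarith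
  \<comment> \<open>This choice means 3 |x - y| < 2^k \<le> 6 |x - y|: the first inequality is what
    the one third trick asks for, the second produces 6^e.\<close>
  define k where "k = \<lfloor>log 2 (3 * s)\<rfloor> + 1"
  have k_le: "2 powr k \<le> 6 * s"
  proof -
    have "2 powr \<lfloor>log 2 (3 * s)\<rfloor> \<le> 3 * s" using s by (simp add: le_log_iff[symmetric])
    then show ?thesis by (simp add: k_def powr_add)
  qed
  have k_gt: "3 * s < 2 powr k"
  proof -
    have "log 2 (3 * s) < k" by (simp add: k_def)
    then show ?thesis using s by (simp add: log_less_iff)
  qed
  have kN: "- int N \<le> k" "k \<le> int N"
  proof -
    have "2 powr (- real N - 1) \<le> 3 * s" using xy by (simp add: s_def)
    then have "- real N - 1 \<le> log 2 (3 * s)" using s by (simp add: le_log_iff)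
    then have "- int N - 1 \<le> \<lfloor>log 2 (3 * s)\<rfloor>" by (simp add: le_floor_iff)
    then show "- int N \<le> k" by (simp add: k_def)
    have "3 * s < 2 powr N" using xy by (simp add: s_def)
    then have "log 2 (3 * s) < real N" using s by (simp add: log_less_iff)
    then have "\<lfloor>log 2 (3 * s)\<rfloor> < int N" by (simp add: floor_less_iff)
    then show "k \<le> int N" by (simp add: k_def)
  qed
  \<comment> \<open>Exactly those coordinates are shifted in which the unshifted grid separates x
    from y.\<close>
  define \<tau> where "\<tau> = (\<lambda>i. \<lfloor>x $ i / 2 powr k\<rfloor> \<noteq> \<lfloor>y $ i / 2 powr k\<rfloor>)"
  define t where "t = grid_shift N \<tau>"
  define z where "z = (\<lambda>i. \<lfloor>(x $ i - t $ i) / 2 powr k\<rfloor>)"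
  have same: "\<lfloor>(y $ i - t $ i) / 2 powr k\<rfloor> = z i" for i
  proof -
    have "\<bar>x $ i - y $ i\<bar> \<le> s" using component_le_norm_cart[of "x - y" i] by (simp add: s_def)
    then have "\<bar>x $ i - y $ i\<bar> < 2 powr k / 3" using k_gt by simp
    then show ?thesis
      using one_third_trick[OF kN(2), of "x $ i" "y $ i"] by (auto simp: z_def t_def grid_shift_def \<tau>_def)
  qed
  \<comment> \<open>From |x_i - t_i| \<le> 2 * 2^N and 2^k \<ge> 2^(-N) the index is at most 2 * 4^N
    + 1 in absolute value; this is the origin of 4^(N+1) in \<open>grid\<close>.\<close>
  have bound: "z i \<in> {- (4 ^ (N + 1))..4 ^ (N + 1)}" for i
  proof -
    have "\<bar>t $ i\<bar> \<le> 2 powr N" by (simp add: t_def grid_shift_def)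
    then have "\<bar>x $ i - t $ i\<bar> \<le> 2 * 2 powr N" using x[of i] by linarith
    then have "\<bar>(x $ i - t $ i) / 2 powr k\<bar> \<le> 2 * 2 powr N / 2 powr k" by (simp add: divide_right_mono)
    also have "\<dots> \<le> 2 * 2 powr N / 2 powr (- real N)"
      using kN(1) by (intro divide_left_mono) auto
    also have "\<dots> = 2 * 4 ^ N"
    proof -
      have "2 powr N / 2 powr (- real N) = (2::real) powr (real (N * 2))" by (simp add: mult.commute flip: powr_diff)
      also have "\<dots> = (2 ^ 2) ^ N" by (simp only: powr_realpow power_mult[symmetric] mult.commute)
      finally show ?thesis by simp
    qed
    finally have "\<bar>(x $ i - t $ i) / 2 powr k\<bar> \<le> 2 * 4 ^ N" .
    then have "\<bar>real_of_int (z i)\<bar> \<le> 2 * 4 ^ N + 1" unfolding z_def by linarith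
    also have "\<dots> \<le> 4 ^ (N + 1)" 
    proof -
      have "(1::real) \<le> 4 ^ N" by (rule one_le_power) simp
      then show ?thesis by (simp only: Suc_eq_plus1[symmetric] power_Suc)
    qed
    finally have "real_of_int \<bar>z i\<bar> \<le> real_of_int (4 ^ (N + 1))" by simp
    then have "\<bar>z i\<bar> \<le> 4 ^ (N + 1)" by (simp only: of_int_le_iff)
    then show ?thesis by (auto simp: abs_le_iff)
  qed
  define Q where "Q = gcube t k z"
  have Q: "Q \<in> grid N \<tau>" unfolding grid_def Q_def t_def[symmetric] using kN bound by (intro image_eqI[of _ _ "(k, z)"]) auto
  have xQ: "x \<in> Q" "y \<in> Q" using same by (auto simp: Q_def gcube_def z_def)
  have "1 / s powr e \<le> 6 powr e * 2 powr (- (e * k))"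
  proof -
    have "(2 powr k) powr e \<le> (6 * s) powr e" using k_le e by (intro powr_mono2) auto
    then have "2 powr (e * k) \<le> 6 powr e * s powr e" using s by (simp add: powr_powr powr_mult mult.commute)
    then show ?thesis using s by (simp add: powr_minus_divide field_simps)
  qed
  also have "2 powr (- (e * k)) = 2 powr (- (e * cube_level Q)) * (indicator Q x * indicator Q y)"
    using xQ by (simp add: Q_def)
  also have "\<dots> \<le> (\<Sum>Q\<in>grid N \<tau>. 2 powr (- (e * cube_level Q)) * (indicator Q x * indicator Q y))"
    using Q by (intro member_le_sum[where f="\<lambda>Q. 2 powr (- (e * cube_level Q)) * (indicator Q x * indicator Q y)"]) (auto simp: finite_grid)
  also have "\<dots> \<le> (\<Sum>\<tau>\<in>UNIV. \<Sum>Q\<in>grid N \<tau>. 2 powr (- (e * cube_level Q)) * (indicator Q x * indicator Q y))"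
    by (intro member_le_sum[where f="\<lambda>\<tau>. \<Sum>Q\<in>grid N \<tau>. 2 powr (- (e * cube_level Q)) * (indicator Q x * indicator Q y)"]) (auto intro!: sum_nonneg)
  finally show ?thesis by (simp add: s_def)
qed

section \<open>Weights\<close>

abbreviation wmeasure :: "(real ^ 'n \<Rightarrow> real) \<Rightarrow> (real ^ 'n) measure" where
  "wmeasure w \<equiv> density lebesgue (\<lambda>x. ennreal (w x))"

lemma weight_measurable:
  fixes w :: "real ^ 'n \<Rightarrow> real"
  assumes "weight w"
  shows "w \<in> borel_measurable lebesgue"
proof (rule borel_measurable_LIMSEQ_real)
  fix m :: nat
  have "w absolutely_integrable_on (cball 0 (real m))" using assms by (simp add: weight_def)
  then show "(\<lambda>x. indicator (cball 0 (real m)) x * w x) \<in> borel_measurable lebesgue"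
    unfolding set_integrable_def by (auto dest: borel_measurable_integrable)
next
  fix x :: "real ^ 'n"
  have "\<forall>\<^sub>F m in sequentially. norm x \<le> real m"
    using filterlim_real_sequentially unfolding filterlim_at_top by blast
  then have "\<forall>\<^sub>F m in sequentially. indicator (cball 0 (real m)) x * w x = w x"
    by eventually_elim simp
  then show "(\<lambda>m. indicator (cball 0 (real m)) x * w x) \<longlonglongrightarrow> w x"
    by (rule tendsto_eventually)
qed

lemma emeasure_wmeasure:
  "weight w \<Longrightarrow> S \<in> sets lebesgue \<Longrightarrow> emeasure (wmeasure w) S = (\<integral>\<^sup>+ x\<in>S. ennreal (w x) \<partial>lebesgue)"
  using weight_measurable[of w] by (intro emeasure_density) auto

lemma weight_cube_finite:
  assumes "weight w" "Q \<in> cubes"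
  shows "emeasure (wmeasure w) Q < \<infinity>"
proof -
  have Q: "compact Q" "Q \<in> sets lebesgue" using assms(2) by (auto simp: cubes_def)
  then have "set_integrable lebesgue Q w" using assms(1) by (simp add: weight_def)
  then have "(\<integral>\<^sup>+ x. ennreal (norm (indicator Q x *\<^sub>R w x)) \<partial>lebesgue) < \<infinity>"
    unfolding set_integrable_def integrable_iff_bounded by simp
  also have "(\<integral>\<^sup>+ x. ennreal (norm (indicator Q x *\<^sub>R w x)) \<partial>lebesgue) = (\<integral>\<^sup>+ x\<in>Q. ennreal (w x) \<partial>lebesgue)"
    using assms(1) by (intro nn_integral_cong) (auto simp: indicator_def weight_def)
  finally show ?thesis using emeasure_wmeasure[OF assms(1) Q(2)] by simp
qed

lemma weight_gcube:
  fixes w :: "real ^ 'n \<Rightarrow> real"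
  assumes w: "weight w"
  shows "gcube t k z \<in> fmeasurable (wmeasure w)"
proof -
  obtain Q where Q: "Q \<in> cubes" "gcube t k z \<subseteq> Q" "gcube t k z \<in> sets lebesgue"
    using gcube_closure[of t k z] by metis
  have "Q \<in> sets lebesgue" using Q(1) by (auto simp: cubes_def)
  then have "emeasure (wmeasure w) (gcube t k z) \<le> emeasure (wmeasure w) Q"
    using Q by (intro emeasure_mono) auto
  then show ?thesis using weight_cube_finite[OF w Q(1)] Q(3) by (intro fmeasurableI) auto
qed

text \<open>The characteristics are defined with closed cubes, the grids consist of half-open ones.\<close>
lemma gcube_closure_weights:
  fixes u \<sigma> :: "real ^ 'n \<Rightarrow> real"
  assumes "weight u" "weight \<sigma>"
  shows "\<exists>Q\<in>cubes. gcube t k z \<subseteq> Q \<and> emeasure lebesgue Q = ennreal (2 powr (real CARD('n) * k))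
         \<and> emeasure (wmeasure u) Q = ennreal (measure (wmeasure u) (gcube t k z))
         \<and> emeasure (wmeasure \<sigma>) Q = ennreal (measure (wmeasure \<sigma>) (gcube t k z))"
proof -
  obtain Q where Q: "Q \<in> cubes" "gcube t k z \<subseteq> Q" "Q - gcube t k z \<in> null_sets lebesgue" "gcube t k z \<in> sets lebesgue"
    "emeasure lebesgue Q = ennreal (2 powr (real CARD('n) * k))"
    using gcube_closure[of t k z] by metis
  have Qm: "Q \<in> sets lebesgue" using Q(1) by (auto simp: cubes_def)
  have "emeasure (wmeasure w) Q = ennreal (measure (wmeasure w) (gcube t k z))" if w: "weight w" for w
  proof -
    have "Q - gcube t k z \<in> null_sets (wmeasure w)"
      using Q(3) weight_measurable[OF w] absolutely_continuousI_density[of "\<lambda>x. ennreal (w x)" lebesgue]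
      by (auto simp: absolutely_continuous_def)
    then have "emeasure (wmeasure w) (Q - (Q - gcube t k z)) = emeasure (wmeasure w) Q"
      using Qm by (intro emeasure_Diff_null_set) auto
    then show ?thesis
      using Q(2) emeasure_eq_measure2[OF weight_gcube[OF w, of t k z]] by (simp add: double_diff)
  qed
  then show ?thesis using Q assms by blast
qed

text \<open>The q-th root of the two-weight condition. The powers of |Q| collect to |Q|^(1/q + 1/p')
  = 2^(e k), and in the application e = n - \<alpha> is the exponent of the kernel: the index s(p)
  is tuned to this match.\<close>

lemma Ar_gcube:
  fixes u \<sigma> :: "real ^ 'n \<Rightarrow> real" and p' q e :: real
  assumes w: "weight u" "weight \<sigma>" and fin: "Ar_const (1 + q / p') u \<sigma> < \<infinity>"
    and pq: "p' > 0" "q > 0" and e: "real CARD('n) * (1 / q + 1 / p') = e"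
  shows "measure (wmeasure \<sigma>) (gcube t k z) powr (1 / p') * measure (wmeasure u) (gcube t k z) powr (1 / q)
    \<le> enn2real (Ar_const (1 + q / p') u \<sigma>) powr (1 / q) * 2 powr (e * k)"
proof -
  obtain Q where Q: "Q \<in> cubes" "emeasure lebesgue Q = ennreal (2 powr (real CARD('n) * k))"
    "emeasure (wmeasure u) Q = ennreal (measure (wmeasure u) (gcube t k z))"
    "emeasure (wmeasure \<sigma>) Q = ennreal (measure (wmeasure \<sigma>) (gcube t k z))"
    using gcube_closure_weights[OF w] by metis
  define v a b where "v = 2 powr (real CARD('n) * k)"
    and "a = measure (wmeasure u) (gcube t k z)" and "b = measure (wmeasure \<sigma>) (gcube t k z)"
  have v: "v > 0" "a \<ge> 0" "b \<ge> 0" by (auto simp: v_def a_def b_def)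
  have Qm: "Q \<in> sets lebesgue" using Q(1) by (auto simp: cubes_def)
  have avu: "avg Q (\<lambda>x. ennreal (u x)) = ennreal (a / v)"
    using Q emeasure_wmeasure[OF w(1) Qm] v by (simp add: avg_def a_def v_def divide_ennreal)
  have avs: "avg Q (\<lambda>x. ennreal (\<sigma> x)) = ennreal (b / v)"
    using Q emeasure_wmeasure[OF w(2) Qm] v by (simp add: avg_def b_def v_def divide_ennreal)
  have "avg Q (\<lambda>x. ennreal (u x)) * ennpowr (avg Q (\<lambda>x. ennreal (\<sigma> x))) (1 + q / p' - 1) \<le> Ar_const (1 + q / p') u \<sigma>"
    unfolding Ar_const_def by (intro SUP_upper Q(1))
  then have "ennreal (a / v * (b / v) powr (q / p')) \<le> Ar_const (1 + q / p') u \<sigma>"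
    using v unfolding avu avs by (simp add: ennpowr_def flip: ennreal_mult)
  also have "\<dots> = ennreal (enn2real (Ar_const (1 + q / p') u \<sigma>))" using fin by simp
  finally have "a / v * (b / v) powr (q / p') \<le> enn2real (Ar_const (1 + q / p') u \<sigma>)"
    by (subst (asm) ennreal_le_iff) auto
  then have "(a / v * (b / v) powr (q / p')) powr (1 / q) \<le> enn2real (Ar_const (1 + q / p') u \<sigma>) powr (1 / q)"
    using v pq by (intro powr_mono2) auto
  also have "(a / v * (b / v) powr (q / p')) powr (1 / q) = b powr (1 / p') * a powr (1 / q) / v powr (1 / q + 1 / p')"
    using v pq by (simp add: powr_mult powr_divide powr_powr powr_add)
  also have "v powr (1 / q + 1 / p') = 2 powr (e * k)"
    unfolding v_def powr_powr e[symmetric] by (simp add: mult_ac)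
  finally show ?thesis by (simp add: a_def b_def field_simps)
qed

text \<open>On a cube H inside P the maximal function of u restricted to P' is at least u(H)/|H|, so
  its integral dominates the Carleson sum up to the 4 of \<open>stops_carleson\<close>, while the
  characteristic bounds that integral by u(P). F only selects the family, so one and the same family
  works for every weight.\<close>

lemma stops_carleson_weight:
  fixes u :: "real ^ 'n \<Rightarrow> real" and F :: "(real ^ 'n) measure"
  assumes w: "weight u" and K: "Ainf'_const u < \<infinity>"
    and D: "finite D" "\<And>Q. Q \<in> D \<Longrightarrow> \<exists>k z. Q = gcube t k z"
    and F: "D \<subseteq> fmeasurable F" "\<And>Q. Q \<in> D \<Longrightarrow> measure F Q > 0"
    and N: "\<And>Q. Q \<in> D \<Longrightarrow> measure (wmeasure u) Q > 0"
    and P: "P \<in> D"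
  shows "(\<Sum>H\<in>{H \<in> stops D (level D (\<lambda>Q. measure F Q / measure lebesgue Q)). H \<subseteq> P}. measure (wmeasure u) H)
    \<le> 4 * enn2real (Ainf'_const u) * measure (wmeasure u) P"
proof -
  obtain k z where Pk: "P = gcube t k z" using D(2)[OF P] by blast
  obtain P' where P': "P' \<in> cubes" "P \<subseteq> P'" "emeasure (wmeasure u) P' = ennreal (measure (wmeasure u) P)"
    using gcube_closure_weights[OF w w, of t k z] unfolding Pk by blast
  have P'm: "P' \<in> sets lebesgue" using P'(1) by (auto simp: cubes_def)
  define g where "g = maximal (\<lambda>y. indicator P' y * u y)"
  have lam: "laminar D" by (rule laminar_gcubes(1)[OF D])
  have u0: "u x \<ge> 0" for x using w by (simp add: weight_def)
  have g_ge: "ennreal (measure (wmeasure u) H / measure lebesgue H) \<le> g x"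
    if H: "H \<in> D" "H \<subseteq> P" "x \<in> H" for H x
  proof -
    obtain l v where Hl: "H = gcube t l v" using D(2)[OF H(1)] by blast
    obtain H' where H': "H' \<in> cubes" "H \<subseteq> H'" "emeasure lebesgue H' = ennreal (2 powr (real CARD('n) * l))"
      using gcube_closure_weights[OF w w, of t l v] unfolding Hl by blast
    have Hm: "H \<in> sets lebesgue" using gcube_fmeasurable[of t l v] unfolding Hl by blast
    have "ennreal (measure (wmeasure u) H) = emeasure (wmeasure u) H"
      using emeasure_eq_measure2[OF weight_gcube[OF w, of t l v]] by (simp add: Hl)
    also have "\<dots> = (\<integral>\<^sup>+ x\<in>H. ennreal (u x) \<partial>lebesgue)" by (rule emeasure_wmeasure[OF w Hm])
    also have "\<dots> \<le> (\<integral>\<^sup>+ x\<in>H'. ennreal \<bar>indicator P' x * u x\<bar> \<partial>lebesgue)"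
      using H H' P'(2) u0 by (intro nn_integral_mono) (auto simp: indicator_def)
    finally have "ennreal (measure (wmeasure u) H) / emeasure lebesgue H' \<le> avg H' (\<lambda>x. ennreal \<bar>indicator P' x * u x\<bar>)"
      unfolding avg_def by (rule divide_right_mono_ennreal)
    also have "\<dots> \<le> g x"
      unfolding g_def maximal_def using H H' by (intro SUP_upper) auto
    finally show ?thesis
      unfolding H'(3) by (simp add: divide_ennreal Hl measure_gcube)
  qed
  have "ennreal (\<Sum>H\<in>{H \<in> stops D (level D (\<lambda>Q. measure F Q / measure lebesgue Q)). H \<subseteq> P}. measure (wmeasure u) H / 4)
      \<le> (\<integral>\<^sup>+x. g x * indicator P x \<partial>lebesgue)"
  proof (rule stops_carleson[OF lam _ F(1) _ F(2) P g_ge])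
    show "D \<subseteq> fmeasurable lebesgue" using D(2) gcube_fmeasurable by blast
    show "measure lebesgue Q > 0" if "Q \<in> D" for Q using D(2)[OF that] by (auto simp: measure_gcube)
  qed
  also have "\<dots> \<le> (\<integral>\<^sup>+x\<in>P'. g x \<partial>lebesgue)"
    using P'(2) by (intro nn_integral_mono) (auto simp: indicator_def)
  also have "\<dots> \<le> Ainf'_const u * wmass u P'"
  proof -
    have wm: "wmass u P' = ennreal (measure (wmeasure u) P)"
      using emeasure_wmeasure[OF w P'm] P'(3) by (simp add: wmass_def)
    have "(\<integral>\<^sup>+x\<in>P'. g x \<partial>lebesgue) / wmass u P' \<le> Ainf'_const u"
      unfolding Ainf'_const_def g_def by (intro SUP_upper P'(1))
    then have "(\<integral>\<^sup>+x\<in>P'. g x \<partial>lebesgue) / wmass u P' * wmass u P' \<le> Ainf'_const u * wmass u P'"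
      by (rule mult_right_mono) simp
    then show ?thesis using N[OF P] unfolding wm by (simp add: ennreal_divide_times mult_divide_eq_ennreal)
  qed
  also have "\<dots> = ennreal (enn2real (Ainf'_const u) * measure (wmeasure u) P)"
    using K emeasure_wmeasure[OF w P'm] P'(3)
    by (simp add: wmass_def ennreal_mult)
  finally have "(\<Sum>H\<in>{H \<in> stops D (level D (\<lambda>Q. measure F Q / measure lebesgue Q)). H \<subseteq> P}. measure (wmeasure u) H / 4)
      \<le> enn2real (Ainf'_const u) * measure (wmeasure u) P"
    by (subst (asm) ennreal_le_iff) auto
  then show ?thesis by (simp add: sum_divide_distrib[symmetric])
qed

section \<open>The form on one grid\<close>

text \<open>One constant for both bounds: the last bracket adds what the strong and the weak
  estimate require. The 64 is the 16 of the kernel forms times 4 for pulling the Carleson factor 4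
  out of a root; the leading quotient is the price of sparseness.\<close>

definition form_const :: "real \<Rightarrow> real \<Rightarrow> real \<Rightarrow> real \<Rightarrow> real \<Rightarrow> real \<Rightarrow> real" where
  "form_const n \<alpha> p p' q r = 2 / (1 - 2 powr (- \<alpha>)) * (64 * kernel_const (n - \<alpha>) (1/p' + 1/q) * stop_const p powr (1/p)
     * (1 / (1 - 2 powr (- (1 - 1/r))) + stop_const r powr (1/r)))"

lemma form_const_factors:
  fixes n \<alpha> p p' q r :: real
  assumes \<alpha>: "0 < \<alpha>" "\<alpha> < n" and pq: "1 < p" "p < q" "1/p + 1/p' = 1" "1/q + 1/r = 1"
  shows "0 \<le> 1 / (1 - 2 powr (- (1 - 1/r)))" "0 < stop_const p powr (1/p)" "0 < stop_const r powr (1/r)"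
    "0 < kernel_const (n - \<alpha>) (1/p' + 1/q)" "form_const n \<alpha> p p' q r > 0"
proof -
  note exps = off_diagonal_exponents[OF pq]
  show *: "0 \<le> 1 / (1 - 2 powr (- (1 - 1/r)))" using exps powr_mono[of "- (1 - 1/r)" 0 "2::real"] by simp
  show **: "0 < stop_const p powr (1/p)" "0 < stop_const r powr (1/r)"
    using stop_const_pos[OF pq(1)] stop_const_pos[OF exps(3)] by auto
  show ***: "0 < kernel_const (n - \<alpha>) (1/p' + 1/q)" using \<alpha> exps by (intro kernel_const_pos) auto
  show "form_const n \<alpha> p p' q r > 0"
    unfolding form_const_def using * ** *** \<alpha> by (intro mult_pos_pos divide_pos_pos add_nonneg_pos) (auto simp: powr_less_one)
qed

context
  fixes u \<sigma> f g :: "real ^ 'n \<Rightarrow> real" and t :: "real ^ 'n" and D :: "(real ^ 'n) set set"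
    and n \<alpha> p p' q r X Y a ku :: real and M N F G :: "(real ^ 'n) measure"
  defines "n \<equiv> real CARD('n)" and "M \<equiv> wmeasure \<sigma>" and "N \<equiv> wmeasure u"
    and "F \<equiv> density (wmeasure \<sigma>) (\<lambda>x. ennreal (f x))" and "G \<equiv> density (wmeasure u) (\<lambda>x. ennreal (g x))"
    and "a \<equiv> enn2real (Ar_const (1 + q / p') u \<sigma>)" and "ku \<equiv> enn2real (Ainf'_const u)"
  assumes w: "weight u" "weight \<sigma>" and Afin: "Ar_const (1 + q / p') u \<sigma> < \<infinity>"
    and Ku: "Ar_const (1 + q / p') u \<sigma> > 0 \<Longrightarrow> Ainf'_const u < \<infinity>"
    and \<alpha>: "0 < \<alpha>" "\<alpha> < n" and pq: "1 < p" "p < q" "1/p + 1/p' = 1" "1/q + 1/r = 1" "1/p - 1/q = \<alpha> / n"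
    and D: "finite D" "\<And>Q. Q \<in> D \<Longrightarrow> \<exists>k z. Q = gcube t k z"
    and f: "f \<in> borel_measurable lebesgue" "\<And>x. f x \<ge> 0" and g: "g \<in> borel_measurable lebesgue" "\<And>x. g x \<ge> 0"
    and DF: "D \<subseteq> fmeasurable F" and DG: "D \<subseteq> fmeasurable G"
    and X: "(\<integral>\<^sup>+x. ennreal (f x powr p) \<partial>M) \<le> ennreal X" "X \<ge> 0"
    and Y: "(\<integral>\<^sup>+x. ennreal (g x powr r) \<partial>N) \<le> ennreal Y" "Y \<ge> 0"
begin

text \<open>Cubes not charged by both F and G contribute nothing to the form. Without them all
  masses, hence all averages, are positive, as the logarithmic levels require.\<close>

private definition "D' = {Q \<in> D. measure F Q > 0 \<and> measure G Q > 0}"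
private definition "S = stops D' (level D' (\<lambda>Q. measure F Q / measure lebesgue Q))"

private lemma D': "finite D'" "Q \<in> D' \<Longrightarrow> \<exists>k z. Q = gcube t k z" "Q \<in> D' \<Longrightarrow> Q \<in> D"
  using D by (auto simp: D'_def)

private lemma S: "Q \<in> S \<Longrightarrow> Q \<in> D'" "finite S" "Q \<in> S \<Longrightarrow> \<exists>k z. Q = gcube t k z"
proof -
  have sub: "S \<subseteq> D'" unfolding S_def by (rule stops_subset)
  then show "Q \<in> S \<Longrightarrow> Q \<in> D'" "finite S" using finite_subset D'(1) by blast+
  then show "Q \<in> S \<Longrightarrow> \<exists>k z. Q = gcube t k z" using D'(2) by blast
qed

private lemma form_fmeas: "D' \<subseteq> fmeasurable M" "D' \<subseteq> fmeasurable N" "D' \<subseteq> fmeasurable F" "D' \<subseteq> fmeasurable G"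
proof -
  show "D' \<subseteq> fmeasurable M" "D' \<subseteq> fmeasurable N"
    by (auto simp: M_def N_def intro!: weight_gcube[OF w(1)] weight_gcube[OF w(2)] dest!: D'(2))
  have sub: "D' \<subseteq> D" using D'(3) by (rule subsetI)
  show "D' \<subseteq> fmeasurable F" "D' \<subseteq> fmeasurable G"
    by (rule subset_trans[OF sub DF], rule subset_trans[OF sub DG])
qed

private lemma measure_density_pos:
  assumes "Q \<in> fmeasurable L" "Q \<in> fmeasurable (density L h)" "h \<in> borel_measurable L" "measure (density L h) Q > 0"
  shows "measure L Q > 0"
proof (rule ccontr)
  assume "\<not> measure L Q > 0"
  then have "measure L Q = 0" using measure_nonneg[of L Q] by linarith
  then have "Q \<in> null_sets L" using assms(1) emeasure_eq_measure2[OF assms(1)] by (auto simp: null_sets_def)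
  then have "Q \<in> null_sets (density L h)"
    using absolutely_continuousI_density[OF assms(3)] by (auto simp: absolutely_continuous_def)
  then show False using assms(4) by (auto simp: measure_def null_sets_def)
qed

private lemma pos: assumes "Q \<in> D'"
  shows "measure M Q > 0" "measure N Q > 0" "measure F Q > 0" "measure G Q > 0"
proof -
  show FG: "measure F Q > 0" "measure G Q > 0" using assms by (auto simp: D'_def)
  have "f \<in> borel_measurable M" "g \<in> borel_measurable N" using f(1) g(1) by (auto simp: M_def N_def)
  then show "measure M Q > 0" "measure N Q > 0"
    using assms form_fmeas FG unfolding F_def G_def M_def[symmetric] N_def[symmetric]
    by (auto intro!: measure_density_pos[of Q M "\<lambda>x. ennreal (f x)"] measure_density_pos[of Q N "\<lambda>x. ennreal (g x)"])
qed

private lemma to_sparse: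
  "(\<Sum>Q\<in>D. 2 powr (- ((n - \<alpha>) * cube_level Q)) * (measure F Q * measure G Q))
    \<le> 2 / (1 - 2 powr (- \<alpha>)) * (\<Sum>Q\<in>S. 2 powr (- ((n - \<alpha>) * cube_level Q)) * (measure F Q * measure G Q))"
proof -
  have "(\<Sum>Q\<in>D. 2 powr (- ((n - \<alpha>) * cube_level Q)) * (measure F Q * measure G Q))
      = (\<Sum>Q\<in>D'. 2 powr (- ((n - \<alpha>) * cube_level Q)) * (measure F Q * measure G Q))"
    using D(1) by (intro sum.mono_neutral_right) (auto simp: D'_def less_le)
  also have "\<dots> \<le> 2 / (1 - 2 powr (- \<alpha>)) * (\<Sum>Q\<in>S. 2 powr (- ((n - \<alpha>) * cube_level Q)) * (measure F Q * measure G Q))"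
    unfolding S_def
  proof (rule sparse_reduction[OF laminar_gcubes(1)[OF D'(1,2)] form_fmeas(4) laminar_gcubes(2,3)[OF D'(1,2)]])
    show "measure lebesgue Q = 2 powr (n * cube_level Q)" if "Q \<in> D'" for Q
      using D'(2)[OF that] by (auto simp: measure_gcube n_def)
  qed (use pos(3) \<alpha> in auto)
  finally show ?thesis .
qed

private lemma A_S: "Q \<in> S \<Longrightarrow> measure M Q powr (1/p') * measure N Q powr (1/q) \<le> a powr (1/q) * 2 powr ((n - \<alpha>) * cube_level Q)"
proof -
  assume "Q \<in> S"
  then obtain k z where Q: "Q = gcube t k z" using S(3) by blast
  have "q > 1" using pq by linarith
  moreover have "1/p < 1" using pq by simp
  then have "1/p' > 0" using pq by linarith
  then have "p' > 0" by (simp add: zero_less_divide_iff)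
  moreover have "1/q + 1/p' = 1 - \<alpha>/n" using pq by linarith
  then have "real CARD('n) * (1/q + 1/p') = n - \<alpha>" using \<alpha> by (simp add: n_def field_simps)
  ultimately show ?thesis
    using Ar_gcube[OF w Afin, of "n - \<alpha>" t k z] unfolding a_def M_def N_def Q by simp
qed

text \<open>A surviving cube has positive mass for both weights, so the two-weight constant cannot
  vanish. Conversely, if the constant is 0 then S is empty and the form is 0; this is what makes the
  conditional finiteness of the characteristics sufficient.\<close>

private lemma a_pos: "S \<noteq> {} \<Longrightarrow> a > 0"
proof -
  assume "S \<noteq> {}"
  then obtain Q where Q: "Q \<in> S" by auto
  have "0 < measure M Q powr (1/p') * measure N Q powr (1/q)" using pos(1,2)[OF S(1)[OF Q]] by (intro mult_pos_pos) auto
  with A_S[OF Q] have "a powr (1/q) \<noteq> 0" by auto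
  then show "a > 0" using enn2real_nonneg by (auto simp: a_def less_le)
qed

private lemma Ar_pos: "S \<noteq> {} \<Longrightarrow> Ar_const (1 + q / p') u \<sigma> > 0"
  using a_pos by (auto simp: a_def enn2real_positive_iff)

private lemma carl: "P \<in> S \<Longrightarrow> (\<Sum>H\<in>{H \<in> S. H \<subseteq> P}. measure N H) \<le> (4 * ku) * measure N P"
proof -
  assume P: "P \<in> S"
  then have "S \<noteq> {}" by auto
  from stops_carleson_weight[OF w(1) Ku[OF Ar_pos[OF this]] D'(1,2) form_fmeas(3) pos(3) pos(2)[unfolded N_def] S(1)[OF P]]
  show ?thesis unfolding S_def ku_def N_def .
qed

private lemmas form_exps = off_diagonal_exponents[OF pq(1-4)]

private lemma quarter: "0 \<le> k \<Longrightarrow> s > 1 \<Longrightarrow> (4 * k) powr (1/s) \<le> 4 * k powr (1/s)" for k s :: real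
  using powr_mono[of "1/s" 1 "4::real"] by (simp add: powr_mult mult_right_mono)

private lemma stage: "laminar S" "S \<subseteq> fmeasurable M" "S \<subseteq> fmeasurable N" "S \<subseteq> fmeasurable F" "S \<subseteq> fmeasurable G"
proof -
  show "laminar S" by (rule laminar_gcubes(1)[OF S(2,3)])
  have "S \<subseteq> D'" using S(1) by (rule subsetI)
  note sub = subset_trans[OF this]
  show "S \<subseteq> fmeasurable M" "S \<subseteq> fmeasurable N" "S \<subseteq> fmeasurable F" "S \<subseteq> fmeasurable G"
    by (rule sub form_fmeas)+
qed

private lemma dens: "f \<in> borel_measurable M" "g \<in> borel_measurable N"
  "F = density M (\<lambda>x. ennreal (f x))" "G = density N (\<lambda>x. ennreal (g x))"
  using f(1) g(1) by (auto simp: M_def N_def F_def G_def)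

private lemma final:
  assumes "(\<Sum>Q\<in>S. 2 powr (- ((n - \<alpha>) * cube_level Q)) * (measure F Q * measure G Q)) \<le> Z"
  shows "(\<Sum>Q\<in>D. 2 powr (- ((n - \<alpha>) * cube_level Q)) * (measure F Q * measure G Q)) \<le> 2 / (1 - 2 powr (- \<alpha>)) * Z"
proof (rule order_trans[OF to_sparse mult_left_mono[OF assms]])
  show "0 \<le> 2 / (1 - 2 powr (- \<alpha>))" using \<alpha> powr_mono[of "- \<alpha>" 0 "2::real"] by simp
qed

private lemmas const_parts = form_const_factors[OF \<alpha> pq(1-4)]

lemma form_strong:
  defines "k\<sigma> \<equiv> enn2real (Ainf'_const \<sigma>)"
  assumes K\<sigma>: "Ar_const (1 + q / p') u \<sigma> > 0 \<Longrightarrow> Ainf'_const \<sigma> < \<infinity>"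
  shows "(\<Sum>Q\<in>D. 2 powr (- ((n - \<alpha>) * cube_level Q)) * (measure F Q * measure G Q))
    \<le> form_const n \<alpha> p p' q r * (a powr (1/q) * (ku powr (1/p') + k\<sigma> powr (1/q)) * (X powr (1/p) * Y powr (1/r)))"
proof -
  define W where "W = 1 / (1 - 2 powr (- (1 - 1/r)))"
  define Z where "Z = a powr (1/q) * (ku powr (1/p') + k\<sigma> powr (1/q)) * (X powr (1/p) * Y powr (1/r))"
  have W: "W \<ge> 0" using const_parts(1) by (simp add: W_def)
  have Z: "Z \<ge> 0" by (simp add: Z_def)
  have k: "ku \<ge> 0" "k\<sigma> \<ge> 0" by (auto simp: ku_def k\<sigma>_def)
  have "(\<Sum>Q\<in>S. 2 powr (- ((n - \<alpha>) * cube_level Q)) * (measure F Q * measure G Q))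
      \<le> 64 * kernel_const (n - \<alpha>) (1/p' + 1/q) * stop_const p powr (1/p) * (W + stop_const r powr (1/r)) * Z"
  proof (cases "S = {}")
    case True
    then show ?thesis using const_parts W Z by simp
  next
    case False
    \<comment> \<open>The family S was selected by Lebesgue averages of F, without reference to u,
      so it is Carleson for \<sigma> by the same argument.\<close>
    have carl\<sigma>: "(\<Sum>H\<in>{H \<in> S. H \<subseteq> P}. measure M H) \<le> (4 * k\<sigma>) * measure M P" if "P \<in> S" for P
      using stops_carleson_weight[OF w(2) K\<sigma>[OF Ar_pos[OF False]] D'(1,2) form_fmeas(3) pos(3) pos(1)[unfolded M_def] S(1)[OF that]]
      by (simp add: S_def k\<sigma>_def M_def)
    have "(\<Sum>Q\<in>S. 2 powr (- ((n - \<alpha>) * cube_level Q)) * (measure F Q * measure G Q))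
      \<le> 16 * kernel_const (n - \<alpha>) (1/p' + 1/q) * stop_const p powr (1/p) * stop_const r powr (1/r)
        * a powr (1/q) * ((4 * ku) powr (1/p') + (4 * k\<sigma>) powr (1/q)) * (X powr (1/p) * Y powr (1/r))"
      using \<alpha> a_pos[OF False] k
      by (intro kernel_form_strong[OF dens(3,4) stage pos[OF S(1)] dens(1) f(2) dens(2) g(2)
            laminar_gcubes(2)[OF S(2,3)] _ _ A_S pq(1-4) X Y carl _ carl\<sigma>]) auto
    also have "\<dots> \<le> 16 * kernel_const (n - \<alpha>) (1/p' + 1/q) * stop_const p powr (1/p) * (W + stop_const r powr (1/r))
        * a powr (1/q) * (4 * ku powr (1/p') + 4 * k\<sigma> powr (1/q)) * (X powr (1/p) * Y powr (1/r))"
      using const_parts W quarter[OF k(1) form_exps(2)] quarter[OF k(2) form_exps(1)]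
      by (intro mult_right_mono mult_mono add_mono) auto
    also have "\<dots> = 64 * kernel_const (n - \<alpha>) (1/p' + 1/q) * stop_const p powr (1/p) * (W + stop_const r powr (1/r)) * Z"
      by (simp add: Z_def mult_ac flip: distrib_left_numeral) 
    finally show ?thesis .
  qed
  from final[OF this] show ?thesis by (simp add: form_const_def W_def Z_def mult_ac)
qed

lemma form_weak:
  assumes g1: "\<And>x. g x \<le> 1" and GY: "\<And>C. finite C \<Longrightarrow> C \<subseteq> fmeasurable G \<Longrightarrow> pairwise disjnt C \<Longrightarrow> (\<Sum>H\<in>C. measure G H) \<le> Y"
  shows "(\<Sum>Q\<in>D. 2 powr (- ((n - \<alpha>) * cube_level Q)) * (measure F Q * measure G Q))
    \<le> form_const n \<alpha> p p' q r * (a powr (1/q) * ku powr (1/p') * (X powr (1/p) * Y powr (1/r)))"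
proof -
  define W where "W = 1 / (1 - 2 powr (- (1 - 1/r)))"
  define Z where "Z = a powr (1/q) * ku powr (1/p') * (X powr (1/p) * Y powr (1/r))"
  have W: "W \<ge> 0" using const_parts(1) by (simp add: W_def)
  have Z: "Z \<ge> 0" by (simp add: Z_def)
  have k: "ku \<ge> 0" by (auto simp: ku_def)
  have "(\<Sum>Q\<in>S. 2 powr (- ((n - \<alpha>) * cube_level Q)) * (measure F Q * measure G Q))
      \<le> 64 * kernel_const (n - \<alpha>) (1/p' + 1/q) * stop_const p powr (1/p) * (W + stop_const r powr (1/r)) * Z"
  proof (cases "S = {}")
    case True
    then show ?thesis using const_parts W Z by simp
  next
    case False
    then obtain P where P: "P \<in> S" by auto
    \<comment> \<open>The Carleson sum at P contains P itself, which yields the lower bound on the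
      constant that \<open>kernel_form_weak\<close> asks for.\<close>
    have "measure N P \<le> (\<Sum>H\<in>{H \<in> S. H \<subseteq> P}. measure N H)"
      using P S(2) by (intro member_le_sum) auto
    also have "\<dots> \<le> (4 * ku) * measure N P" by (rule carl[OF P])
    finally have k1: "4 * ku \<ge> 1" using pos(2)[OF S(1)[OF P]] by simp
    have "(\<Sum>H\<in>C. measure G H) \<le> Y" if "C \<subseteq> S" "pairwise disjnt C" for C
      using that stage(5) by (intro GY finite_subset[OF that(1) S(2)]) auto
    then have "(\<Sum>Q\<in>S. 2 powr (- ((n - \<alpha>) * cube_level Q)) * (measure F Q * measure G Q))
      \<le> 16 * kernel_const (n - \<alpha>) (1/p' + 1/q) * stop_const p powr (1/p) * (1 / (1 - 2 powr (- (1 - 1/r))) + stop_const r powr (1/r))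
        * a powr (1/q) * (4 * ku) powr (1/p') * (X powr (1/p) * Y powr (1/r))"
      using \<alpha> a_pos[OF False] k k1
      by (intro kernel_form_weak[OF dens(3,4) stage pos[OF S(1)] dens(1) f(2) dens(2) g(2)
            laminar_gcubes(2)[OF S(2,3)] _ _ A_S pq(1-4) X Y carl _ g1]) auto
    also have "\<dots> \<le> 16 * kernel_const (n - \<alpha>) (1/p' + 1/q) * stop_const p powr (1/p) * (W + stop_const r powr (1/r))
        * a powr (1/q) * (4 * ku powr (1/p')) * (X powr (1/p) * Y powr (1/r))"
      unfolding W_def[symmetric] using const_parts W quarter[OF k form_exps(2)]
      by (intro mult_right_mono mult_left_mono) auto
    also have "\<dots> = 64 * kernel_const (n - \<alpha>) (1/p' + 1/q) * stop_const p powr (1/p) * (W + stop_const r powr (1/r)) * Z"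
      by (simp add: Z_def mult_ac)
    finally show ?thesis .
  qed
  from final[OF this] show ?thesis by (simp add: form_const_def W_def Z_def mult_ac)
qed

end

section \<open>Norm bounds for the potential of one grid\<close>

definition grid_potential :: "real \<Rightarrow> (real ^ 'n) measure \<Rightarrow> (real ^ 'n) set set \<Rightarrow> real ^ 'n \<Rightarrow> real" where
  "grid_potential e F D x = (\<Sum>Q\<in>D. 2 powr (- (e * cube_level Q)) * measure F Q * indicator Q x)"

lemma grid_potential_nonneg: "grid_potential e F D x \<ge> 0"
  unfolding grid_potential_def by (intro sum_nonneg) auto

lemma grid_potential_measurable:
  "finite D \<Longrightarrow> D \<subseteq> sets lebesgue \<Longrightarrow> grid_potential e F D \<in> borel_measurable lebesgue"
  unfolding grid_potential_def[abs_def] by (intro borel_measurable_sum borel_measurable_times borel_measurable_const borel_measurable_indicator) auto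

context
  fixes u \<sigma> f :: "real ^ 'n \<Rightarrow> real" and t :: "real ^ 'n" and D :: "(real ^ 'n) set set"
    and n \<alpha> p p' q r X a ku c :: real and M N F :: "(real ^ 'n) measure" and h :: "real ^ 'n \<Rightarrow> real"
  defines "n \<equiv> real CARD('n)" and "M \<equiv> wmeasure \<sigma>" and "N \<equiv> wmeasure u"
    and "F \<equiv> density (wmeasure \<sigma>) (\<lambda>x. ennreal (f x))"
    and "a \<equiv> enn2real (Ar_const (1 + q / p') u \<sigma>)" and "ku \<equiv> enn2real (Ainf'_const u)"
    and "h \<equiv> grid_potential (real CARD('n) - \<alpha>) (density (wmeasure \<sigma>) (\<lambda>x. ennreal (f x))) D"
    and "c \<equiv> form_const (real CARD('n)) \<alpha> p p' q r"
  assumes w: "weight u" "weight \<sigma>" and Afin: "Ar_const (1 + q / p') u \<sigma> < \<infinity>"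
    and Ku: "Ar_const (1 + q / p') u \<sigma> > 0 \<Longrightarrow> Ainf'_const u < \<infinity>"
    and \<alpha>: "0 < \<alpha>" "\<alpha> < n" and pq: "1 < p" "p < q" "1/p + 1/p' = 1" "1/q + 1/r = 1" "1/p - 1/q = \<alpha> / n"
    and D: "finite D" "\<And>Q. Q \<in> D \<Longrightarrow> \<exists>k z. Q = gcube t k z"
    and f: "f \<in> borel_measurable lebesgue" "\<And>x. f x \<ge> 0"
    and X: "(\<integral>\<^sup>+x. ennreal (f x powr p) \<partial>M) \<le> ennreal X" "X \<ge> 0"
begin

private lemma DN: "D \<subseteq> fmeasurable N" "D \<subseteq> fmeasurable M" "D \<subseteq> sets lebesgue"
  using gcube_fmeasurable by (auto simp: M_def N_def intro!: weight_gcube[OF w(1)] weight_gcube[OF w(2)] dest!: D(2))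

text \<open>Since f \<le> 1 + f^p, a function in L^p(\<sigma>) is \<sigma>-integrable over every
  cube.\<close>

lemma potential_density_fmeasurable: "D \<subseteq> fmeasurable F"
proof
  fix Q assume Q: "Q \<in> D"
  then have Qs: "Q \<in> sets lebesgue" using DN(3) by auto
  have fM: "f \<in> borel_measurable M" using f(1) by (simp add: M_def)
  have "emeasure F Q = (\<integral>\<^sup>+x. ennreal (f x) * indicator Q x \<partial>M)"
    unfolding F_def M_def using f(1) Qs by (subst emeasure_density) auto
  also have "\<dots> \<le> (\<integral>\<^sup>+x. indicator Q x + ennreal (f x powr p) \<partial>M)"
  proof (intro nn_integral_mono)
    fix x
    have "f x \<le> 1 + f x powr p"
      using powr_mono[of 1 p "f x"] pq(1) f(2)[of x] by (cases "f x \<le> 1") (auto intro: order_trans)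
    then have "ennreal (f x) \<le> 1 + ennreal (f x powr p)"
      by (metis ennreal_1 ennreal_leI ennreal_plus powr_ge_zero zero_le_one)
    then show "ennreal (f x) * indicator Q x \<le> indicator Q x + ennreal (f x powr p)"
      by (auto simp: indicator_def)
  qed
  also have "\<dots> = emeasure M Q + (\<integral>\<^sup>+x. ennreal (f x powr p) \<partial>M)"
    using fM Qs by (subst nn_integral_add) (auto simp: M_def)
  also have "\<dots> < \<infinity>"
    using fmeasurableD2[OF subsetD[OF DN(2) Q]] X(1) by (auto simp: less_top[symmetric] top_unique)
  finally show "Q \<in> fmeasurable F" using Qs by (intro fmeasurableI) (auto simp: F_def)
qed

text \<open>A finite sum of indicators is bounded and vanishes outside a set of finite u-mass. Its
  norm is therefore finite before it is estimated, which the duality argument needs in order to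
  divide by it.\<close>

private definition "hmax = (\<Sum>Q\<in>D. 2 powr (- ((n - \<alpha>) * cube_level Q)) * measure F Q)"

private lemma potential_props: "h x \<ge> 0" "h x \<le> hmax" "h x \<noteq> 0 \<Longrightarrow> x \<in> \<Union>D" "h \<in> borel_measurable lebesgue" "h \<in> borel_measurable N"
proof -
  show "h x \<ge> 0" unfolding h_def by (rule grid_potential_nonneg)
  show "h x \<le> hmax" unfolding h_def hmax_def grid_potential_def F_def n_def
    by (intro sum_mono) (auto simp: indicator_def)
  show "h x \<noteq> 0 \<Longrightarrow> x \<in> \<Union>D"
    unfolding h_def grid_potential_def by (rule ccontr) (auto simp: indicator_def)
  show "h \<in> borel_measurable lebesgue" unfolding h_def using D(1) DN(3) by (rule grid_potential_measurable)
  then show "h \<in> borel_measurable N" by (simp add: N_def)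
qed

private lemma UD: "\<Union>D \<in> fmeasurable N"
  using D(1) DN(1) by (intro fmeasurable.finite_Union) auto

private lemma pairing:
  assumes g: "g \<in> borel_measurable lebesgue" "\<And>x. g x \<ge> 0" and DG: "D \<subseteq> fmeasurable (density N (\<lambda>x. ennreal (g x)))"
  shows "(\<integral>\<^sup>+x. ennreal (h x * g x) \<partial>N)
    = ennreal (\<Sum>Q\<in>D. 2 powr (- ((n - \<alpha>) * cube_level Q)) * (measure F Q * measure (density N (\<lambda>x. ennreal (g x))) Q))"
proof -
  define k where "k = (\<lambda>Q. 2 powr (- ((n - \<alpha>) * cube_level Q)) * measure F Q)"
  have k: "k Q \<ge> 0" for Q by (simp add: k_def)
  have gN: "g \<in> borel_measurable N" using g(1) by (simp add: N_def)
  have Dm: "Q \<in> sets N" if "Q \<in> D" for Q using DN(3) that by (auto simp: N_def)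
  have "(\<integral>\<^sup>+x. ennreal (h x * g x) \<partial>N) = (\<integral>\<^sup>+x. (\<Sum>Q\<in>D. ennreal (k Q) * (ennreal (g x) * indicator Q x)) \<partial>N)"
  proof (intro nn_integral_cong)
    fix x
    have "h x * g x = (\<Sum>Q\<in>D. k Q * (g x * indicator Q x))"
      unfolding h_def grid_potential_def k_def F_def n_def sum_distrib_right by (intro sum.cong refl) (simp add: mult_ac)
    also have "ennreal \<dots> = (\<Sum>Q\<in>D. ennreal (k Q * (g x * indicator Q x)))"
      using k g(2) by (intro sum_ennreal[symmetric]) auto
    also have "\<dots> = (\<Sum>Q\<in>D. ennreal (k Q) * (ennreal (g x) * indicator Q x))"
      using k g(2) by (intro sum.cong refl) (auto simp: ennreal_mult indicator_def)
    finally show "ennreal (h x * g x) = (\<Sum>Q\<in>D. ennreal (k Q) * (ennreal (g x) * indicator Q x))" .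
  qed
  also have "\<dots> = (\<Sum>Q\<in>D. \<integral>\<^sup>+x. ennreal (k Q) * (ennreal (g x) * indicator Q x) \<partial>N)"
    using gN Dm by (intro nn_integral_sum) auto
  also have "\<dots> = (\<Sum>Q\<in>D. ennreal (k Q) * emeasure (density N (\<lambda>x. ennreal (g x))) Q)"
    using gN Dm by (intro sum.cong refl) (simp add: nn_integral_cmult emeasure_density)
  also have "\<dots> = (\<Sum>Q\<in>D. ennreal (k Q * measure (density N (\<lambda>x. ennreal (g x))) Q))"
    using DG k by (intro sum.cong refl) (auto simp: emeasure_eq_measure2 ennreal_mult subset_iff)
  also have "\<dots> = ennreal (\<Sum>Q\<in>D. k Q * measure (density N (\<lambda>x. ennreal (g x))) Q)"
    using k by (intro sum_ennreal) auto
  finally show ?thesis by (simp add: k_def mult.assoc)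
qed

private lemma bounded_density:
  assumes g: "g \<in> borel_measurable lebesgue" "\<And>x. g x \<ge> 0" "\<And>x. g x \<le> b"
  shows "D \<subseteq> fmeasurable (density N (\<lambda>x. ennreal (g x)))"
proof
  fix Q assume Q: "Q \<in> D"
  then have Qs: "Q \<in> sets N" using DN(3) by (auto simp: N_def)
  have "b \<ge> 0" using g(2,3) order_trans by blast
  have "g \<in> borel_measurable N" using g(1) by (simp add: N_def)
  then have "emeasure (density N (\<lambda>x. ennreal (g x))) Q = (\<integral>\<^sup>+x. ennreal (g x) * indicator Q x \<partial>N)"
    using Qs by (subst emeasure_density) auto
  also have "\<dots> \<le> (\<integral>\<^sup>+x. ennreal b * indicator Q x \<partial>N)"
    using g(3) by (intro nn_integral_mono) (auto simp: indicator_def ennreal_leI)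
  also have "\<dots> = ennreal b * emeasure N Q" using Qs by (simp add: nn_integral_cmult_indicator)
  also have "\<dots> < \<infinity>"
    using fmeasurableD2[OF subsetD[OF DN(1) Q]] by (simp add: ennreal_mult_less_top less_top)
  finally show "Q \<in> fmeasurable (density N (\<lambda>x. ennreal (g x)))" using Qs by (intro fmeasurableI) auto
qed

text \<open>Duality: the form is tested on \<open>g = h\<^sup>q\<^sup>-\<^sup>1\<close>, for which it equals the \<open>q\<close>-th power of the norm.\<close>
lemma grid_potential_strong:
  defines "k\<sigma> \<equiv> enn2real (Ainf'_const \<sigma>)"
  assumes K\<sigma>: "Ar_const (1 + q / p') u \<sigma> > 0 \<Longrightarrow> Ainf'_const \<sigma> < \<infinity>"
  shows "(\<integral>\<^sup>+x. ennreal (h x powr q) \<partial>N)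
    \<le> ennreal ((c * (a powr (1/q) * (ku powr (1/p') + k\<sigma> powr (1/q))) * X powr (1/p)) powr q)"
proof -
  note exps = off_diagonal_exponents[OF pq(1-4)]
  define Y where "Y = enn2real (\<integral>\<^sup>+x. ennreal (h x powr q) \<partial>N)"
  define C where "C = c * (a powr (1/q) * (ku powr (1/p') + k\<sigma> powr (1/q))) * X powr (1/p)"
  define g where "g = (\<lambda>x. h x powr (q - 1))"
  have c: "c > 0" unfolding c_def using form_const_factors(5)[OF \<alpha> pq(1-4)] by (simp add: n_def)
  have C: "C \<ge> 0" using c by (simp add: C_def)
  have g: "g \<in> borel_measurable lebesgue" "\<And>x. g x \<ge> 0" "\<And>x. g x \<le> hmax powr (q - 1)"
    using potential_props exps by (auto simp: g_def intro!: powr_mono2)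
  have "(\<integral>\<^sup>+x. ennreal (h x powr q) \<partial>N) \<le> (\<integral>\<^sup>+x. ennreal (hmax powr q) * indicator (\<Union>D) x \<partial>N)"
    using potential_props(1-3) exps by (intro nn_integral_mono) (force simp: indicator_def intro!: ennreal_leI powr_mono2)
  also have "\<dots> = ennreal (hmax powr q) * emeasure N (\<Union>D)"
    using UD by (simp add: nn_integral_cmult_indicator fmeasurableD)
  also have "\<dots> < \<infinity>" using fmeasurableD2[OF UD] by (simp add: ennreal_mult_less_top less_top)
  finally have Y: "(\<integral>\<^sup>+x. ennreal (h x powr q) \<partial>N) = ennreal Y" "Y \<ge> 0" by (auto simp: Y_def)
  have hg: "h x * g x = h x powr q" for x
    using potential_props(1)[of x] powr_add[of "h x" 1 "q - 1"] by (cases "h x = 0") (auto simp: g_def)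
  have "1/r = (q - 1) / q" using exps by (simp add: field_simps)
  then have "(q - 1) * r = q" using exps by (simp add: field_simps)
  then have gr: "g x powr r = h x powr q" for x by (simp add: g_def powr_powr)
  have DG: "D \<subseteq> fmeasurable (density N (\<lambda>x. ennreal (g x)))" by (rule bounded_density[OF g])
  have "Y = (\<Sum>Q\<in>D. 2 powr (- ((n - \<alpha>) * cube_level Q)) * (measure F Q * measure (density N (\<lambda>x. ennreal (g x))) Q))"
    using pairing[OF g(1,2) DG] Y by (simp add: hg sum_nonneg)
  also have "\<dots> \<le> form_const n \<alpha> p p' q r * (a powr (1/q) * (ku powr (1/p') + k\<sigma> powr (1/q)) * (X powr (1/p) * Y powr (1/r)))"
    unfolding n_def F_def N_def a_def ku_def k\<sigma>_def
    by (rule form_strong[OF w Afin Ku \<alpha>[unfolded n_def] pq(1-4) pq(5)[unfolded n_def] D f g(1,2) potential_density_fmeasurable[unfolded F_def] DG[unfolded N_def]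
          X[unfolded M_def] _ Y(2) K\<sigma>]) (use Y(1) in \<open>simp_all add: gr N_def\<close>)
  also have "\<dots> = C * Y powr (1/r)" by (simp add: C_def c_def n_def)
  finally have le: "Y \<le> C * Y powr (1/r)" .
  have "Y \<le> C powr q"
  proof (cases "Y = 0")
    case False
    then have Yp: "Y > 0" using Y(2) by simp
    have "Y powr (1/q) * Y powr (1/r) = Y" using Yp pq(4) by (simp flip: powr_add)
    then have "Y powr (1/q) \<le> C" using le Yp by (metis mult_le_cancel_right_pos powr_gt_zero order_less_irrefl)
    then have "(Y powr (1/q)) powr q \<le> C powr q" using exps by (intro powr_mono2) auto
    then show ?thesis using Yp exps by (simp add: powr_powr)
  qed simp
  then show ?thesis unfolding Y(1) C_def by (rule ennreal_leI)
qed

text \<open>The form is tested on the indicator g of the level set. With Y the u-mass of that set,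
  the form is at least s Y, while the integral of g^r du is Y itself. So s Y \<le> C Y^(1/r), and Y
  is finite.\<close>

lemma grid_potential_weak:
  assumes s: "s > 0"
  shows "emeasure N {x. h x > s} \<le> ennreal ((c * (a powr (1/q) * ku powr (1/p')) * X powr (1/p) / s) powr q)"
proof -
  note exps = off_diagonal_exponents[OF pq(1-4)]
  define E where "E = {x. h x > s}"
  define g :: "real ^ 'n \<Rightarrow> real" where "g = indicator E"
  define C where "C = c * (a powr (1/q) * ku powr (1/p')) * X powr (1/p)"
  define Y where "Y = measure N E"
  have c: "c > 0" unfolding c_def using form_const_factors(5)[OF \<alpha> pq(1-4)] by (simp add: n_def)
  have C: "C \<ge> 0" using c by (simp add: C_def)
  have Em: "E \<in> sets lebesgue" using borel_measurable_const[of s] potential_props(4) borel_measurable_less[of "\<lambda>_. s" lebesgue h]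
    by (simp add: E_def)
  have "E \<subseteq> \<Union>D" using potential_props(3) s by (force simp: E_def)
  then have EN: "E \<in> fmeasurable N" using UD Em by (intro fmeasurableI2[OF UD]) (auto simp: N_def)
  have g: "g \<in> borel_measurable lebesgue" "\<And>x. g x \<ge> 0" "\<And>x. g x \<le> 1"
    using Em by (auto simp: g_def indicator_def)
  have gN: "g \<in> borel_measurable N" using g(1) by (simp add: N_def)
  have DG: "D \<subseteq> fmeasurable (density N (\<lambda>x. ennreal (g x)))" by (rule bounded_density[OF g])
  have Y: "emeasure N E = ennreal Y" "Y \<ge> 0" using emeasure_eq_measure2[OF EN] by (auto simp: Y_def)
  have ig: "(\<integral>\<^sup>+x. ennreal (g x) \<partial>N) = ennreal Y"
    using Y(1) EN by (simp add: g_def fmeasurableD ennreal_indicator)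
  have gr: "(\<integral>\<^sup>+x. ennreal (g x powr r) \<partial>N) \<le> ennreal Y"
    unfolding ig[symmetric] by (intro nn_integral_mono) (auto simp: g_def indicator_def)
  have GY: "(\<Sum>H\<in>A. measure (density N (\<lambda>x. ennreal (g x))) H) \<le> Y"
    if A: "finite A" "A \<subseteq> fmeasurable (density N (\<lambda>x. ennreal (g x)))" "pairwise disjnt A" for A
  proof -
    have sp: "emeasure (density N (\<lambda>x. ennreal (g x))) UNIV = ennreal Y"
      using gN ig by (subst emeasure_density) (auto simp: N_def)
    then have "UNIV \<in> fmeasurable (density N (\<lambda>x. ennreal (g x)))" by (intro fmeasurableI) (auto simp: N_def)
    then have "(\<Sum>H\<in>A. measure (density N (\<lambda>x. ennreal (g x))) H) \<le> measure (density N (\<lambda>x. ennreal (g x))) UNIV"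
      using A by (intro sum_measure_disjnt_le) auto
    then show ?thesis using sp Y(2) by (simp add: measure_def)
  qed
  have "ennreal (s * Y) = (\<integral>\<^sup>+x. ennreal s * ennreal (g x) \<partial>N)"
    using gN ig s Y(2) by (subst nn_integral_cmult) (auto simp: ennreal_mult)
  also have "\<dots> \<le> (\<integral>\<^sup>+x. ennreal (h x * g x) \<partial>N)"
    using s by (intro nn_integral_mono) (auto simp: g_def E_def indicator_def intro!: ennreal_leI)
  also have "\<dots> = ennreal (\<Sum>Q\<in>D. 2 powr (- ((n - \<alpha>) * cube_level Q)) * (measure F Q * measure (density N (\<lambda>x. ennreal (g x))) Q))"
    by (rule pairing[OF g(1,2) DG])
  also have "\<dots> \<le> ennreal (form_const n \<alpha> p p' q r * (a powr (1/q) * ku powr (1/p') * (X powr (1/p) * Y powr (1/r))))"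
    unfolding n_def F_def N_def a_def ku_def
    by (intro ennreal_leI form_weak[OF w Afin Ku \<alpha>[unfolded n_def] pq(1-4) pq(5)[unfolded n_def] D f g(1,2) potential_density_fmeasurable[unfolded F_def] DG[unfolded N_def]
          X[unfolded M_def] gr[unfolded N_def] Y(2) g(3) GY[unfolded N_def]])
  also have "\<dots> = ennreal (C * Y powr (1/r))" by (simp add: C_def c_def n_def mult_ac)
  finally have le: "s * Y \<le> C * Y powr (1/r)" using C by (subst (asm) ennreal_le_iff) auto
  have "Y \<le> (C / s) powr q"
  proof (cases "Y = 0")
    case False
    then have Yp: "Y > 0" using Y(2) by simp
    have "Y powr (1/q) * Y powr (1/r) = Y" using Yp pq(4) by (simp flip: powr_add)
    then have "(s * Y powr (1/q)) * Y powr (1/r) \<le> C * Y powr (1/r)" using le by (simp add: mult.assoc)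
    then have "s * Y powr (1/q) \<le> C" using Yp by simp
    then have "Y powr (1/q) \<le> C / s" using s by (simp add: field_simps)
    then have "(Y powr (1/q)) powr q \<le> (C / s) powr q" using exps by (intro powr_mono2) auto
    then show ?thesis using Yp exps by (simp add: powr_powr)
  qed simp
  then show ?thesis unfolding Y(1)[unfolded E_def] C_def by (rule ennreal_leI)
qed


end

section \<open>From the grids to the Riesz potential\<close>

text \<open>Both parts of the integral are bounded by the integral of the absolute value, and |a -
  b| \<le> max a b. The convention \<infinity> - \<infinity> = \<infinity> respects this inequality,
  so divergent potentials are covered.\<close>

lemma abs_riesz_le:
  fixes f \<sigma> :: "real ^ 'n \<Rightarrow> real"
  assumes \<sigma>: "\<And>x. \<sigma> x \<ge> 0"
  shows "e2ennreal \<bar>riesz \<alpha> (\<lambda>y. f y * \<sigma> y) x\<bar>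
    \<le> (\<integral>\<^sup>+y. ennreal (\<bar>f y\<bar> * \<sigma> y / norm (x - y) powr (real CARD('n) - \<alpha>)) \<partial>lebesgue)"
    (is "_ \<le> ?I")
proof -
  have max: "e2ennreal \<bar>enn2ereal a - enn2ereal b\<bar> \<le> max a b" for a b
    by (cases a; cases b) (auto simp: max_def abs_if ennreal_leI split: if_splits)
  define k where "k = (\<lambda>y. f y * \<sigma> y / norm (x - y) powr (real CARD('n) - \<alpha>))"
  have k: "\<bar>k y\<bar> = \<bar>f y\<bar> * \<sigma> y / norm (x - y) powr (real CARD('n) - \<alpha>)" for y
    using \<sigma>[of y] by (simp add: k_def abs_mult)
  have "(\<integral>\<^sup>+y. e2ennreal (ereal (k y)) \<partial>lebesgue) \<le> ?I" "(\<integral>\<^sup>+y. e2ennreal (- ereal (k y)) \<partial>lebesgue) \<le> ?I"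
    unfolding k[symmetric] by (intro nn_integral_mono; simp add: ennreal_leI)+
  moreover have "riesz \<alpha> (\<lambda>y. f y * \<sigma> y) x = eintegral lebesgue (\<lambda>y. ereal (k y))"
    by (simp add: riesz_def k_def)
  ultimately show ?thesis
    unfolding eintegral_def by (auto intro!: order_trans[OF max])
qed

text \<open>The grids of stage N handle only pairs at distance between 2^(-N-1)/3 and 2^N/3. These
  shells exhaust all y \<noteq> x, but the shifts change with N, so only a lower limit of the grid
  potentials is available.\<close>

lemma riesz_le_liminf_grid_potential:
  fixes f \<sigma> :: "real ^ 'n \<Rightarrow> real" and F :: "(real ^ 'n) measure"
  defines "F \<equiv> density (wmeasure \<sigma>) (\<lambda>x. ennreal (f x))"
  assumes w: "weight \<sigma>" and f: "f \<in> borel_measurable lebesgue" "\<And>x. f x \<ge> 0" and e: "e > 0"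
    and DF: "\<And>N \<tau>. grid N \<tau> \<subseteq> fmeasurable F"
  shows "(\<integral>\<^sup>+y. ennreal (f y * \<sigma> y / norm (x - y) powr e) \<partial>lebesgue)
    \<le> liminf (\<lambda>N. ennreal (6 powr e * (\<Sum>\<tau>\<in>UNIV. grid_potential e F (grid N \<tau>) x)))"
proof -
  define A where "A = (\<lambda>N::nat. {y. 2 powr (- real N - 1) / 3 \<le> norm (x - y) \<and> norm (x - y) < 2 powr N / 3})"
  define k where "k = (\<lambda>y. ennreal (f y * \<sigma> y / norm (x - y) powr e))"
  have \<sigma>: "\<sigma> \<in> borel_measurable lebesgue" "\<And>y. \<sigma> y \<ge> 0"
    using weight_measurable[OF w] w by (auto simp: weight_def)
  have A: "A N \<in> sets lebesgue" for N unfolding A_def by (intro sets_completionI_sets) measurable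
  have nrm: "(\<lambda>y. norm (x - y)) \<in> borel_measurable lebesgue" by (rule measurable_completion) measurable
  have k: "k \<in> borel_measurable lebesgue"
  proof -
    note [measurable] = f(1) \<sigma>(1) nrm
    show ?thesis unfolding k_def by measurable
  qed
  have grow: "\<forall>\<^sub>F N in sequentially. c < 2 powr real N" for c :: real
  proof -
    have "\<forall>\<^sub>F N in sequentially. c < real N"
      using filterlim_real_sequentially by (auto simp: filterlim_at_top_dense)
    then show ?thesis
    proof eventually_elim
      case (elim N)
      moreover have "real N < 2 powr real N" by (simp add: powr_realpow of_nat_less_two_power)
      ultimately show ?case by linarith
    qed
  qed
  \<comment> \<open>At y = x the quotient is 0 because division by 0 yields 0, so the centre, which
    lies in no shell, is harmless.\<close>
  have "k y \<le> liminf (\<lambda>N. k y * indicator (A N) y)" for y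
  proof (cases "x = y")
    case False
    then have "0 < norm (x - y)" by simp
    have "\<forall>\<^sub>F N in sequentially. 2 powr (- real N - 1) / 3 < norm (x - y)"
      using grow[of "1 / (6 * norm (x - y))"]
      by eventually_elim (use \<open>0 < norm (x - y)\<close> in \<open>simp add: powr_diff powr_minus field_simps\<close>)
    moreover have "\<forall>\<^sub>F N in sequentially. norm (x - y) < 2 powr real N / 3"
      using grow[of "3 * norm (x - y)"] by eventually_elim simp
    ultimately have "\<forall>\<^sub>F N in sequentially. k y \<le> k y * indicator (A N) y"
      by eventually_elim (simp add: A_def)
    then show ?thesis by (rule Liminf_bounded)
  qed (simp add: k_def)
  then have "(\<integral>\<^sup>+y. k y \<partial>lebesgue) \<le> (\<integral>\<^sup>+y. liminf (\<lambda>N. k y * indicator (A N) y) \<partial>lebesgue)"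
    by (intro nn_integral_mono)
  also have "\<dots> \<le> liminf (\<lambda>N. \<integral>\<^sup>+y. k y * indicator (A N) y \<partial>lebesgue)"
    using k A by (intro nn_integral_liminf) auto
  also have "\<dots> \<le> liminf (\<lambda>N. ennreal (6 powr e * (\<Sum>\<tau>\<in>UNIV. grid_potential e F (grid N \<tau>) x)))"
  proof (rule Liminf_mono)
    have "\<forall>\<^sub>F N in sequentially. norm x < 2 powr real N" by (rule grow)
    then show "\<forall>\<^sub>F N in sequentially. (\<integral>\<^sup>+y. k y * indicator (A N) y \<partial>lebesgue)
        \<le> ennreal (6 powr e * (\<Sum>\<tau>\<in>UNIV. grid_potential e F (grid N \<tau>) x))"
      using eventually_ge_at_top[of 1]
    proof eventually_elim
      case (elim N)
      define c where "c = (\<lambda>Q. 6 powr e * (2 powr (- (e * cube_level Q)) * indicator Q x) :: real)"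
      have c: "c Q \<ge> 0" for Q by (simp add: c_def)
      have Qm: "Q \<in> sets lebesgue" if "Q \<in> grid N \<tau>" for Q \<tau>
        using grid_gcube[OF that] gcube_fmeasurable by auto
      have meas: "(\<lambda>y. ennreal (f y * \<sigma> y) * indicator Q y) \<in> borel_measurable lebesgue"
        "(\<lambda>y. ennreal (c Q) * (ennreal (f y * \<sigma> y) * indicator Q y)) \<in> borel_measurable lebesgue"
        if "Q \<in> grid N \<tau>" for Q \<tau>
      proof -
        note [measurable] = f(1) \<sigma>(1) Qm[OF that]
        show "(\<lambda>y. ennreal (f y * \<sigma> y) * indicator Q y) \<in> borel_measurable lebesgue" by measurable
        then show "(\<lambda>y. ennreal (c Q) * (ennreal (f y * \<sigma> y) * indicator Q y)) \<in> borel_measurable lebesgue" by measurable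
      qed
      have xN: "\<bar>x $ i\<bar> \<le> 2 powr N" for i
        using component_le_norm_cart[of x i] elim(1) by linarith
      have "(\<integral>\<^sup>+y. k y * indicator (A N) y \<partial>lebesgue)
          \<le> (\<integral>\<^sup>+y. (\<Sum>\<tau>\<in>UNIV. \<Sum>Q\<in>grid N \<tau>. ennreal (c Q) * (ennreal (f y * \<sigma> y) * indicator Q y)) \<partial>lebesgue)"
      proof (intro nn_integral_mono)
        fix y
        show "k y * indicator (A N) y \<le> (\<Sum>\<tau>\<in>UNIV. \<Sum>Q\<in>grid N \<tau>. ennreal (c Q) * (ennreal (f y * \<sigma> y) * indicator Q y))"
        proof (cases "y \<in> A N")
          case True
          have "1 / norm (x - y) powr e \<le> 6 powr e * (\<Sum>\<tau>\<in>UNIV. \<Sum>Q\<in>grid N \<tau>. 2 powr (- (e * cube_level Q)) * (indicator Q x * indicator Q y))"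
            by (rule kernel_le_grid_sum[OF elim(2) xN e]) (use True in \<open>auto simp: A_def\<close>)
          also have "\<dots> = (\<Sum>\<tau>\<in>UNIV. \<Sum>Q\<in>grid N \<tau>. c Q * indicator Q y)"
            by (simp add: c_def sum_distrib_left mult_ac)
          finally have "f y * \<sigma> y * (1 / norm (x - y) powr e) \<le> f y * \<sigma> y * (\<Sum>\<tau>\<in>UNIV. \<Sum>Q\<in>grid N \<tau>. c Q * indicator Q y)"
            using f(2) \<sigma>(2) by (intro mult_left_mono) auto
          then have "k y \<le> ennreal (\<Sum>\<tau>\<in>UNIV. \<Sum>Q\<in>grid N \<tau>. c Q * (f y * \<sigma> y * indicator Q y))"
            unfolding k_def by (intro ennreal_leI) (simp add: sum_distrib_left mult_ac)
          also have "\<dots> = (\<Sum>\<tau>\<in>UNIV. ennreal (\<Sum>Q\<in>grid N \<tau>. c Q * (f y * \<sigma> y * indicator Q y)))"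
            using c f(2) \<sigma>(2) by (intro sum_ennreal[symmetric] sum_nonneg) auto
          also have "\<dots> = (\<Sum>\<tau>\<in>UNIV. \<Sum>Q\<in>grid N \<tau>. ennreal (c Q * (f y * \<sigma> y * indicator Q y)))"
            using c f(2) \<sigma>(2) by (intro sum.cong refl sum_ennreal[symmetric]) auto
          also have "\<dots> = (\<Sum>\<tau>\<in>UNIV. \<Sum>Q\<in>grid N \<tau>. ennreal (c Q) * (ennreal (f y * \<sigma> y) * indicator Q y))"
            using c f(2) \<sigma>(2) by (intro sum.cong refl) (auto simp: ennreal_mult indicator_def)
          finally show ?thesis using True by simp
        qed simp
      qed
      also have "\<dots> = (\<Sum>\<tau>\<in>UNIV. \<integral>\<^sup>+y. (\<Sum>Q\<in>grid N \<tau>. ennreal (c Q) * (ennreal (f y * \<sigma> y) * indicator Q y)) \<partial>lebesgue)"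
        using meas(2) by (intro nn_integral_sum borel_measurable_sum) auto
      also have "\<dots> = (\<Sum>\<tau>\<in>UNIV. \<Sum>Q\<in>grid N \<tau>. \<integral>\<^sup>+y. ennreal (c Q) * (ennreal (f y * \<sigma> y) * indicator Q y) \<partial>lebesgue)"
        using meas(2) by (intro sum.cong refl nn_integral_sum) auto
      also have "\<dots> = (\<Sum>\<tau>\<in>UNIV. \<Sum>Q\<in>grid N \<tau>. ennreal (c Q * measure F Q))"
      proof (intro sum.cong refl)
        fix \<tau> :: "'n \<Rightarrow> bool" and Q assume Q: "Q \<in> grid N \<tau>"
        have "(\<integral>\<^sup>+y. ennreal (c Q) * (ennreal (f y * \<sigma> y) * indicator Q y) \<partial>lebesgue)
            = ennreal (c Q) * (\<integral>\<^sup>+y. ennreal (f y * \<sigma> y) * indicator Q y \<partial>lebesgue)"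
          using meas(1)[OF Q] by (intro nn_integral_cmult) auto
        also have "(\<integral>\<^sup>+y. ennreal (f y * \<sigma> y) * indicator Q y \<partial>lebesgue) = emeasure F Q"
        proof -
          have "F = density lebesgue (\<lambda>y. ennreal (\<sigma> y) * ennreal (f y))"
            unfolding F_def using f(1) \<sigma>(1) by (intro density_density_eq) auto
          also have "\<dots> = density lebesgue (\<lambda>y. ennreal (f y * \<sigma> y))"
            using f(2) \<sigma>(2) by (intro arg_cong[where f="density lebesgue"] ext) (simp add: ennreal_mult mult.commute)
          finally show ?thesis using f(1) \<sigma>(1) Qm[OF Q] by (simp add: emeasure_density)
        qed
        also have "\<dots> = ennreal (measure F Q)" using DF Q by (intro emeasure_eq_measure2) auto
        finally show "(\<integral>\<^sup>+y. ennreal (c Q) * (ennreal (f y * \<sigma> y) * indicator Q y) \<partial>lebesgue) = ennreal (c Q * measure F Q)"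
          using c by (simp add: ennreal_mult)
      qed
      also have "\<dots> = (\<Sum>\<tau>\<in>UNIV. ennreal (\<Sum>Q\<in>grid N \<tau>. c Q * measure F Q))"
        using c by (intro sum.cong refl sum_ennreal) auto
      also have "\<dots> = ennreal (\<Sum>\<tau>\<in>UNIV. \<Sum>Q\<in>grid N \<tau>. c Q * measure F Q)"
        using c by (intro sum_ennreal sum_nonneg) auto
      also have "(\<Sum>\<tau>\<in>UNIV. \<Sum>Q\<in>grid N \<tau>. c Q * measure F Q) = 6 powr e * (\<Sum>\<tau>\<in>UNIV. grid_potential e F (grid N \<tau>) x)"
        by (simp add: c_def grid_potential_def sum_distrib_left mult_ac)
      finally show ?case .
    qed
  qed
  finally show ?thesis by (simp add: k_def)
qed

section \<open>Passage to the limit in the strong and the weak norm\<close>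

lemma ennpowr_mono: "x \<le> y \<Longrightarrow> 0 \<le> s \<Longrightarrow> ennpowr x s \<le> ennpowr y s"
  by (cases x; cases y) (auto simp: ennpowr_def top_unique ennreal_leI powr_mono2 infinity_ennreal_def)

lemma ennpowr_ennreal: "x \<ge> 0 \<Longrightarrow> ennpowr (ennreal x) s = ennreal (x powr s)"
  by (simp add: ennpowr_def)

lemma ennpowr_ge: "ennreal (enn2real x powr s) \<le> ennpowr x s"
  by (simp add: ennpowr_def)

lemma ennpowr_le_liminf:
  assumes x: "x \<le> liminf (\<lambda>N. ennreal (a N))" and a: "\<And>N. a N \<ge> 0" and q: "q > 0"
  shows "ennpowr x q \<le> liminf (\<lambda>N. ennreal (a N powr q))"
  unfolding le_Liminf_iff
proof (intro allI impI)
  fix y assume y: "y < ennpowr x q"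
  then obtain b where b: "y = ennreal b" "b \<ge> 0" by (cases y) auto
  have "ennreal (b powr (1/q)) < x"
  proof (cases x)
    case (real c)
    then have "b < c powr q" using y b by (simp add: ennpowr_def ennreal_less_iff)
    then have "b powr (1/q) < (c powr q) powr (1/q)" using b q by (intro powr_less_mono2) auto
    then show ?thesis using real q b by (simp add: powr_powr ennreal_less_iff)
  qed simp
  then have "\<forall>\<^sub>F N in sequentially. ennreal (b powr (1/q)) < ennreal (a N)"
    using x unfolding le_Liminf_iff by blast
  then show "\<forall>\<^sub>F N in sequentially. y < ennreal (a N powr q)"
  proof eventually_elim
    case (elim N)
    then have "b powr (1/q) < a N" by (simp add: ennreal_less_iff)
    then have "(b powr (1/q)) powr q < a N powr q" using q by (intro powr_less_mono2) auto
    then show ?case using b q by (simp add: powr_powr ennreal_less_iff)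
  qed
qed

lemma sum_powr_le:
  fixes h :: "'i \<Rightarrow> real"
  assumes "finite I" "\<And>i. i \<in> I \<Longrightarrow> h i \<ge> 0" "q > 0"
  shows "(\<Sum>i\<in>I. h i) powr q \<le> real (card I) powr q * (\<Sum>i\<in>I. h i powr q)"
proof (cases "I = {}")
  case False
  define m where "m = Max (h ` I)"
  have "m \<in> h ` I" unfolding m_def using False assms(1) by (intro Max_in) auto
  then obtain j where j: "j \<in> I" "m = h j" by auto
  have "(\<Sum>i\<in>I. h i) \<le> real (card I) * m"
    using assms(1) by (intro sum_bounded_above) (auto simp: m_def)
  then have "(\<Sum>i\<in>I. h i) powr q \<le> (real (card I) * m) powr q"
    using assms by (intro powr_mono2 sum_nonneg) auto
  also have "\<dots> = real (card I) powr q * h j powr q" using j assms by (simp add: powr_mult)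
  also have "\<dots> \<le> real (card I) powr q * (\<Sum>i\<in>I. h i powr q)"
    using assms j by (intro mult_left_mono member_le_sum) auto
  finally show ?thesis .
qed simp

context
  fixes u \<sigma> f :: "real ^ 'n \<Rightarrow> real" and \<alpha> p p' q r a ku c C :: real
  defines "a \<equiv> enn2real (Ar_const (1 + q / p') u \<sigma>)" and "ku \<equiv> enn2real (Ainf'_const u)"
    and "c \<equiv> form_const (real CARD('n)) \<alpha> p p' q r"
    and "C \<equiv> 6 powr (real CARD('n) - \<alpha>) * real (card (UNIV :: ('n \<Rightarrow> bool) set)) ^ 2 * form_const (real CARD('n)) \<alpha> p p' q r"
  assumes w: "weight u" "weight \<sigma>" and Afin: "Ar_const (1 + q / p') u \<sigma> < \<infinity>"
    and Ku: "Ar_const (1 + q / p') u \<sigma> > 0 \<Longrightarrow> Ainf'_const u < \<infinity>"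
    and \<alpha>: "0 < \<alpha>" "\<alpha> < real CARD('n)"
    and pq: "1 < p" "p < q" "1/p + 1/p' = 1" "1/q + 1/r = 1" "1/p - 1/q = \<alpha> / real CARD('n)"
    and f: "f \<in> Lspace p \<sigma>"
begin

private definition "m = real (card (UNIV :: ('n \<Rightarrow> bool) set))"
private definition "X = enn2real (\<integral>\<^sup>+x. ennreal (\<bar>f x\<bar> powr p) \<partial>wmeasure \<sigma>)"
private definition "F = density (wmeasure \<sigma>) (\<lambda>x. ennreal \<bar>f x\<bar>)"
private definition "h N \<tau> = grid_potential (real CARD('n) - \<alpha>) F (grid N \<tau>)"
text \<open>The sum over all shifts that dominates the potential. In \<open>C\<close>, one factor m
  comes from splitting this sum into its m terms, the other from adding up the m resulting bounds
  before the q-th root is taken.\<close>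

private definition "H N x = 6 powr (real CARD('n) - \<alpha>) * (\<Sum>\<tau>\<in>UNIV. h N \<tau> x)"

private lemma fmeas: "f \<in> borel_measurable lebesgue" "(\<lambda>x. \<bar>f x\<bar>) \<in> borel_measurable lebesgue"
  using f by (auto simp: Lspace_def)

private lemma m1: "m \<ge> 1"
proof -
  have "card (UNIV :: ('n \<Rightarrow> bool) set) \<noteq> 0" by simp
  then have "1 \<le> card (UNIV :: ('n \<Rightarrow> bool) set)" by linarith
  then show ?thesis unfolding m_def by linarith
qed

private lemma Lnorm_X: "(\<integral>\<^sup>+x. ennreal (\<bar>f x\<bar> powr p) \<partial>wmeasure \<sigma>) = ennreal X" "X \<ge> 0"
  "Lnorm p \<sigma> (\<lambda>x. ereal (f x)) = ennreal (X powr (1/p))"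
proof -
  have \<sigma>: "\<sigma> \<in> borel_measurable lebesgue" by (rule weight_measurable[OF w(2)])
  have eq: "(\<integral>\<^sup>+x. ennpowr (e2ennreal \<bar>ereal (f x)\<bar>) p * ennreal (\<sigma> x) \<partial>lebesgue) = (\<integral>\<^sup>+x. ennreal (\<bar>f x\<bar> powr p) \<partial>wmeasure \<sigma>)"
    using \<sigma> fmeas by (subst nn_integral_density) (auto simp: ennpowr_ennreal mult.commute)
  have "Lnorm p \<sigma> (\<lambda>x. ereal (f x)) < \<infinity>" using f by (simp add: Lspace_def)
  then have "(\<integral>\<^sup>+x. ennreal (\<bar>f x\<bar> powr p) \<partial>wmeasure \<sigma>) < \<infinity>"
    unfolding Lnorm_def eq by (auto simp: ennpowr_def less_top[symmetric] split: if_splits)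
  then show X: "(\<integral>\<^sup>+x. ennreal (\<bar>f x\<bar> powr p) \<partial>wmeasure \<sigma>) = ennreal X" by (simp add: X_def)
  show "X \<ge> 0" by (simp add: X_def)
  then show "Lnorm p \<sigma> (\<lambda>x. ereal (f x)) = ennreal (X powr (1/p))"
    unfolding Lnorm_def eq X by (rule ennpowr_ennreal)
qed

private lemmas X_le = eq_refl[OF Lnorm_X(1)]

private lemma grid_fmeasurable: "grid N \<tau> \<subseteq> fmeasurable F"
  unfolding F_def
  by (rule potential_density_fmeasurable[OF w Afin Ku \<alpha> pq finite_grid grid_gcube fmeas(2) abs_ge_zero X_le Lnorm_X(2)])

private lemma h: "h N \<tau> x \<ge> 0" "h N \<tau> \<in> borel_measurable lebesgue" "H N x \<ge> 0" "H N \<in> borel_measurable lebesgue"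
proof -
  show h0: "h N \<tau> x \<ge> 0" for N \<tau> x unfolding h_def by (rule grid_potential_nonneg)
  show hm: "h N \<tau> \<in> borel_measurable lebesgue" for N \<tau>
    unfolding h_def using gcube_fmeasurable by (intro grid_potential_measurable finite_grid) (auto dest!: grid_gcube)
  show "H N x \<ge> 0" unfolding H_def using h0 by (intro mult_nonneg_nonneg sum_nonneg) auto
  show "H N \<in> borel_measurable lebesgue"
    unfolding H_def[abs_def] using hm by (intro borel_measurable_times borel_measurable_sum borel_measurable_const) auto
qed

private lemma riesz_le: "e2ennreal \<bar>riesz \<alpha> (\<lambda>y. f y * \<sigma> y) x\<bar> \<le> liminf (\<lambda>N. ennreal (H N x))"
proof -
  have "e2ennreal \<bar>riesz \<alpha> (\<lambda>y. f y * \<sigma> y) x\<bar>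
      \<le> (\<integral>\<^sup>+y. ennreal (\<bar>f y\<bar> * \<sigma> y / norm (x - y) powr (real CARD('n) - \<alpha>)) \<partial>lebesgue)"
    using w(2) by (intro abs_riesz_le) (simp add: weight_def)
  also have "\<dots> \<le> liminf (\<lambda>N. ennreal (H N x))"
    unfolding H_def h_def F_def
    by (rule riesz_le_liminf_grid_potential[OF w(2) fmeas(2) abs_ge_zero]) (use \<alpha> grid_fmeasurable in \<open>simp_all add: F_def\<close>)
  finally show ?thesis .
qed

private lemma root_le: "z \<ge> 0 \<Longrightarrow> (m * z powr q) powr (1/q) \<le> m * z"
proof -
  assume z: "z \<ge> 0"
  have q: "q > 1" using pq by linarith
  have "(m * z powr q) powr (1/q) = m powr (1/q) * z" using q z m1 by (simp add: powr_mult powr_powr)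
  also have "\<dots> \<le> m powr 1 * z" using q z m1 by (intro mult_right_mono powr_mono) auto
  finally show ?thesis using m1 by simp
qed

private lemma c_pos: "c > 0"
  unfolding c_def by (rule form_const_factors(5)[OF \<alpha> pq(1-4)])

lemma riesz_strong:
  defines "k\<sigma> \<equiv> enn2real (Ainf'_const \<sigma>)"
  assumes K\<sigma>: "Ar_const (1 + q / p') u \<sigma> > 0 \<Longrightarrow> Ainf'_const \<sigma> < \<infinity>"
  shows "Lnorm q u (riesz \<alpha> (\<lambda>x. f x * \<sigma> x))
    \<le> ennreal (C * (a powr (1/q) * (ku powr (1/p') + k\<sigma> powr (1/q)))) * Lnorm p \<sigma> (\<lambda>x. ereal (f x))"
proof -
  define Z where "Z = c * (a powr (1/q) * (ku powr (1/p') + k\<sigma> powr (1/q))) * X powr (1/p)"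
  define L where "L = 6 powr (real CARD('n) - \<alpha>)"
  have L: "L > 0" by (simp add: L_def)
  have Z: "Z \<ge> 0" using c_pos by (simp add: Z_def)
  have q: "q > 1" using pq by linarith
  have um: "(\<lambda>x. ennreal (u x)) \<in> borel_measurable lebesgue" using weight_measurable[OF w(1)] by simp
  have hq: "(\<integral>\<^sup>+x. ennreal (h N \<tau> x powr q) \<partial>wmeasure u) \<le> ennreal (Z powr q)" for N \<tau>
    unfolding h_def F_def Z_def c_def a_def ku_def k\<sigma>_def
    by (rule grid_potential_strong[OF w Afin Ku \<alpha> pq finite_grid grid_gcube fmeas(2) abs_ge_zero X_le Lnorm_X(2) K\<sigma>])
  have Hq: "(\<integral>\<^sup>+x. ennreal (H N x powr q) \<partial>wmeasure u) \<le> ennreal (m * (L * m * Z) powr q)" for N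
  proof -
    have "(\<integral>\<^sup>+x. ennreal (H N x powr q) \<partial>wmeasure u)
        \<le> (\<integral>\<^sup>+x. (\<Sum>\<tau>\<in>UNIV. ennreal ((L * m) powr q) * ennreal (h N \<tau> x powr q)) \<partial>wmeasure u)"
    proof (intro nn_integral_mono)
      fix x
      have "H N x powr q = L powr q * (\<Sum>\<tau>\<in>UNIV. h N \<tau> x) powr q"
        unfolding H_def L_def[symmetric] using L h(1) by (intro powr_mult)
      also have "\<dots> \<le> L powr q * (m powr q * (\<Sum>\<tau>\<in>UNIV. h N \<tau> x powr q))"
        unfolding m_def using h(1) q by (intro mult_left_mono sum_powr_le) auto
      also have "\<dots> = (\<Sum>\<tau>\<in>UNIV. (L * m) powr q * h N \<tau> x powr q)"
        using L m1 by (simp add: powr_mult sum_distrib_left mult.assoc)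
      finally have "ennreal (H N x powr q) \<le> ennreal (\<Sum>\<tau>\<in>UNIV. (L * m) powr q * h N \<tau> x powr q)" by (rule ennreal_leI)
      also have "\<dots> = (\<Sum>\<tau>\<in>UNIV. ennreal ((L * m) powr q * h N \<tau> x powr q))" by (intro sum_ennreal[symmetric]) auto
      also have "\<dots> = (\<Sum>\<tau>\<in>UNIV. ennreal ((L * m) powr q) * ennreal (h N \<tau> x powr q))"
        by (intro sum.cong refl ennreal_mult) auto
      finally show "ennreal (H N x powr q) \<le> (\<Sum>\<tau>\<in>UNIV. ennreal ((L * m) powr q) * ennreal (h N \<tau> x powr q))" .
    qed
    also have "\<dots> = (\<Sum>\<tau>\<in>UNIV. \<integral>\<^sup>+x. ennreal ((L * m) powr q) * ennreal (h N \<tau> x powr q) \<partial>wmeasure u)"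
      using h(2) by (intro nn_integral_sum) auto
    also have "\<dots> = (\<Sum>\<tau>\<in>UNIV. ennreal ((L * m) powr q) * (\<integral>\<^sup>+x. ennreal (h N \<tau> x powr q) \<partial>wmeasure u))"
      using h(2) by (intro sum.cong refl nn_integral_cmult) auto
    also have "\<dots> \<le> (\<Sum>\<tau>\<in>(UNIV :: ('n \<Rightarrow> bool) set). ennreal ((L * m) powr q) * ennreal (Z powr q))"
      by (intro sum_mono mult_left_mono hq) auto
    also have "\<dots> = ennreal (m * (L * m * Z) powr q)"
      using L m1 Z by (simp add: m_def powr_mult ennreal_mult ennreal_of_nat_eq_real_of_nat)
    finally show ?thesis .
  qed
  have "(\<integral>\<^sup>+x. ennpowr (e2ennreal \<bar>riesz \<alpha> (\<lambda>x. f x * \<sigma> x) x\<bar>) q * ennreal (u x) \<partial>lebesgue)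
      \<le> (\<integral>\<^sup>+x. ennreal (u x) * liminf (\<lambda>N. ennreal (H N x powr q)) \<partial>lebesgue)"
  proof (intro nn_integral_mono)
    fix x
    have "ennpowr (e2ennreal \<bar>riesz \<alpha> (\<lambda>x. f x * \<sigma> x) x\<bar>) q \<le> liminf (\<lambda>N. ennreal (H N x powr q))"
      using q by (intro ennpowr_le_liminf[OF riesz_le h(3)]) auto
    then show "ennpowr (e2ennreal \<bar>riesz \<alpha> (\<lambda>x. f x * \<sigma> x) x\<bar>) q * ennreal (u x)
        \<le> ennreal (u x) * liminf (\<lambda>N. ennreal (H N x powr q))"
      by (simp add: mult.commute mult_left_mono)
  qed
  also have "\<dots> = (\<integral>\<^sup>+x. liminf (\<lambda>N. ennreal (H N x powr q)) \<partial>wmeasure u)"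
    using um h(4) by (intro nn_integral_density[symmetric] borel_measurable_liminf) auto
  also have "\<dots> \<le> liminf (\<lambda>N. \<integral>\<^sup>+x. ennreal (H N x powr q) \<partial>wmeasure u)"
    using h(4) by (intro nn_integral_liminf) auto
  also have "\<dots> \<le> liminf (\<lambda>N::nat. ennreal (m * (L * m * Z) powr q))"
    by (intro Liminf_mono always_eventually allI Hq)
  also have "\<dots> = ennreal (m * (L * m * Z) powr q)" by (simp add: Liminf_const)
  finally have "Lnorm q u (riesz \<alpha> (\<lambda>x. f x * \<sigma> x)) \<le> ennpowr (ennreal (m * (L * m * Z) powr q)) (1/q)"
    unfolding Lnorm_def using q by (intro ennpowr_mono) auto
  also have "\<dots> = ennreal ((m * (L * m * Z) powr q) powr (1/q))" using m1 by (intro ennpowr_ennreal) auto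
  also have "\<dots> \<le> ennreal (m * (L * m * Z))" using L m1 Z by (intro ennreal_leI root_le) auto
  also have "m * (L * m * Z) = C * (a powr (1/q) * (ku powr (1/p') + k\<sigma> powr (1/q))) * X powr (1/p)"
    by (simp add: C_def Z_def L_def m_def c_def power2_eq_square mult_ac)
  also have "ennreal \<dots> = ennreal (C * (a powr (1/q) * (ku powr (1/p') + k\<sigma> powr (1/q)))) * Lnorm p \<sigma> (\<lambda>x. ereal (f x))"
    unfolding Lnorm_X(3) using c_pos by (intro ennreal_mult) (auto simp: C_def c_def)
  finally show ?thesis .
qed

lemma riesz_weak:
  "weak_Lnorm q u (riesz \<alpha> (\<lambda>x. f x * \<sigma> x))
    \<le> ennreal (C * (a powr (1/q) * ku powr (1/p'))) * Lnorm p \<sigma> (\<lambda>x. ereal (f x))"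
  unfolding weak_Lnorm_def
proof (intro SUP_least)
  fix t :: real assume "t \<in> {0<..}"
  then have t: "t > 0" by simp
  define Z where "Z = c * (a powr (1/q) * ku powr (1/p')) * X powr (1/p)"
  define L where "L = 6 powr (real CARD('n) - \<alpha>)"
  \<comment> \<open>If every \<open>h N \<tau> x\<close> is at most s, then \<open>H N x\<close> is
    at most L m s = t; so the level set at t is covered by the level sets at s of the single
    grids.\<close>
  define s where "s = t / (L * m)"
  define S where "S = {x. \<bar>riesz \<alpha> (\<lambda>x. f x * \<sigma> x) x\<bar> > ereal t}"
  have L: "L > 0" by (simp add: L_def)
  have s: "s > 0" using t L m1 by (simp add: s_def)
  have Z: "Z \<ge> 0" using c_pos by (simp add: Z_def)
  have q: "q > 1" using pq by linarith
  have um: "(\<lambda>x. ennreal (u x)) \<in> borel_measurable lebesgue" using weight_measurable[OF w(1)] by simp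
  have hs: "emeasure (wmeasure u) {x. h N \<tau> x > s} \<le> ennreal ((Z / s) powr q)" for N \<tau>
    unfolding h_def F_def Z_def c_def a_def ku_def
    by (rule grid_potential_weak[OF w Afin Ku \<alpha> pq finite_grid grid_gcube fmeas(2) abs_ge_zero X_le Lnorm_X(2) s])
  have lev: "{x. g x > b} \<in> sets lebesgue" if "g \<in> borel_measurable lebesgue" for g :: "real ^ 'n \<Rightarrow> real" and b
    using borel_measurable_less[OF borel_measurable_const that, of b] by simp
  have Hs: "emeasure (wmeasure u) {x. H N x > t} \<le> ennreal (m * (Z / s) powr q)" for N
  proof -
    have "{x. H N x > t} \<subseteq> (\<Union>\<tau>. {x. h N \<tau> x > s})"
    proof (rule subsetI, rule ccontr)
      fix x assume x: "x \<in> {x. H N x > t}" and "x \<notin> (\<Union>\<tau>. {x. h N \<tau> x > s})"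
      then have "(\<Sum>\<tau>\<in>UNIV. h N \<tau> x) \<le> m * s"
        unfolding m_def by (intro sum_bounded_above) (auto simp: not_less)
      then have "H N x \<le> L * (m * s)" unfolding H_def L_def[symmetric] using L by (intro mult_left_mono) auto
      also have "\<dots> = t" using L m1 by (simp add: s_def)
      finally show False using x by simp
    qed
    then have "emeasure (wmeasure u) {x. H N x > t} \<le> emeasure (wmeasure u) (\<Union>\<tau>. {x. h N \<tau> x > s})"
      using lev[OF h(2)] by (intro emeasure_mono) (auto intro!: sets.finite_UN)
    also have "\<dots> \<le> (\<Sum>\<tau>\<in>UNIV. emeasure (wmeasure u) {x. h N \<tau> x > s})"
      using lev[OF h(2)] by (intro emeasure_subadditive_finite) auto
    also have "\<dots> \<le> (\<Sum>\<tau>\<in>(UNIV :: ('n \<Rightarrow> bool) set). ennreal ((Z / s) powr q))"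
      by (intro sum_mono hs)
    also have "\<dots> = ennreal (m * (Z / s) powr q)"
      by (simp add: m_def ennreal_mult ennreal_of_nat_eq_real_of_nat)
    finally show ?thesis .
  qed
  have "wmass u S \<le> (\<integral>\<^sup>+x. ennreal (u x) * liminf (\<lambda>N. indicator {x. H N x > t} x) \<partial>lebesgue)"
    unfolding wmass_def
  proof (intro nn_integral_mono mult_left_mono)
    fix x
    \<comment> \<open>Strictness of the level carries over: where the potential exceeds t, so does
      its lower limit bound, and the point lies in the level sets of \<open>H N\<close> for all
      large N.\<close>
    show "indicator S x \<le> liminf (\<lambda>N. indicator {x. H N x > t} x :: ennreal)"
    proof (cases "x \<in> S")
      case True
      have "ennreal t < e2ennreal \<bar>riesz \<alpha> (\<lambda>x. f x * \<sigma> x) x\<bar>"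
        using True t by (cases "riesz \<alpha> (\<lambda>x. f x * \<sigma> x) x") (auto simp: S_def ennreal_less_iff)
      then have "\<forall>\<^sub>F N in sequentially. ennreal t < ennreal (H N x)"
        using riesz_le[of x] unfolding le_Liminf_iff by blast
      then have "\<forall>\<^sub>F N in sequentially. (1::ennreal) \<le> indicator {x. H N x > t} x"
        by eventually_elim (use t in \<open>simp add: ennreal_less_iff\<close>)
      then show ?thesis using True by (simp add: Liminf_bounded)
    qed simp
  qed simp
  also have "\<dots> = (\<integral>\<^sup>+x. liminf (\<lambda>N. indicator {x. H N x > t} x) \<partial>wmeasure u)"
    using um lev[OF h(4)] by (intro nn_integral_density[symmetric] borel_measurable_liminf) auto
  also have "\<dots> \<le> liminf (\<lambda>N. \<integral>\<^sup>+x. indicator {x. H N x > t} x \<partial>wmeasure u)"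
    using lev[OF h(4)] by (intro nn_integral_liminf) auto
  also have "\<dots> \<le> liminf (\<lambda>N::nat. ennreal (m * (Z / s) powr q))"
    using Hs lev[OF h(4)] by (intro Liminf_mono always_eventually allI) simp
  also have "\<dots> = ennreal (m * (Z / s) powr q)" by (simp add: Liminf_const)
  finally have "ennpowr (wmass u S) (1/q) \<le> ennpowr (ennreal (m * (Z / s) powr q)) (1/q)"
    using q by (intro ennpowr_mono) auto
  also have "\<dots> = ennreal ((m * (Z / s) powr q) powr (1/q))" using m1 by (intro ennpowr_ennreal) auto
  also have "\<dots> \<le> ennreal (m * (Z / s))" using Z s by (intro ennreal_leI root_le) auto
  finally have "ennreal t * ennpowr (wmass u S) (1/q) \<le> ennreal t * ennreal (m * (Z / s))"
    by (rule mult_left_mono) simp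
  also have "\<dots> = ennreal (t * (m * (Z / s)))" using t m1 Z s by (intro ennreal_mult[symmetric]) auto
  also have "t * (m * (Z / s)) = C * (a powr (1/q) * ku powr (1/p')) * X powr (1/p)"
    using t L m1 by (simp add: s_def C_def Z_def L_def m_def c_def power2_eq_square mult_ac)
  also have "ennreal \<dots> = ennreal (C * (a powr (1/q) * ku powr (1/p'))) * Lnorm p \<sigma> (\<lambda>x. ereal (f x))"
    unfolding Lnorm_X(3) using c_pos by (intro ennreal_mult) (auto simp: C_def c_def)
  finally show "ennreal t * ennpowr (wmass u {x. \<bar>riesz \<alpha> (\<lambda>x. f x * \<sigma> x) x\<bar> > ereal t}) (1/q)
      \<le> ennreal (C * (a powr (1/q) * ku powr (1/p'))) * Lnorm p \<sigma> (\<lambda>x. ereal (f x))"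
    by (simp add: S_def)
qed

end

section \<open>Operator norms and conclusion\<close>

lemma riesz_opnorm_le:
  assumes "K < \<infinity> \<Longrightarrow> (\<And>f. f \<in> Lspace p \<sigma> \<Longrightarrow> V (riesz \<alpha> (\<lambda>x. f x * \<sigma> x)) \<le> K * Lnorm p \<sigma> (\<lambda>x. ereal (f x)))"
  shows "riesz_opnorm \<alpha> p \<sigma> V \<le> K"
proof (cases "K < \<infinity>")
  case True
  then show ?thesis unfolding riesz_opnorm_def using assms by (intro Inf_lower) auto
next
  case False
  then show ?thesis by (simp add: less_top[symmetric])
qed

theorem theorem1p4:
  fixes \<alpha> p q :: real
  assumes "0 < \<alpha>" and "\<alpha> < real CARD('n::finite)"
    and "1 < p" and "p < real CARD('n) / \<alpha>"
    and "1 / p - 1 / q = \<alpha> / real CARD('n)"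
  shows "\<exists>C::real. C > 0 \<and>
    (\<forall>(u :: real ^ 'n \<Rightarrow> real) \<sigma>.
      weight u \<longrightarrow> weight \<sigma> \<longrightarrow> Ar_const (s_exp p q) u \<sigma> < \<infinity> \<longrightarrow>
      (u \<in> Ainf \<longrightarrow>
        riesz_opnorm \<alpha> p \<sigma> (weak_Lnorm q u)
          \<le> ennreal C * ennpowr (Ar_const (s_exp p q) u \<sigma>) (1 / q)
              * ennpowr (Ainf'_const u) (1 / conj_exp p)) \<and>
      (u \<in> Ainf \<and> \<sigma> \<in> Ainf \<longrightarrow>
        riesz_opnorm \<alpha> p \<sigma> (Lnorm q u)
          \<le> ennreal C * ennpowr (Ar_const (s_exp p q) u \<sigma>) (1 / q)
              * (ennpowr (Ainf'_const u) (1 / conj_exp p) + ennpowr (Ainf'_const \<sigma>) (1 / q))))"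
proof -
  define p' where "p' = conj_exp p"
  define r where "r = conj_exp q"
  \<comment> \<open>The exponent q is given only through 1/q; positivity of 1/q, which comes from p
    < n/\<alpha>, also excludes the default value 1/0 = 0.\<close>
  have "1/p > \<alpha> / real CARD('n)" using assms(1-4) by (simp add: field_simps)
  then have q0: "1/q > 0" using assms(5) by linarith
  then have "q > 0" by (simp add: zero_less_divide_iff)
  moreover have "1/q < 1/p" using assms(1,2,5) divide_pos_pos[of \<alpha> "real CARD('n)"] by linarith
  ultimately have pq: "p < q" using assms(3) by (simp add: field_simps)
  have pp: "1/p + 1/p' = 1" using assms(3) by (simp add: p'_def conj_exp_def field_simps)
  have qr: "1/q + 1/r = 1" using assms(3) pq by (simp add: r_def conj_exp_def field_simps)
  note exps = off_diagonal_exponents[OF assms(3) pq pp qr]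
  define C where "C = 6 powr (real CARD('n) - \<alpha>) * real (card (UNIV :: ('n \<Rightarrow> bool) set)) ^ 2 * form_const (real CARD('n)) \<alpha> p p' q r"
  have C: "C > 0"
    unfolding C_def using form_const_factors(5)[OF assms(1-3) pq pp qr] by (intro mult_pos_pos) auto
  have s: "s_exp p q = 1 + q / p'" by (simp add: s_exp_def p'_def)
  show ?thesis unfolding s p'_def[symmetric]
  proof (intro exI[of _ C] conjI C allI impI)
    fix u \<sigma> :: "real ^ 'n \<Rightarrow> real"
    assume w: "weight u" "weight \<sigma>" and A: "Ar_const (1 + q / p') u \<sigma> < \<infinity>"
    define a where "a = Ar_const (1 + q / p') u \<sigma>"
    \<comment> \<open>As 0 * \<infinity> = 0, a finite right-hand side yields a finite
      characteristic only for a > 0, which is exactly the conditional form required by the norm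
      bounds.\<close>
    have fin: "k < \<infinity>" if "ennreal C * ennpowr a (1/q) * ennpowr k s < \<infinity>" "a > 0" for k s
    proof (rule ccontr)
      assume "\<not> k < \<infinity>"
      then have "ennpowr k s = \<infinity>" by (simp add: ennpowr_def less_top[symmetric])
      moreover have "enn2real a > 0" using that(2) A by (simp add: a_def enn2real_positive_iff)
      then have "ennpowr a (1/q) > 0" by (simp add: ennpowr_def)
      ultimately show False using that(1) C by (simp add: ennreal_mult_less_top less_top[symmetric] ennreal_top_mult ennreal_mult_eq_top_iff)
    qed
    show "riesz_opnorm \<alpha> p \<sigma> (weak_Lnorm q u)
          \<le> ennreal C * ennpowr (Ar_const (1 + q / p') u \<sigma>) (1 / q) * ennpowr (Ainf'_const u) (1 / p')"
      unfolding a_def[symmetric]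
    proof (rule riesz_opnorm_le)
      fix f assume K: "ennreal C * ennpowr a (1/q) * ennpowr (Ainf'_const u) (1/p') < \<infinity>" and f: "f \<in> Lspace p \<sigma>"
      have "weak_Lnorm q u (riesz \<alpha> (\<lambda>x. f x * \<sigma> x))
          \<le> ennreal (C * (enn2real a powr (1/q) * enn2real (Ainf'_const u) powr (1/p'))) * Lnorm p \<sigma> (\<lambda>x. ereal (f x))"
        unfolding a_def C_def
        by (rule riesz_weak[OF w A _ assms(1-3) pq pp qr assms(5) f]) (use fin[OF K] in \<open>simp add: a_def\<close>)
      \<comment> \<open>\<open>enn2real\<close> sends \<infinity> to 0, so passing from real to
        extended values can only enlarge the bound.\<close>
      also have "ennreal (C * (enn2real a powr (1/q) * enn2real (Ainf'_const u) powr (1/p')))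
          \<le> ennreal C * ennpowr a (1/q) * ennpowr (Ainf'_const u) (1/p')"
        using C by (simp add: ennreal_mult mult.assoc) (intro mult_left_mono mult_mono ennpowr_ge; simp)
      finally show "weak_Lnorm q u (riesz \<alpha> (\<lambda>x. f x * \<sigma> x))
          \<le> ennreal C * ennpowr a (1/q) * ennpowr (Ainf'_const u) (1/p') * Lnorm p \<sigma> (\<lambda>x. ereal (f x))"
        by (simp add: mult_right_mono)
    qed
    show "riesz_opnorm \<alpha> p \<sigma> (Lnorm q u)
          \<le> ennreal C * ennpowr (Ar_const (1 + q / p') u \<sigma>) (1 / q)
              * (ennpowr (Ainf'_const u) (1 / p') + ennpowr (Ainf'_const \<sigma>) (1 / q))"
      unfolding a_def[symmetric]
    proof (rule riesz_opnorm_le)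
      fix f assume K: "ennreal C * ennpowr a (1/q) * (ennpowr (Ainf'_const u) (1/p') + ennpowr (Ainf'_const \<sigma>) (1/q)) < \<infinity>"
        and f: "f \<in> Lspace p \<sigma>"
      have K12: "ennreal C * ennpowr a (1/q) * ennpowr (Ainf'_const u) (1/p') < \<infinity>"
        "ennreal C * ennpowr a (1/q) * ennpowr (Ainf'_const \<sigma>) (1/q) < \<infinity>"
        using K by (simp_all add: distrib_left less_top[symmetric])
      have "Lnorm q u (riesz \<alpha> (\<lambda>x. f x * \<sigma> x))
          \<le> ennreal (C * (enn2real a powr (1/q) * (enn2real (Ainf'_const u) powr (1/p') + enn2real (Ainf'_const \<sigma>) powr (1/q))))
              * Lnorm p \<sigma> (\<lambda>x. ereal (f x))"
        unfolding a_def C_def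
        by (rule riesz_strong[OF w A _ assms(1-3) pq pp qr assms(5) f]) (use fin[OF K12(1)] fin[OF K12(2)] in \<open>simp_all add: a_def\<close>)
      also have "ennreal (C * (enn2real a powr (1/q) * (enn2real (Ainf'_const u) powr (1/p') + enn2real (Ainf'_const \<sigma>) powr (1/q))))
          \<le> ennreal C * ennpowr a (1/q) * (ennpowr (Ainf'_const u) (1/p') + ennpowr (Ainf'_const \<sigma>) (1/q))"
        using C by (simp add: ennreal_mult mult.assoc) (intro mult_left_mono mult_mono add_mono ennpowr_ge; simp)
      finally show "Lnorm q u (riesz \<alpha> (\<lambda>x. f x * \<sigma> x))
          \<le> ennreal C * ennpowr a (1/q) * (ennpowr (Ainf'_const u) (1/p') + ennpowr (Ainf'_const \<sigma>) (1/q))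
              * Lnorm p \<sigma> (\<lambda>x. ereal (f x))"
        by (simp add: mult_right_mono)
    qed
  qed
qed

end
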